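(* There exists a constant $\alpha>0$ such that \[\mathbb{P}\left[M_n(p)\text{ is strongly non-singular}\right]\ge 1-\frac53\,p-O(p^{1+\alpha})\] for all $p\in(0,1)$, and this bound is tight. In particular, for $\xi\sim\mathrm{Uniform}\big(\{2^j\}_{j=0}^{\lfloor 1/p\rfloor}\cup\{0\}\big)$, \[\mathbb{P}\left[M_n(\xi)\text{ is strongly non-singular}\right]= 1-\frac53\,p-O(p^{1+\alpha}).\]
   Context: For a discrete random variable $\xi$, $|\xi|_\infty:=\max_{a\in\mathbb{R}}\mathbb{P}[\xi=a]$. $M_n(p)$ denotes an arbitrary $n\times n$ random matrix with independent (not necessarily identically distributed) entries $\xi_{ij}$, where each $\xi_{ij}$ is a discrete random variable, possibly taking infinitely many values, with $|\xi_{ij}|_\infty\le p$ for all $i,j\in\{1,\dots,n\}$. For a discrete random variable $\xi$, $M_n(\xi)$ denotes an $n\times n$ random matrix with entries independently distributed according to $\xi$. $\mathrm{Uniform}(S)$ is the uniform distribution on the finite set $S$. An $n\times n$ matrix is strongly non-singular if its leading $k\times k$ principal minor is non-zero for every $k\in\{1,\dots,n\}$. $O(\cdot)$ is the usual big-O notation.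
   Formalization: Tightness and the explicit equality for the powers-of-two law are stated for n ≥ 2 only; for n = 1 they fail, since the probability there is 1 − 1/(⌊1/p⌋+2) = 1 − p + O(p²). The lower bound is stated for all n ≥ 1. *)

theory Defs
  imports "HOL-Probability.Probability" "Jordan_Normal_Form.Determinant"
begin

text \<open>
  A discrete real random variable is represented by its law, a \<^typ>\<open>real pmf\<close>, and a random
  matrix by its law on \<^typ>\<open>real mat\<close>. Rows and columns are indexed by \<open>0, ..., n - 1\<close>.
\<close>

definition max_atom :: "real pmf \<Rightarrow> real" where
  \<comment> \<open>The supremum is attained, so this is a maximum; \<open>Max\<close> is not
      applicable because the range of the mass function may be infinite.\<close>
  "max_atom \<xi> = (SUP a. pmf \<xi> a)"

definition indep_matrix :: "nat \<Rightarrow> (nat \<Rightarrow> nat \<Rightarrow> real pmf) \<Rightarrow> real mat pmf" where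
  \<comment> \<open>Independence of the entries is the product law; the default value 0 only fills
      positions outside the matrix and is never read.\<close>
  "indep_matrix n \<xi> = map_pmf (mat n n) (Pi_pmf ({0..<n} \<times> {0..<n}) 0 (\<lambda>(i, j). \<xi> i j))"

definition iid_matrix :: "nat \<Rightarrow> real pmf \<Rightarrow> real mat pmf" where
  "iid_matrix n \<xi> = indep_matrix n (\<lambda>_ _. \<xi>)"

definition entries_bounded :: "nat \<Rightarrow> real \<Rightarrow> (nat \<Rightarrow> nat \<Rightarrow> real pmf) \<Rightarrow> bool" where
  "entries_bounded n p \<xi> \<longleftrightarrow> (\<forall>i<n. \<forall>j<n. max_atom (\<xi> i j) \<le> p)"

definition leading_minor :: "real mat \<Rightarrow> nat \<Rightarrow> real" where
  "leading_minor A k = det (mat k k (\<lambda>(i, j). A $$ (i, j)))"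

definition strongly_nonsingular :: "real mat \<Rightarrow> bool" where
  "strongly_nonsingular A \<longleftrightarrow> (\<forall>k\<in>{1..dim_row A}. leading_minor A k \<noteq> 0)"

definition prob_strongly_nonsingular :: "real mat pmf \<Rightarrow> real" where
  "prob_strongly_nonsingular A = measure_pmf.prob A {B. strongly_nonsingular B}"

definition powers_of_two_law :: "real \<Rightarrow> real pmf" where
  "powers_of_two_law p = pmf_of_set ((\<lambda>j. 2 ^ j) ` {0..nat \<lfloor>1 / p\<rfloor>} \<union> {0})"

end

theory Submission
  imports Defs "HOL-Real_Asymp.Real_Asymp"
begin

text \<open>
  Let \<open>m\<close> be the size of the last non-zero leading minor before the first zero one. The case \<open>m = 0\<close>
  costs \<open>p\<close>. The case \<open>m = 1\<close> is the equation \<open>a * d = b * c\<close> among independent entries; by two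
  applications of Cauchy--Schwarz it reduces to the multiplicative energy of a single law, which is at
  most \<open>2/3 * p + O(p\<^sup>2)\<close>, as for a geometric progression.

  For \<open>m \<ge> 2\<close> the last row is orthogonal to the vector \<open>v\<close> that is normal to the previous rows. Three
  coordinates of \<open>v\<close> suffice for a probability \<open>O(p powr (7/6))\<close>: only few ratios \<open>v 0 / v 1\<close> can be bad, by an
  incidence bound for grids, and each is attained with probability at most \<open>p\<close>.
  A bound \<open>O(m powr (-28))\<close> makes the sum over \<open>m\<close> converge. Here the collision probability (energy) of
  the partial sums of \<open>\<Sum>j. x j * v j\<close> is followed. If the whole sum is concentrated, then a set \<open>J\<close> of
  \<open>O(log m)\<close> coordinates determines, up to about \<open>1 / energy J\<close> choices each, almost all others, while every
  row annihilates \<open>v\<close> with probability at most \<open>(1 - 1/200) * energy J\<close>. So such a \<open>v\<close> exists with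
  exponentially small probability.
\<close>

section \<open>Collision probabilities\<close>

text \<open>The estimate must be uniform in \<open>n\<close>, so the failure probabilities for all
  \<open>m\<close> have to be summed. The bound in \<open>p\<close> alone does not decay in
  \<open>m\<close>, and the bound in \<open>m\<close> alone carries no power of \<open>p\<close>.
  Their weighted geometric mean with exponents 13/14 and 1/14 is a multiple of
  \<open>p powr (13/12) / m\<^sup>2\<close>. This is why a decay as fast as 28 is asked for, and
  where \<alpha> = 1/12 comes from. The obstacle for large \<open>m\<close> is that the normal
  vector ranges over a continuum and the entries may take infinitely many values with unrelated
  laws. Hence the estimates use only inner products of mass functions, for which Cauchy-Schwarz
  separates different laws. The constant 2/3 is four times 1/6, the integral of
  \<open>(1 - 2 * t)\<^sup>2\<close> over \<open>0 \<le> t \<le> 1/2\<close>: for uniform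
  \<open>U\<close> the number \<open>min U (1 - U)\<close> exceeds \<open>t\<close> with probability
  \<open>1 - 2 * t\<close>, and an inner pair needs both its members above the level.\<close>

lemma prob_bind_pmf:
  "measure_pmf.prob (bind_pmf M f) A = measure_pmf.expectation M (\<lambda>x. measure_pmf.prob (f x) A)"
proof -
  have "ennreal (measure_pmf.prob (bind_pmf M f) A)
      = (\<integral>\<^sup>+ x. ennreal (measure_pmf.prob (f x) A) \<partial>measure_pmf M)"
    by (simp flip: measure_pmf.emeasure_eq_measure)
  also have "\<dots> = ennreal (measure_pmf.expectation M (\<lambda>x. measure_pmf.prob (f x) A))"
    by (intro nn_integral_eq_integral measure_pmf.integrable_const_bound[where B = 1]) auto
  finally show ?thesis
    by (simp add: integral_nonneg_AE)
qed

lemma prob_pair_pmf: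
  "measure_pmf.prob (pair_pmf M N) A
    = measure_pmf.expectation M (\<lambda>x. measure_pmf.prob N {y. (x, y) \<in> A})"
proof -
  have "pair_pmf M N = bind_pmf M (\<lambda>x. map_pmf (Pair x) N)"
    by (simp add: pair_pmf_def map_pmf_def)
  then show ?thesis
    by (simp add: prob_bind_pmf vimage_def)
qed

lemma prob_pair_le:
  assumes "\<And>x. x \<in> set_pmf M \<Longrightarrow> measure_pmf.prob N {y. (x, y) \<in> A} \<le> b"
  shows "measure_pmf.prob (pair_pmf M N) A \<le> b"
proof -
  have "measure_pmf.expectation M (\<lambda>x. measure_pmf.prob N {y. (x, y) \<in> A})
      \<le> measure_pmf.expectation M (\<lambda>_. b)"
  proof (rule integral_mono_AE)
    show "integrable M (\<lambda>x. measure_pmf.prob N {y. (x, y) \<in> A})"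
      by (rule measure_pmf.integrable_const_bound[where B = 1]) auto
  qed (use assms in \<open>auto simp: AE_measure_pmf_iff\<close>)
  then show ?thesis by (simp add: prob_pair_pmf)
qed

lemma prob_pair_mult_le:
  assumes "\<And>x. x \<in> set_pmf M \<Longrightarrow> P x \<Longrightarrow> measure_pmf.prob N {y. (x, y) \<in> A} \<le> b"
    and "\<And>x y. (x, y) \<in> A \<Longrightarrow> P x"
  shows "measure_pmf.prob (pair_pmf M N) A \<le> measure_pmf.prob M {x. P x} * b"
proof -
  have "measure_pmf.expectation M (\<lambda>x. measure_pmf.prob N {y. (x, y) \<in> A})
      \<le> measure_pmf.expectation M (\<lambda>x. indicator {x. P x} x * b)"
  proof (rule integral_mono_AE)
    show "integrable M (\<lambda>x. measure_pmf.prob N {y. (x, y) \<in> A})"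
      by (rule measure_pmf.integrable_const_bound[where B = 1]) auto
    show "integrable M (\<lambda>x. indicator {x. P x} x * b)"
      by (intro integrable_mult_left measure_pmf.integrable_const_bound[where B = 1]) auto
    have "measure_pmf.prob N {y. (x, y) \<in> A} \<le> indicator {x. P x} x * b" if "x \<in> set_pmf M" for x
    proof (cases "P x")
      case False
      then have "{y. (x, y) \<in> A} = {}" using assms(2) by blast
      then show ?thesis using False by simp
    qed (use assms(1)[OF that] in simp)
    then show "AE x in M. measure_pmf.prob N {y. (x, y) \<in> A} \<le> indicator {x. P x} x * b"
      by (simp add: AE_measure_pmf_iff)
  qed
  then show ?thesis by (simp add: prob_pair_pmf)
qed

lemma prob_pair_ge:
  assumes "\<And>x. P x \<Longrightarrow> b \<le> measure_pmf.prob N {y. (x, y) \<in> A}"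
  shows "measure_pmf.prob M {x. P x} * b \<le> measure_pmf.prob (pair_pmf M N) A"
proof -
  have "measure_pmf.expectation M (\<lambda>x. indicator {x. P x} x * b)
      \<le> measure_pmf.expectation M (\<lambda>x. measure_pmf.prob N {y. (x, y) \<in> A})"
    using assms
    by (intro integral_mono_AE measure_pmf.integrable_const_bound[where B = 1]
        integrable_mult_left) (auto simp: indicator_def)
  then show ?thesis by (simp add: prob_pair_pmf)
qed

lemma prob_pair_Times:
  "measure_pmf.prob (pair_pmf M N) (A \<times> B) = measure_pmf.prob M A * measure_pmf.prob N B"
proof -
  have "measure_pmf.prob N {y. (x, y) \<in> A \<times> B} = indicator A x * measure_pmf.prob N B" for x
    by (cases "x \<in> A") auto
  then show ?thesis by (simp add: prob_pair_pmf)
qed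

lemma prob_pair_swap:
  "measure_pmf.prob (pair_pmf M N) A = measure_pmf.prob (pair_pmf N M) {z. (snd z, fst z) \<in> A}"
  by (subst pair_commute_pmf) (simp add: vimage_def case_prod_unfold)

text \<open>The inner product of the two mass functions in l2 (\<open>coll_integral\<close>), so
  \<open>coll M M\<close> is a squared norm. Distances and translations in l2 carry the estimates
  that follow.\<close>

definition coll :: "'a pmf \<Rightarrow> 'a pmf \<Rightarrow> real" where
  "coll M N = measure_pmf.prob (pair_pmf M N) {z. fst z = snd z}"

lemma coll_expectation: "coll M N = measure_pmf.expectation M (pmf N)"
proof -
  have "measure_pmf.prob N {y. x = y} = pmf N x" for x
    by (simp add: measure_pmf_single)
  then show ?thesis by (simp add: coll_def prob_pair_pmf)
qed

lemma coll_nonneg [simp]: "0 \<le> coll M N"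
  by (simp add: coll_def)

lemma coll_le_1: "coll M N \<le> 1"
  by (simp add: coll_def)

lemma coll_le:
  assumes "\<And>x. pmf N x \<le> b"
  shows "coll M N \<le> b"
  unfolding coll_def
  by (rule prob_pair_le) (simp add: assms measure_pmf_single)

lemma coll_map_inj:
  assumes "inj f"
  shows "coll (map_pmf f M) (map_pmf f N) = coll M N"
proof -
  have "pair_pmf (map_pmf f M) (map_pmf f N) = map_pmf (\<lambda>(a, b). (f a, f b)) (pair_pmf M N)"
    by (simp add: map_pair)
  then show ?thesis
    using assms by (simp add: coll_def vimage_def case_prod_unfold inj_eq)
qed

lemma integrable_pmf_mult: "integrable (count_space UNIV) (\<lambda>x. pmf M x * pmf N x)"
proof (rule Bochner_Integration.integrable_bound[OF integrable_pmf[of UNIV M]])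
  show "AE x in count_space UNIV. norm (pmf M x * pmf N x) \<le> norm (pmf M x)"
    by (simp add: pmf_le_1 mult_left_le)
qed simp

lemma coll_integral: "coll M N = (\<integral>x. pmf M x * pmf N x \<partial>count_space UNIV)"
proof -
  have "measure_pmf.expectation M (pmf N) = (\<integral>x. pmf M x *\<^sub>R pmf N x \<partial>count_space UNIV)"
    unfolding measure_pmf_eq_density by (subst integral_density) auto
  then show ?thesis by (simp add: coll_expectation)
qed

text \<open>The squared l2 norm of a combination of three mass functions, expanded. It serves
  Cauchy-Schwarz (with \<open>c = 0\<close>) and the parallelogram argument of
  \<open>coll_triangle\<close> alike.\<close>

lemma coll_quadratic_nonneg:
  "0 \<le> a\<^sup>2 * coll A A + b\<^sup>2 * coll B B + c\<^sup>2 * coll C C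
      + 2 * a * b * coll A B + 2 * a * c * coll A C + 2 * b * c * coll B C"
proof -
  have "0 \<le> (\<integral>x. (a * pmf A x + b * pmf B x + c * pmf C x)\<^sup>2 \<partial>count_space UNIV)"
    by (intro integral_nonneg_AE) auto
  also have "\<dots> = (\<integral>x. a\<^sup>2 * (pmf A x * pmf A x) + b\<^sup>2 * (pmf B x * pmf B x)
      + c\<^sup>2 * (pmf C x * pmf C x) + 2 * a * b * (pmf A x * pmf B x)
      + 2 * a * c * (pmf A x * pmf C x) + 2 * b * c * (pmf B x * pmf C x) \<partial>count_space UNIV)"
    by (intro Bochner_Integration.integral_cong) (auto simp: power2_eq_square algebra_simps)
  also have "\<dots> = a\<^sup>2 * coll A A + b\<^sup>2 * coll B B + c\<^sup>2 * coll C C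
      + 2 * a * b * coll A B + 2 * a * c * coll A C + 2 * b * c * coll B C"
    unfolding coll_integral
    by (subst Bochner_Integration.integral_add; (intro Bochner_Integration.integrable_add integrable_mult_right integrable_pmf_mult)?)+
       simp
  finally show ?thesis .
qed

lemma coll_ge_pmf_sq: "(pmf M x)\<^sup>2 \<le> coll M M"
proof -
  have "pmf M x * pmf M x = measure_pmf.prob (pair_pmf M M) {(x, x)}"
    by (simp add: measure_pmf_single pmf_pair)
  also have "\<dots> \<le> coll M M"
    unfolding coll_def by (intro measure_pmf.finite_measure_mono) auto
  finally show ?thesis by (simp add: power2_eq_square)
qed

lemma coll_pos: "0 < coll M M"
proof -
  obtain x where "x \<in> set_pmf M" using set_pmf_not_empty[of M] by blast
  then have "0 < (pmf M x)\<^sup>2" by (simp add: set_pmf_iff)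
  then show ?thesis using coll_ge_pmf_sq[of M x] by linarith
qed

lemma coll_Cauchy_Schwarz: "coll M N \<le> sqrt (coll M M * coll N N)"
proof (rule real_le_rsqrt)
  let ?m = "coll M M" and ?n = "coll N N" and ?i = "coll M N"
  have "0 \<le> ?n\<^sup>2 * ?m + (- ?i)\<^sup>2 * ?n + 2 * ?n * (- ?i) * ?i"
    using coll_quadratic_nonneg[of ?n M "- ?i" N 0 M] by simp
  then have "0 \<le> ?n * (?m * ?n - ?i\<^sup>2)" by (simp add: power2_eq_square algebra_simps)
  then show "?i\<^sup>2 \<le> ?m * ?n" using coll_pos[of N] by (simp add: zero_le_mult_iff)
qed

text \<open>In l2 this is \<open>|A - C|^2 \<le> 2 |A - B|^2 + 2 |B - C|^2\<close>; the difference
  of the two sides is the squared norm of \<open>A - 2 B + C\<close>.\<close>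

lemma coll_triangle:
  "coll A A + coll C C - 2 * coll A C
    \<le> 2 * (coll A A + coll B B - 2 * coll A B) + 2 * (coll B B + coll C C - 2 * coll B C)"
  using coll_quadratic_nonneg[of 1 A "-2" B 1 C] by simp

section \<open>Sums of independent variables and autocorrelation\<close>

definition conv :: "real pmf \<Rightarrow> real pmf \<Rightarrow> real pmf" where
  "conv M N = map_pmf (\<lambda>(x, y). x + y) (pair_pmf M N)"

definition diff_pmf :: "real pmf \<Rightarrow> real pmf" where
  "diff_pmf M = map_pmf (\<lambda>(x, y). x - y) (pair_pmf M M)"

lemma pmf_diff_pmf: "pmf (diff_pmf M) t = coll M (map_pmf (\<lambda>x. x + t) M)"
  unfolding coll_def pair_map_pmf2 diff_pmf_def pmf_map
  by (auto simp: vimage_def case_prod_unfold algebra_simps intro!: arg_cong[where f = "measure_pmf.prob _"])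

lemma coll_shift: "coll (map_pmf (\<lambda>x. x + t) M) (map_pmf (\<lambda>x. x + t) N) = coll M (N :: real pmf)"
  by (rule coll_map_inj) (simp add: inj_def)

text \<open>The autocorrelation is largest at \<open>0\<close>, since a translation preserves the
  norm.\<close>

lemma pmf_diff_le: "pmf (diff_pmf M) t \<le> coll M M"
proof -
  have "coll M (map_pmf (\<lambda>x. x + t) M) \<le> sqrt (coll M M * coll M M)"
    using coll_Cauchy_Schwarz[of M "map_pmf (\<lambda>x. x + t) M"] by (simp add: coll_shift)
  then show ?thesis by (simp add: pmf_diff_pmf)
qed

text \<open>\<open>coll M M - pmf (diff_pmf M) t\<close> is half the squared distance from
  \<open>M\<close> to its translate by \<open>t\<close>. Hence sums of near-periods of
  \<open>M\<close> are near-periods, with the loss of \<open>coll_triangle\<close>.\<close>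

lemma diff_pmf_defect:
  "coll M M - pmf (diff_pmf M) (s + t)
    \<le> 2 * (coll M M - pmf (diff_pmf M) s) + 2 * (coll M M - pmf (diff_pmf M) t)"
proof -
  let ?S = "\<lambda>t. map_pmf (\<lambda>x. x + t) M"
  have "?S (s + t) = map_pmf (\<lambda>x. x + s) (?S t)"
    by (simp add: pmf.map_comp o_def add_ac)
  then have "coll (?S s) (?S (s + t)) = coll M (?S t)"
    by (simp add: coll_shift)
  then show ?thesis
    using coll_triangle[of M "?S (s + t)" "?S s"] by (simp add: coll_shift pmf_diff_pmf)
qed

lemma pmf_conv_le: "pmf (conv M N) z \<le> sqrt (coll M M * coll N N)"
proof -
  have "pmf (conv M N) z = coll M (map_pmf (\<lambda>y. z - y) N)"
    unfolding coll_def conv_def pair_map_pmf2 pmf_map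
    by (auto simp: vimage_def case_prod_unfold algebra_simps intro!: arg_cong[where f = "measure_pmf.prob _"])
  also have "\<dots> \<le> sqrt (coll M M * coll (map_pmf (\<lambda>y. z - y) N) (map_pmf (\<lambda>y. z - y) N))"
    by (rule coll_Cauchy_Schwarz)
  also have "coll (map_pmf (\<lambda>y. z - y) N) (map_pmf (\<lambda>y. z - y) N) = coll N N"
    by (rule coll_map_inj) (simp add: inj_def)
  finally show ?thesis .
qed

lemma pair_pair_regroup:
  "pair_pmf (pair_pmf A B) (pair_pmf C D)
    = map_pmf (\<lambda>((a, c), (b, d)). ((a, b), (c, d))) (pair_pmf (pair_pmf A C) (pair_pmf B D))"
proof (rule pmf_eqI)
  fix z :: "('a \<times> 'b) \<times> 'c \<times> 'd"
  let ?f = "\<lambda>((a, c), (b, d)). ((a, b), (c, d))"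
  obtain a b c d where z: "z = ((a, b), (c, d))" by (metis surj_pair)
  have "inj ?f" by (auto simp: inj_def)
  from pmf_map_inj'[OF this, of "pair_pmf (pair_pmf A C) (pair_pmf B D)" "((a, c), (b, d))"]
  show "pmf (pair_pmf (pair_pmf A B) (pair_pmf C D)) z
      = pmf (map_pmf ?f (pair_pmf (pair_pmf A C) (pair_pmf B D))) z"
    by (simp add: z pmf_pair)
qed

text \<open>A collision \<open>x + y = x' + y'\<close> is read as \<open>x - x' = y' - y\<close>,
  which averages the autocorrelation of \<open>M\<close> over the differences of
  \<open>N\<close>.\<close>

lemma coll_conv:
  "coll (conv M N) (conv M N) = measure_pmf.expectation (diff_pmf N) (pmf (diff_pmf M))"
proof -
  have "coll (conv M N) (conv M N)
      = measure_pmf.prob (pair_pmf (pair_pmf M N) (pair_pmf M N))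
          {z. fst (fst z) + snd (fst z) = fst (snd z) + snd (snd z)}"
    by (simp add: coll_def conv_def pair_map_pmf1 pair_map_pmf2 vimage_def case_prod_unfold)
  also have "\<dots> = measure_pmf.prob (pair_pmf (pair_pmf M M) (pair_pmf N N))
      {z. fst (fst z) - snd (fst z) = snd (snd z) - fst (snd z)}"
    by (subst pair_pair_regroup) (auto simp: vimage_def case_prod_unfold algebra_simps
        intro!: arg_cong[where f = "measure_pmf.prob _"])
  also have "\<dots> = measure_pmf.prob (pair_pmf (pair_pmf N N) (pair_pmf M M))
      {z. fst (snd z) - snd (snd z) = snd (fst z) - fst (fst z)}"
    by (subst prob_pair_swap) simp
  also have "\<dots> = measure_pmf.expectation (pair_pmf N N) (\<lambda>z. pmf (diff_pmf M) (snd z - fst z))"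
    by (simp add: prob_pair_pmf diff_pmf_def pmf_map vimage_def case_prod_unfold)
  also have "\<dots> = measure_pmf.expectation (pair_pmf N N) (\<lambda>z. pmf (diff_pmf M) (fst z - snd z))"
    by (subst pair_commute_pmf) (simp add: case_prod_unfold)
  finally show ?thesis by (simp add: diff_pmf_def case_prod_unfold)
qed

lemma coll_conv_le: "coll (conv M N) (conv M N) \<le> coll M M"
proof -
  have "coll (conv M N) (conv M N) \<le> measure_pmf.expectation (diff_pmf N) (\<lambda>_. coll M M)"
    unfolding coll_conv
    by (intro integral_mono_AE measure_pmf.integrable_const_bound[where B = 1])
       (auto simp: pmf_diff_le pmf_le_1 coll_le_1)
  then show ?thesis by simp
qed

text \<open>The translates of \<open>S\<close> by its minimum and by its maximum share at most the
  point \<open>Max S + Min S\<close>.\<close>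

lemma card_sumset_ge:
  fixes S :: "real set"
  assumes "finite S" "S \<noteq> {}"
  shows "2 * card S \<le> card ((\<lambda>(a, b). a + b) ` (S \<times> S)) + 1"
proof -
  let ?T = "(\<lambda>(a, b). a + b) ` (S \<times> S)"
  let ?A = "(\<lambda>a. a + Min S) ` S" and ?B = "(\<lambda>b. Max S + b) ` S"
  have "Min S \<in> S" "Max S \<in> S" using assms by auto
  then have "?A \<union> ?B \<subseteq> ?T" by blast
  then have "card (?A \<union> ?B) \<le> card ?T" using assms by (intro card_mono) auto
  moreover have "?A \<inter> ?B \<subseteq> {Max S + Min S}"
  proof
    fix x assume "x \<in> ?A \<inter> ?B"
    then obtain a b where "a \<in> S" "b \<in> S" "x = a + Min S" "x = Max S + b" by auto
    then show "x \<in> {Max S + Min S}"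
      using Max_ge[OF assms(1), of a] Min_le[OF assms(1), of b] by simp
  qed
  then have "card (?A \<inter> ?B) \<le> 1" using card_mono[of "{Max S + Min S}"] by simp
  moreover have "card ?A = card S" "card ?B = card S" by (auto intro!: card_image inj_onI)
  ultimately show ?thesis using card_Un_Int[of ?A ?B] assms by simp
qed

text \<open>Without a gain the differences of \<open>N\<close> would almost always be near-periods
  of \<open>M\<close>, and no difference is likely, so the set \<open>S\<close> of near-periods has
  about \<open>1 / b\<close> elements. By \<open>diff_pmf_defect\<close> the sumset of
  \<open>S\<close> still consists of near-periods, but it is almost twice as large, and the
  autocorrelation of \<open>M\<close> would have total mass above 1.\<close>

lemma coll_conv_gain:
  assumes "coll M M \<le> b" "coll N N \<le> b" "b \<le> 1/4"
  shows "coll (conv M N) (conv M N) \<le> (1 - 1/200) * b"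
proof (rule ccontr)
  let ?g = "pmf (diff_pmf M)"
  assume "\<not> ?thesis"
  then have big: "(1 - 1/200) * b < coll (conv M N) (conv M N)" by simp
  have b0: "0 < b" using coll_pos[of M] assms by linarith
  define S where "S = {t. (1 - 1/20) * b \<le> ?g t}"
  have card_le: "real (card T) * h \<le> 1" if "finite T" "\<And>t. t \<in> T \<Longrightarrow> h \<le> ?g t" for T h
  proof -
    have "real (card T) * h = (\<Sum>t\<in>T. h)" by simp
    also have "\<dots> \<le> (\<Sum>t\<in>T. ?g t)" using that by (intro sum_mono)
    also have "\<dots> \<le> 1" using that by (simp flip: measure_measure_pmf_finite)
    finally show ?thesis .
  qed
  have fin: "finite S"
  proof (rule ccontr)
    assume "infinite S"
    obtain m :: nat where m: "1 / ((1 - 1/20) * b) < m" using reals_Archimedean2 by blast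
    obtain T where T: "T \<subseteq> S" "finite T" "card T = m"
      using infinite_arbitrarily_large[OF \<open>infinite S\<close>] by blast
    have "real m * ((1 - 1/20) * b) \<le> 1" using card_le[of T "(1 - 1/20) * b"] T by (auto simp: S_def)
    with m b0 show False by (simp add: field_simps)
  qed
  define P where "P = measure_pmf.prob (diff_pmf N) S"
  have "coll (conv M N) (conv M N)
      \<le> measure_pmf.expectation (diff_pmf N) (\<lambda>t. (1 - 1/20) * b + indicator S t * (b / 20))"
    unfolding coll_conv
  proof (intro integral_mono_AE measure_pmf.integrable_const_bound[where B = 1])
    have "?g t \<le> (1 - 1/20) * b + indicator S t * (b / 20)" for t
      using pmf_diff_le[of M t] assms(1) by (auto simp: S_def indicator_def)
    then show "AE t in diff_pmf N. ?g t \<le> (1 - 1/20) * b + indicator S t * (b / 20)" by simp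
  qed (use b0 assms(3) in \<open>auto simp: pmf_le_1 indicator_def\<close>)
  also have "\<dots> = (1 - 1/20) * b + P * (b / 20)"
  proof -
    have "integrable (diff_pmf N) (\<lambda>t. indicator S t * (b / 20))"
      by (intro integrable_mult_left measure_pmf.integrable_const_bound[where B = 1]) auto
    then show ?thesis unfolding P_def by (subst Bochner_Integration.integral_add) auto
  qed
  \<comment> \<open>The threshold 1/20 is ten times the assumed loss 1/200, so the mass outside
    \<open>S\<close> is at most 1/10.\<close>
  finally have "b * (9/10) \<le> b * P" using big by (simp add: algebra_simps)
  then have P: "9/10 \<le> P" using b0 by simp
  have "P \<le> real (card S) * b"
  proof -
    have "P = (\<Sum>t\<in>S. pmf (diff_pmf N) t)" unfolding P_def by (rule measure_measure_pmf_finite[OF fin])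
    also have "\<dots> \<le> (\<Sum>t\<in>S. b)"
      using pmf_diff_le[of N] assms(2) by (intro sum_mono) (meson order_trans)
    finally show ?thesis by simp
  qed
  with P have S1: "9/10 \<le> real (card S) * b" by linarith
  then have "S \<noteq> {}" using b0 by auto
  let ?T = "(\<lambda>(a, b). a + b) ` (S \<times> S)"
  have T: "2 * real (card S) \<le> real (card ?T) + 1"
    using card_sumset_ge[OF fin \<open>S \<noteq> {}\<close>] by linarith
  have M_ge: "(1 - 1/200) * b < coll M M" using big coll_conv_le[of M N] by linarith
  have "(1 - 1/200 - 4/20) * b \<le> ?g t" if "t \<in> ?T" for t
  proof -
    obtain s u where "t = s + u" "s \<in> S" "u \<in> S" using \<open>t \<in> ?T\<close> by auto
    then show ?thesis using diff_pmf_defect[of M s u] assms(1) M_ge by (simp add: S_def algebra_simps)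
  qed
  then have "real (card ?T) * ((1 - 1/200 - 4/20) * b) \<le> 1" using fin by (intro card_le) auto
  moreover have "(2 * real (card S) - 1) * ((1 - 1/200 - 4/20) * b) \<le> real (card ?T) * ((1 - 1/200 - 4/20) * b)"
    using T b0 by (intro mult_right_mono) auto
  \<comment> \<open>Here \<open>(1 - 1/200 - 4/20) * (2 * 9/10 - 1/4) > 1\<close>; the bound
    \<open>b \<le> 1/4\<close> absorbs the \<open>- 1\<close> in the size of the sumset.\<close>
  ultimately show False using S1 assms(3) by (simp add: algebra_simps)
qed

section \<open>Quantiles and rich slopes\<close>

text \<open>The support may be infinite and even dense, so minima and maxima over it need not exist.
  They will be taken over a finite set that carries all but \<open>e\<close> of the mass.\<close>

lemma finite_pmf_approx:
  assumes "0 < e"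
  obtains Q where "finite Q" "measure_pmf.prob M (- Q) < e"
proof (cases "finite (set_pmf M)")
  case True
  have "measure_pmf.prob M (- set_pmf M) = 0"
    by (simp add: measure_pmf_zero_iff)
  then show ?thesis using that[OF True] assms by simp
next
  case False
  define A where "A n = from_nat_into (set_pmf M) ` {..<n}" for n
  have "incseq A" by (force simp: A_def incseq_def)
  then have "(\<lambda>n. measure_pmf.prob M (A n)) \<longlonglongrightarrow> measure_pmf.prob M (\<Union>n. A n)"
    by (intro measure_pmf.finite_Lim_measure_incseq) auto
  also have "(\<Union>n. A n) = set_pmf M"
    using range_from_nat_into[OF set_pmf_not_empty, of M] by (fastforce simp: A_def)
  finally have "(\<lambda>n. measure_pmf.prob M (A n)) \<longlonglongrightarrow> 1"
    by (subst (asm) measure_pmf.prob_eq_1[THEN iffD2, of "set_pmf M"]) (auto simp: AE_measure_pmf_iff)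
  then have "eventually (\<lambda>n. 1 - e < measure_pmf.prob M (A n)) sequentially"
    by (rule order_tendstoD) (use assms in simp)
  then obtain n where "1 - e < measure_pmf.prob M (A n)"
    by (auto simp: eventually_sequentially)
  then have "measure_pmf.prob M (- A n) < e"
    using measure_pmf.prob_compl[of "A n" M] by (simp add: Compl_eq_Diff_UNIV)
  then show ?thesis using that[of "A n"] by (simp add: A_def)
qed

text \<open>Otherwise take, inside a finite set of almost full mass, the least point outside the
  quantile set. Everything below it is in the quantile set or negligible, yet has mass at least
  \<open>u\<close>.\<close>

lemma quantile_ge:
  fixes M :: "real pmf"
  assumes "u \<le> 1"
  shows "u \<le> measure_pmf.prob M {x. measure_pmf.prob M {..<x} < u}"
proof (rule ccontr)
  let ?S = "{x. measure_pmf.prob M {..<x} < u}"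
  assume "\<not> ?thesis"
  then have less: "measure_pmf.prob M ?S < u" by simp
  obtain Q where Q: "finite Q" "measure_pmf.prob M (- Q) < u - measure_pmf.prob M ?S"
    using finite_pmf_approx[of "u - measure_pmf.prob M ?S" M] less by auto
  define R where "R = Q - ?S"
  have "R \<noteq> {}"
  proof
    assume "R = {}"
    then have "UNIV = ?S \<union> - Q" by (auto simp: R_def)
    then have "1 \<le> measure_pmf.prob M ?S + measure_pmf.prob M (- Q)"
      using measure_Un_le[of ?S M "- Q"] by simp
    with Q less assms show False by linarith
  qed
  define x where "x = Min R"
  have x: "x \<in> R" and x_le: "\<And>y. y \<in> R \<Longrightarrow> x \<le> y"
    using \<open>R \<noteq> {}\<close> Q Min_in[of R] Min_le[of R] by (auto simp: x_def R_def)
  have "u \<le> measure_pmf.prob M {..<x}" using x by (auto simp: R_def)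
  also have "\<dots> \<le> measure_pmf.prob M (?S \<union> - Q)"
    by (rule measure_pmf.finite_measure_mono) (use x_le in \<open>force simp: R_def\<close>)+
  also have "\<dots> \<le> measure_pmf.prob M ?S + measure_pmf.prob M (- Q)"
    by (rule measure_Un_le) auto
  finally show False using Q by linarith
qed

text \<open>The overshoot is one atom: up to a negligible part the set lies in \<open>{..x}\<close>
  for one of its own points \<open>x\<close>, and \<open>{..<x}\<close> has mass below
  \<open>u\<close>.\<close>

lemma quantile_le:
  fixes M :: "real pmf"
  assumes atom: "\<And>x. pmf M x \<le> p" and "0 \<le> u"
  shows "measure_pmf.prob M {x. measure_pmf.prob M {..<x} < u} \<le> u + p"
proof (rule field_le_epsilon)
  fix e :: real assume "0 < e"
  let ?S = "{x. measure_pmf.prob M {..<x} < u}"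
  obtain Q where Q: "finite Q" "measure_pmf.prob M (- Q) < e"
    using finite_pmf_approx[OF \<open>0 < e\<close>] .
  have "0 \<le> p" using atom[of 0] pmf_nonneg[of M 0] by linarith
  have "measure_pmf.prob M (?S \<inter> Q) \<le> u + p"
  proof (cases "?S \<inter> Q = {}")
    case False
    define x where "x = Max (?S \<inter> Q)"
    have x: "x \<in> ?S" and x_ge: "\<And>y. y \<in> ?S \<inter> Q \<Longrightarrow> y \<le> x"
      using False Q Max_in[of "?S \<inter> Q"] by (auto simp: x_def)
    have "measure_pmf.prob M (?S \<inter> Q) \<le> measure_pmf.prob M ({..<x} \<union> {x})"
      by (rule measure_pmf.finite_measure_mono) (use x_ge in force)+
    also have "\<dots> \<le> measure_pmf.prob M {..<x} + measure_pmf.prob M {x}"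
      by (rule measure_Un_le) auto
    finally show ?thesis using x atom[of x] by (simp add: measure_pmf_single)
  next
    case True
    then show ?thesis using \<open>0 \<le> p\<close> \<open>0 \<le> u\<close> by simp
  qed
  moreover have "measure_pmf.prob M ?S \<le> measure_pmf.prob M (?S \<inter> Q \<union> - Q)"
    by (rule measure_pmf.finite_measure_mono) auto
  moreover have "measure_pmf.prob M (?S \<inter> Q \<union> - Q)
      \<le> measure_pmf.prob M (?S \<inter> Q) + measure_pmf.prob M (- Q)"
    by (rule measure_Un_le) auto
  ultimately show "measure_pmf.prob M ?S \<le> u + p + e" using Q by linarith
qed

lemma coll_pair: "coll (pair_pmf A B) (pair_pmf C D) = coll A C * coll B D"
proof -
  have "coll (pair_pmf A B) (pair_pmf C D)
      = measure_pmf.prob (pair_pmf (pair_pmf A C) (pair_pmf B D))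
          ({z. fst z = snd z} \<times> {z. fst z = snd z})"
    unfolding coll_def
    by (subst pair_pair_regroup) (auto simp: vimage_def case_prod_unfold prod_eq_iff
        intro!: arg_cong[where f = "measure_pmf.prob _"])
  then show ?thesis by (simp add: prob_pair_Times coll_def)
qed

text \<open>Cauchy--Schwarz for the law of \<open>(Z, K)\<close> against that of \<open>(Z, U)\<close>, where \<open>U\<close> is uniform on
  \<open>C\<close> and independent of \<open>Z\<close>.\<close>

lemma coll_refine:
  assumes "finite C" "C \<noteq> {}" "\<And>w. K w \<in> C"
  shows "coll (map_pmf Z W) (map_pmf Z W)
    \<le> card C * coll (map_pmf (\<lambda>w. (Z w, K w)) W) (map_pmf (\<lambda>w. (Z w, K w)) W)"
proof -
  define A where "A = map_pmf (\<lambda>w. (Z w, K w)) W"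
  define B where "B = pair_pmf (map_pmf Z W) (pmf_of_set C)"
  define c where "c = coll (map_pmf Z W) (map_pmf Z W)"
  have card: "0 < real (card C)" using assms by (simp add: card_gt_0_iff)
  have "coll A B = measure_pmf.expectation W (\<lambda>w. pmf (map_pmf Z W) (Z w) * (1 / card C))"
    using assms by (simp add: coll_expectation A_def B_def pmf_pair)
  also have "\<dots> = measure_pmf.expectation W (\<lambda>w. pmf (map_pmf Z W) (Z w)) * (1 / card C)"
    by (rule integral_mult_left_zero)
  finally have AB: "coll A B = c / card C" by (simp add: c_def coll_expectation)
  have "coll (pmf_of_set C) (pmf_of_set C) = 1 / card C"
    using assms by (simp add: coll_expectation integral_pmf_of_set sum.If_cases card)
  then have BB: "coll B B = c / card C" by (simp add: B_def coll_pair c_def)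
  have "(coll A B)\<^sup>2 \<le> coll A A * coll B B"
    using coll_Cauchy_Schwarz[of A B] by (metis abs_le_square_iff abs_of_nonneg coll_nonneg
        mult_nonneg_nonneg real_sqrt_ge_zero real_sqrt_pow2)
  then have "(c / card C) * (c / card C) \<le> coll A A * (c / card C)"
    by (simp add: AB BB power2_eq_square)
  moreover have "0 < c / card C" using card coll_pos[of "map_pmf Z W"] by (simp add: c_def)
  ultimately have "c / card C \<le> coll A A" by (rule mult_right_le_imp_le)
  then show ?thesis using card by (simp add: A_def c_def field_simps)
qed

text \<open>The index is the rounded distribution function. Its cells are therefore intervals, and
  each has mass at most \<open>1 / s\<close> plus one atom, which cannot be divided.\<close>

lemma monotone_cells:
  fixes M :: "real pmf"
  assumes atom: "\<And>x. pmf M x \<le> p" and "1 \<le> s"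
  obtains \<phi> :: "real \<Rightarrow> nat" where "mono \<phi>" "\<And>x. \<phi> x \<le> s"
    "coll (map_pmf \<phi> M) (map_pmf \<phi> M) \<le> 1 / s + p"
proof
  define G where "G x = measure_pmf.prob M {..<x}" for x
  define \<phi> where "\<phi> x = nat \<lfloor>s * G x\<rfloor>" for x
  have G: "0 \<le> G x" "G x \<le> 1" for x by (auto simp: G_def)
  have mono_G: "G x \<le> G y" if "x \<le> y" for x y
    unfolding G_def by (rule measure_pmf.finite_measure_mono) (use that in auto)
  show "mono \<phi>"
    unfolding \<phi>_def by (intro monoI nat_mono floor_mono mult_left_mono mono_G) auto
  show "\<phi> x \<le> s" for x
  proof -
    have "s * G x \<le> s" using G[of x] by (simp add: mult_left_le)
    then show ?thesis by (simp add: \<phi>_def nat_le_iff floor_le_iff) 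
  qed
  have p0: "0 \<le> p" using atom[of 0] pmf_nonneg[of M 0] by linarith
  have "pmf (map_pmf \<phi> M) c \<le> 1 / s + p" for c
  proof (cases "c \<le> s")
    case True
    let ?A = "{x. G x < (c + 1) / s}" and ?B = "{x. G x < c / s}"
    have iff: "\<phi> x = c \<longleftrightarrow> c / s \<le> G x \<and> G x < (c + 1) / s" for x
    proof -
      have "\<phi> x = c \<longleftrightarrow> \<lfloor>s * G x\<rfloor> = int c"
        using G(1)[of x] by (auto simp: \<phi>_def)
      also have "\<dots> \<longleftrightarrow> real c \<le> s * G x \<and> s * G x < real c + 1"
        by (simp add: floor_eq_iff)
      finally show ?thesis using \<open>1 \<le> s\<close> by (simp add: field_simps)
    qed
    have "?B \<subseteq> ?A" using \<open>1 \<le> s\<close> by (auto simp: field_simps intro: less_le_trans)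
    have "pmf (map_pmf \<phi> M) c = measure_pmf.prob M (?A - ?B)"
    proof -
      have "x \<in> \<phi> -` {c} \<longleftrightarrow> x \<in> ?A - ?B" for x
        by (simp only: vimage_eq singleton_iff iff Diff_iff mem_Collect_eq not_less) blast
      then have "\<phi> -` {c} = ?A - ?B" by blast
      then show ?thesis by (simp add: pmf_map)
    qed
    also have "\<dots> = measure_pmf.prob M ?A - measure_pmf.prob M ?B"
      using \<open>?B \<subseteq> ?A\<close> by (intro measure_pmf.finite_measure_Diff) auto
    also have "\<dots> \<le> ((c + 1) / s + p) - c / s"
      using quantile_le[OF atom, of "(c + 1) / s"] quantile_ge[of "c / s" M] True \<open>1 \<le> s\<close>
      by (simp add: G_def)
    also have "\<dots> = 1 / s + p" using \<open>1 \<le> s\<close> by (simp add: field_simps)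
    finally show ?thesis .
  next
    case False
    then have "\<phi> -` {c} = {}" using \<open>\<And>x. \<phi> x \<le> s\<close> by auto
    then show ?thesis using p0 by (simp add: pmf_map)
  qed
  then show "coll (map_pmf \<phi> M) (map_pmf \<phi> M) \<le> 1 / s + p" by (rule coll_le)
qed

text \<open>A Szemer\'edi--Trotter bound for a Cartesian product. Cut the two axes into about \<open>s\<close> intervals
  of mass about \<open>1 / s\<close>. A line meets only \<open>2 * s + 1\<close> of the resulting cells, since it is monotone,
  so a rich slope has many collinear pairs inside a single cell; distinct slopes do not share
  such pairs.\<close>

lemma rich_slopes:
  fixes X Y :: "real pmf" and s :: nat
  assumes X: "\<And>x. pmf X x \<le> p" and Y: "\<And>x. pmf Y x \<le> p" and s: "1 \<le> s"
    and T: "finite T" "0 \<notin> T"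
    and rich: "\<And>t. t \<in> T \<Longrightarrow> \<eta> \<le> coll (map_pmf (\<lambda>(x, y). t * x + y) (pair_pmf X Y))
                                    (map_pmf (\<lambda>(x, y). t * x + y) (pair_pmf X Y))"
  shows "card T * (\<eta> / (2 * s + 1) - p\<^sup>2) \<le> (1 / s + p)\<^sup>2"
proof -
  have p0: "0 \<le> p" using X[of 0] pmf_nonneg[of X 0] by linarith
  obtain \<phi> where \<phi>: "mono \<phi>" "\<And>x. \<phi> x \<le> s" "coll (map_pmf \<phi> X) (map_pmf \<phi> X) \<le> 1 / s + p"
    using monotone_cells[OF X s] by blast
  obtain \<psi> where \<psi>: "mono \<psi>" "\<And>x. \<psi> x \<le> s" "coll (map_pmf \<psi> Y) (map_pmf \<psi> Y) \<le> 1 / s + p"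
    using monotone_cells[OF Y s] by blast
  define W where "W = pair_pmf X Y"
  define Z where "Z t w = t * fst w + snd w" for t :: real and w
  define cell where "cell w = (\<phi> (fst w), \<psi> (snd w))" for w
  \<comment> \<open>On a line \<open>t * x + y = const\<close> both summands of \<open>K t\<close>
    weakly increase with \<open>x\<close>, so equal values of \<open>K t\<close> on one line mean
    equal cells. There are only \<open>2 * s + 1\<close> values.\<close>
  define K where "K t w = (if t < 0 then \<phi> (fst w) + \<psi> (snd w) else \<phi> (fst w) + (s - \<psi> (snd w)))"
    for t :: real and w
  define E where "E t = {z. Z t (fst z) = Z t (snd z) \<and> cell (fst z) = cell (snd z) \<and> fst z \<noteq> snd z}" for t
  have same_cell: "cell w = cell w'" if "Z t w = Z t w'" "K t w = K t w'" "t \<noteq> 0" for t w w'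
  proof -
    have *: "cell w = cell w'"
      if "Z t w = Z t w'" "K t w = K t w'" "t \<noteq> 0" "fst w \<le> fst w'" for w w'
    proof (cases "t < 0")
      case True
      then have "t * fst w' \<le> t * fst w" using that by (intro mult_left_mono_neg) auto
      then have "snd w \<le> snd w'" using that by (simp add: Z_def)
      then have "\<phi> (fst w) \<le> \<phi> (fst w')" "\<psi> (snd w) \<le> \<psi> (snd w')"
        using that \<phi>(1) \<psi>(1) by (auto dest: monoD)
      then show ?thesis using that True by (simp add: K_def cell_def)
    next
      case False
      then have "t * fst w \<le> t * fst w'" using that by (intro mult_left_mono) auto
      then have "snd w' \<le> snd w" using that by (simp add: Z_def)
      then have "\<phi> (fst w) \<le> \<phi> (fst w')" "\<psi> (snd w') \<le> \<psi> (snd w)"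
        using that \<phi>(1) \<psi>(1) by (auto dest: monoD)
      moreover have "\<phi> (fst w) + (s - \<psi> (snd w)) = \<phi> (fst w') + (s - \<psi> (snd w'))"
        using that False by (simp add: K_def)
      ultimately have "\<phi> (fst w) = \<phi> (fst w') \<and> \<psi> (snd w) = \<psi> (snd w')"
        using \<psi>(2)[of "snd w"] \<psi>(2)[of "snd w'"] by arith
      then show ?thesis by (simp add: cell_def)
    qed
    show ?thesis
      using *[of w w'] *[of w' w] that by (cases "fst w \<le> fst w'") auto
  qed
  \<comment> \<open>A pair of equal points collides for every slope and says nothing about
    \<open>t\<close>; it is removed at the price \<open>p\<^sup>2\<close>.\<close>
  have diag: "measure_pmf.prob (pair_pmf W W) {z. fst z = snd z} \<le> p\<^sup>2"
  proof -
    have "coll W W \<le> p * p"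
      unfolding W_def coll_pair using coll_le[of X p X] coll_le[of Y p Y] X Y p0
      by (intro mult_mono) auto
    then show ?thesis by (simp add: coll_def power2_eq_square)
  qed
  have E_ge: "\<eta> / (2 * s + 1) - p\<^sup>2 \<le> measure_pmf.prob (pair_pmf W W) (E t)" if "t \<in> T" for t
  proof -
    have "t \<noteq> 0" using that T by auto
    have fin: "finite {..2 * s}" "{..2 * s} \<noteq> {}" by auto
    have K: "K t w \<in> {..2 * s}" for w
      using \<phi>(2)[of "fst w"] \<psi>(2)[of "snd w"] by (auto simp: K_def)
    let ?ZK = "map_pmf (\<lambda>w. (Z t w, K t w)) W"
    have "\<eta> \<le> coll (map_pmf (Z t) W) (map_pmf (Z t) W)"
      using rich[OF that] unfolding W_def Z_def by (simp add: case_prod_unfold)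
    also have "\<dots> \<le> card {..2 * s} * coll ?ZK ?ZK"
      by (rule coll_refine[OF fin K])
    finally have 1: "\<eta> \<le> (2 * s + 1) * coll ?ZK ?ZK" by simp
    have "coll ?ZK ?ZK
        = measure_pmf.prob (pair_pmf W W) {z. Z t (fst z) = Z t (snd z) \<and> K t (fst z) = K t (snd z)}"
      by (simp add: coll_def pair_map_pmf1 pair_map_pmf2 vimage_def case_prod_unfold)
    also have "\<dots> \<le> measure_pmf.prob (pair_pmf W W) ({z. fst z = snd z} \<union> E t)"
      by (rule measure_pmf.finite_measure_mono) (auto simp: E_def dest: same_cell[OF _ _ \<open>t \<noteq> 0\<close>])
    also have "\<dots> \<le> measure_pmf.prob (pair_pmf W W) {z. fst z = snd z} + measure_pmf.prob (pair_pmf W W) (E t)"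
      by (rule measure_Un_le) auto
    also have "\<dots> \<le> p\<^sup>2 + measure_pmf.prob (pair_pmf W W) (E t)" using diag by simp
    finally have "(2 * s + 1) * coll ?ZK ?ZK \<le> (2 * s + 1) * (p\<^sup>2 + measure_pmf.prob (pair_pmf W W) (E t))"
      by (intro mult_left_mono) auto
    with 1 have "\<eta> \<le> (2 * s + 1) * (p\<^sup>2 + measure_pmf.prob (pair_pmf W W) (E t))" by linarith
    then show ?thesis by (simp add: field_simps)
  qed
  have disj: "disjoint_family_on E T"
  proof (unfold disjoint_family_on_def, intro ballI impI, rule ccontr)
    fix t u assume "t \<in> T" "u \<in> T" "t \<noteq> u" "E t \<inter> E u \<noteq> {}"
    then obtain z where "z \<in> E t" "z \<in> E u" by blast
    then obtain w w' where w: "Z t w = Z t w'" "Z u w = Z u w'" "w \<noteq> w'"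
      unfolding E_def by blast
    then have "(t - u) * (fst w - fst w') = 0" by (simp add: Z_def algebra_simps)
    then have "fst w = fst w'" using \<open>t \<noteq> u\<close> by simp
    with w show False by (simp add: Z_def prod_eq_iff)
  qed
  have "card T * (\<eta> / (2 * s + 1) - p\<^sup>2) = (\<Sum>t\<in>T. \<eta> / (2 * s + 1) - p\<^sup>2)" by simp
  also have "\<dots> \<le> (\<Sum>t\<in>T. measure_pmf.prob (pair_pmf W W) (E t))"
    by (intro sum_mono E_ge)
  also have "\<dots> = measure_pmf.prob (pair_pmf W W) (\<Union>t\<in>T. E t)"
    using T disj by (intro measure_pmf.finite_measure_finite_Union[symmetric]) auto
  also have "\<dots> \<le> measure_pmf.prob (pair_pmf W W) {z. cell (fst z) = cell (snd z)}"
    by (rule measure_pmf.finite_measure_mono) (auto simp: E_def)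
  also have "\<dots> = coll (map_pmf cell W) (map_pmf cell W)"
    by (simp add: coll_def pair_map_pmf1 pair_map_pmf2 vimage_def case_prod_unfold)
  also have "map_pmf cell W = pair_pmf (map_pmf \<phi> X) (map_pmf \<psi> Y)"
    unfolding W_def cell_def by (simp flip: map_pair add: case_prod_unfold)
  also have "coll \<dots> \<dots> \<le> (1 / s + p) * (1 / s + p)"
    unfolding coll_pair using \<phi> \<psi> p0 by (intro mult_mono) auto
  finally show ?thesis by (simp add: power2_eq_square)
qed

section \<open>Multiplicative energy\<close>

text \<open>For a continuous law \<open>w\<close> is distributed like \<open>min U (1 - U)\<close>
  with \<open>U\<close> uniform and exceeds \<open>t\<close> with probability
  \<open>1 - 2 * t\<close>. Atoms of size at most \<open>r\<close> cost the term
  \<open>4 * r\<close>.\<close>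

lemma prob_min_tail:
  fixes M :: "real pmf"
  assumes atom: "\<And>x. pmf M x \<le> r" and "0 \<le> t"
  defines "w \<equiv> \<lambda>x. min (measure_pmf.prob M {..x}) (measure_pmf.prob M {x..})"
  shows "measure_pmf.prob M {x. t < w x} \<le> max 0 (1 + 4 * r - 2 * t)"
proof -
  define F where "F x = measure_pmf.prob M {..x}" for x
  define G where "G x = measure_pmf.prob M {x..}" for x
  have w: "w x = min (F x) (G x)" for x by (simp add: w_def F_def G_def)
  have r0: "0 \<le> r" using atom[of 0] pmf_nonneg[of M 0] by linarith
  have FG: "F x + G x = 1 + pmf M x" for x
  proof -
    have "F x + measure_pmf.prob M (- {..x}) = 1"
      using measure_pmf.prob_compl[of "{..x}" M] by (simp add: F_def Compl_eq_Diff_UNIV)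
    moreover have "G x = measure_pmf.prob M ({x} \<union> - {..x})"
      unfolding G_def by (rule arg_cong[where f = "measure_pmf.prob M"]) auto
    moreover have "\<dots> = measure_pmf.prob M {x} + measure_pmf.prob M (- {..x})"
      by (rule measure_pmf.finite_measure_Union) auto
    ultimately show ?thesis by (simp add: measure_pmf_single)
  qed
  have low: "u - r \<le> measure_pmf.prob M' {x. measure_pmf.prob M' {..x} \<le> u}"
    if "u \<le> 1" "\<And>x. pmf M' x \<le> r" for u and M' :: "real pmf"
  proof -
    have "u - r \<le> measure_pmf.prob M' {x. measure_pmf.prob M' {..<x} < u - r}"
      using that r0 by (intro quantile_ge) auto
    also have "\<dots> \<le> measure_pmf.prob M' {x. measure_pmf.prob M' {..x} \<le> u}"
    proof (rule measure_pmf.finite_measure_mono)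
      have "measure_pmf.prob M' {..x} \<le> measure_pmf.prob M' {..<x} + r" for x
      proof -
        have "measure_pmf.prob M' ({..<x} \<union> {x}) \<le> measure_pmf.prob M' {..<x} + measure_pmf.prob M' {x}"
          by (rule measure_Un_le) auto
        moreover have "{..<x} \<union> {x} = {..x}" by auto
        ultimately show ?thesis using that(2)[of x] by (simp add: measure_pmf_single)
      qed
      then show "{x. measure_pmf.prob M' {..<x} < u - r} \<subseteq> {x. measure_pmf.prob M' {..x} \<le> u}"
        by (auto intro: order_trans[OF _ less_imp_le] simp: less_diff_eq add.commute)
    qed simp
    finally show ?thesis .
  qed
  have lowF: "u - r \<le> measure_pmf.prob M {x. F x \<le> u}" if "u \<le> 1" for u
    using low[OF that atom] by (simp add: F_def)
  have lowG: "u - r \<le> measure_pmf.prob M {x. G x \<le> u}" if "u \<le> 1" for u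
  proof -
    let ?N = "map_pmf uminus M"
    have "pmf ?N x \<le> r" for x
      using atom[of "- x"] pmf_map_inj'[of uminus M "- x"] by simp
    moreover have "measure_pmf.prob ?N {..x} = G (- x)" for x
      by (auto simp: G_def vimage_def intro!: arg_cong[where f = "measure_pmf.prob M"])
    ultimately show ?thesis
      using low[OF that, of ?N] by (simp add: vimage_def)
  qed
  have half: "measure_pmf.prob M {x. u < w x} \<le> 1 - 2 * (u - r)" if "u < 1 / 2" for u
  proof -
    have "measure_pmf.prob M {x. F x \<le> u} + measure_pmf.prob M {x. G x \<le> u}
        = measure_pmf.prob M ({x. F x \<le> u} \<union> {x. G x \<le> u})"
    proof (rule measure_pmf.finite_measure_Union[symmetric])
      show "{x. F x \<le> u} \<inter> {x. G x \<le> u} = {}"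
      proof (rule ccontr)
        assume "\<not> ?thesis"
        then obtain x where "F x \<le> u" "G x \<le> u" by auto
        then show False using FG[of x] that pmf_nonneg[of M x] by linarith
      qed
    qed auto
    also have "{x. F x \<le> u} \<union> {x. G x \<le> u} = - {x. u < w x}" by (auto simp: w)
    also have "measure_pmf.prob M \<dots> = 1 - measure_pmf.prob M {x. u < w x}"
      using measure_pmf.prob_compl[of "{x. u < w x}" M] by (simp add: Compl_eq_Diff_UNIV)
    finally show ?thesis using lowF[of u] lowG[of u] that by simp
  qed
  show ?thesis
  proof (cases "t < 1 / 2 + r")
    case True
    \<comment> \<open>The events of a small lower and of a small upper tail are disjoint only at
      levels below 1/2; \<open>t - r\<close> is such a level although \<open>t\<close> need not
      be.\<close>
    have "measure_pmf.prob M {x. t < w x} \<le> measure_pmf.prob M {x. t - r < w x}"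
      by (rule measure_pmf.finite_measure_mono) (use r0 in auto)
    then show ?thesis using half[of "t - r"] True by (simp add: max_def)
  next
    case False
    have "{x. t < w x} = {}"
    proof (rule ccontr)
      assume "\<not> ?thesis"
      then obtain x where "t < F x" "t < G x" by (auto simp: w)
      then show False using FG[of x] atom[of x] False r0 by linarith
    qed
    then show ?thesis by simp
  qed
qed

text \<open>A discrete layer-cake formula, rounded up: the minimum is averaged over the levels
  \<open>j / N\<close> that both numbers exceed. In this form its expectation factors for
  independent \<open>u\<close> and \<open>v\<close>.\<close>

lemma min_le_count:
  fixes u v :: real and N :: nat
  assumes "0 < N" "u \<le> 1"
  shows "min u v \<le> (\<Sum>j<N. of_bool (j / N < u \<and> j / N < v)) / N"
proof -
  define x where "x = min u v"
  have "x * N \<le> card {j. j < N \<and> j < x * N}"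
  proof (cases "x \<le> 0")
    case False
    have "{..<nat \<lceil>x * N\<rceil>} \<subseteq> {j. j < N \<and> j < x * N}"
    proof
      fix j assume "j \<in> {..<nat \<lceil>x * N\<rceil>}"
      then have j: "j < x * N" by (simp add: less_ceiling_iff zless_nat_eq_int_zless)
      also have "x * N \<le> N" using assms by (simp add: x_def mult_left_le_one_le)
      finally show "j \<in> {j. j < N \<and> j < x * N}" using j by simp
    qed
    then have "nat \<lceil>x * N\<rceil> \<le> card {j. j < N \<and> j < x * N}"
      using card_mono[of "{j. j < N \<and> j < x * N}" "{..<nat \<lceil>x * N\<rceil>}"] by simp
    moreover have "x * N \<le> nat \<lceil>x * N\<rceil>" by linarith
    ultimately show ?thesis by linarith
  next
    case True
    then have "x * N \<le> 0" by (simp add: mult_nonpos_nonneg)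
    then show ?thesis by linarith
  qed
  also have "{j. j < N \<and> j < x * N} = {j \<in> {..<N}. j / N < u \<and> j / N < v}"
    using assms by (simp add: x_def flip: pos_divide_less_eq)
  also have "real (card \<dots>) = (\<Sum>j<N. of_bool (j / N < u \<and> j / N < v))"
    by (simp add: sum.If_cases of_bool_def Int_def)
  finally show ?thesis using assms by (simp add: x_def field_simps)
qed

text \<open>A Riemann sum for the integral of \<open>(B - 2 * t)\<^sup>2\<close> over
  \<open>0 \<le> t \<le> B / 2\<close>, which is \<open>B ^ 3 / 6\<close>. From the second term on
  it is dominated by a telescoping sum of cubes; the first term is the error.\<close>

lemma sum_pos_part_squares:
  assumes "0 < N" "0 \<le> B"
  shows "(\<Sum>j<N. (max 0 (B - 2 * (real j / real N)))\<^sup>2) / N \<le> B ^ 3 / 6 + B\<^sup>2 / N"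
proof -
  define y where "y j = max 0 (B - 2 * (real j / real N))" for j :: nat
  have step: "(y (Suc j))\<^sup>2 / N \<le> (y j ^ 3 - y (Suc j) ^ 3) / 6" for j
  proof (cases "y (Suc j) = 0")
    case False
    then have "y (Suc j) > 0" by (simp add: y_def max_def split: if_splits)
    moreover from this have yj: "y j = y (Suc j) + 2 / N"
      by (simp add: y_def max_def add_divide_distrib split: if_splits) (use assms in \<open>simp add: field_simps\<close>)
    moreover define d where "d = 2 / real N"
    moreover have "(y (Suc j) + d) ^ 3 - y (Suc j) ^ 3 - 3 * (y (Suc j))\<^sup>2 * d = 3 * y (Suc j) * d\<^sup>2 + d ^ 3"
      by (simp add: power3_eq_cube power2_eq_square algebra_simps)
    moreover have "0 \<le> d" by (simp add: d_def)
    ultimately have "3 * (y (Suc j))\<^sup>2 * d \<le> y j ^ 3 - y (Suc j) ^ 3"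
      by (smt (verit) mult_nonneg_nonneg zero_le_power)
    then show ?thesis by (simp add: d_def mult.commute)
  qed (simp add: y_def)
  have y0: "y 0 = B" using assms by (simp add: y_def)
  obtain K where K: "N = Suc K" using assms gr0_implies_Suc by blast
  have "(\<Sum>j<N. (y j)\<^sup>2) / N = B\<^sup>2 / N + (\<Sum>j<K. (y (Suc j))\<^sup>2 / N)"
    unfolding K by (subst sum.lessThan_Suc_shift) (simp add: y0 add_divide_distrib sum_divide_distrib)
  also have "(\<Sum>j<K. (y (Suc j))\<^sup>2 / N) \<le> (\<Sum>j<K. (y j ^ 3 - y (Suc j) ^ 3) / 6)"
    by (intro sum_mono step)
  also have "\<dots> = (B ^ 3 - y K ^ 3) / 6"
    by (simp flip: sum_divide_distrib add: sum_lessThan_telescope'[of "\<lambda>j. y j ^ 3"] y0)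
  also have "\<dots> \<le> B ^ 3 / 6" by (simp add: y_def)
  finally show ?thesis by (simp add: y_def)
qed

lemma fourfold_regroup:
  "pair_pmf (pair_pmf A B) (pair_pmf C D)
    = map_pmf (\<lambda>((a, d), (b, c)). ((a, b), (c, d))) (pair_pmf (pair_pmf A D) (pair_pmf B C))"
proof -
  have "pair_pmf (pair_pmf A B) (pair_pmf C D)
      = map_pmf (\<lambda>(x, (d, c)). (x, (c, d))) (pair_pmf (pair_pmf A B) (pair_pmf D C))"
    by (subst pair_commute_pmf[of C D]) (simp add: pair_map_pmf2 apsnd_def map_prod_def case_prod_unfold)
  then show ?thesis
    by (simp add: pair_pair_regroup[of A B D C] pmf.map_comp o_def case_prod_unfold)
qed

text \<open>The additive energy of a set is maximal for an interval. In a solution of \<open>a * d = b * c\<close> one of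
  the pairs \<open>{a, d}\<close>, \<open>{b, c}\<close> encloses the other in absolute value, and for a given inner pair the
  outer one is determined by either of its ends.\<close>

lemma nested_energy:
  fixes M :: "real pmf"
  assumes atom: "\<And>x. pmf M x \<le> p" and "0 < p" "p \<le> 1 / 8"
  shows "measure_pmf.prob (pair_pmf (pair_pmf M M) (pair_pmf M M))
      {((a, d), (b, c)). a * d = b * c \<and> b * c \<noteq> 0 \<and> \<bar>a\<bar> \<le> min \<bar>b\<bar> \<bar>c\<bar> \<and> max \<bar>b\<bar> \<bar>c\<bar> \<le> \<bar>d\<bar>}
    \<le> p * (1 / 6 + 14 * p)"
proof -
  define L where "L = map_pmf abs M"
  define w where "w x = min (measure_pmf.prob L {..x}) (measure_pmf.prob L {x..})" for x
  \<comment> \<open>With about \<open>1 / p\<close> levels the discretisation error has the order of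
    the atoms.\<close>
  define N where "N = nat \<lceil>1 / p\<rceil>"
  have N: "0 < N" "1 / real N \<le> p"
  proof -
    have "1 / p \<le> N" by (simp add: N_def real_nat_ceiling_ge)
    then have "1 \<le> p * N" using \<open>0 < p\<close> by (simp add: field_simps)
    moreover from this show "0 < N" by (auto intro!: Nat.gr0I)
    ultimately show "1 / real N \<le> p" by (simp add: field_simps)
  qed
  let ?E = "{((a, d), (b, c)). a * d = b * c \<and> b * c \<noteq> 0 \<and> \<bar>a\<bar> \<le> min \<bar>b\<bar> \<bar>c\<bar> \<and> max \<bar>b\<bar> \<bar>c\<bar> \<le> \<bar>d\<bar>}"
  have L_atom: "pmf L x \<le> 2 * p" for x
  proof -
    have "pmf L x \<le> measure_pmf.prob M {x, - x}"
      unfolding L_def pmf_map by (rule measure_pmf.finite_measure_mono) auto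
    also have "\<dots> \<le> measure_pmf.prob M {x} + measure_pmf.prob M {- x}"
      using measure_Un_le[of "{x}" M "{- x}"] by (simp add: insert_commute)
    finally show ?thesis using atom[of x] atom[of "- x"] by (simp add: measure_pmf_single)
  qed
  have inner: "measure_pmf.prob (pair_pmf M M) {(a, d). ((a, d), (b, c)) \<in> ?E} \<le> p * min (w \<bar>b\<bar>) (w \<bar>c\<bar>)"
    for b c
  proof -
    have single: "measure_pmf.prob M {x. e * x = r} \<le> p" if "e \<noteq> 0" for e r
    proof -
      have "{x. e * x = r} = {r / e}" using that by (auto simp: field_simps)
      then show ?thesis using atom by (simp add: measure_pmf_single)
    qed
    let ?A = "{(a, d). ((a, d), (b, c)) \<in> ?E}"
    have 1: "measure_pmf.prob (pair_pmf M M) ?A \<le> measure_pmf.prob L {..min \<bar>b\<bar> \<bar>c\<bar>} * p"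
    proof -
      have "measure_pmf.prob (pair_pmf M M) ?A
          \<le> measure_pmf.prob M {a. \<bar>a\<bar> \<le> min \<bar>b\<bar> \<bar>c\<bar>} * p"
      proof (rule prob_pair_mult_le)
        fix a
        show "measure_pmf.prob M {d. (a, d) \<in> ?A} \<le> p"
        proof (cases "a = 0")
          case True
          then have "{d. (a, d) \<in> ?A} = {}" by auto
          then show ?thesis using less_imp_le[OF \<open>0 < p\<close>] by (simp only: measure_empty)
        next
          case False
          have "measure_pmf.prob M {d. (a, d) \<in> ?A} \<le> measure_pmf.prob M {x. a * x = b * c}"
            by (rule measure_pmf.finite_measure_mono) auto
          with single[OF False] show ?thesis by (rule order_trans[rotated])
        qed
      qed auto
      then show ?thesis by (simp add: L_def vimage_def)
    qed
    have 2: "measure_pmf.prob (pair_pmf M M) ?A \<le> measure_pmf.prob L {max \<bar>b\<bar> \<bar>c\<bar>..} * p"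
    proof -
      have "measure_pmf.prob (pair_pmf M M) {z. (snd z, fst z) \<in> ?A}
          \<le> measure_pmf.prob M {d. max \<bar>b\<bar> \<bar>c\<bar> \<le> \<bar>d\<bar>} * p"
      proof (rule prob_pair_mult_le)
        fix d
        show "measure_pmf.prob M {a. (d, a) \<in> {z. (snd z, fst z) \<in> ?A}} \<le> p"
        proof (cases "d = 0")
          case True
          then have "{a. (d, a) \<in> {z. (snd z, fst z) \<in> ?A}} = {}" by auto
          then show ?thesis using less_imp_le[OF \<open>0 < p\<close>] by (simp only: measure_empty)
        next
          case False
          have "measure_pmf.prob M {a. (d, a) \<in> {z. (snd z, fst z) \<in> ?A}} \<le> measure_pmf.prob M {x. d * x = b * c}"
            by (rule measure_pmf.finite_measure_mono) (auto simp: mult.commute)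
          with single[OF False] show ?thesis by (rule order_trans[rotated])
        qed
      qed auto
      then show ?thesis by (subst prob_pair_swap) (simp add: L_def vimage_def)
    qed
    have mono: "measure_pmf.prob L {..min \<bar>b\<bar> \<bar>c\<bar>} \<le> measure_pmf.prob L {..x}"
      "measure_pmf.prob L {max \<bar>b\<bar> \<bar>c\<bar>..} \<le> measure_pmf.prob L {x..}" if "x = \<bar>b\<bar> \<or> x = \<bar>c\<bar>" for x
      using that by (intro measure_pmf.finite_measure_mono; auto)+
    have "measure_pmf.prob (pair_pmf M M) ?A / p \<le> measure_pmf.prob L {..min \<bar>b\<bar> \<bar>c\<bar>}"
      "measure_pmf.prob (pair_pmf M M) ?A / p \<le> measure_pmf.prob L {max \<bar>b\<bar> \<bar>c\<bar>..}"
      using 1 2 \<open>0 < p\<close> by (simp_all only: pos_divide_le_eq)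
    then have "measure_pmf.prob (pair_pmf M M) ?A / p \<le> w x" if "x = \<bar>b\<bar> \<or> x = \<bar>c\<bar>" for x
      unfolding w_def using mono[OF that] by (intro min.boundedI) (rule order_trans, assumption, assumption)+
    then have "measure_pmf.prob (pair_pmf M M) ?A / p \<le> min (w \<bar>b\<bar>) (w \<bar>c\<bar>)"
      by (intro min.boundedI) blast+
    then show ?thesis using \<open>0 < p\<close> by (simp only: pos_divide_le_eq mult.commute)
  qed
  \<comment> \<open>\<open>8 * p\<close> is \<open>4 * r\<close> in \<open>prob_min_tail\<close>
    with \<open>r = 2 * p\<close>, as an atom of \<open>L\<close> can combine those of
    \<open>M\<close> at \<open>x\<close> and \<open>- x\<close>. For \<open>B = 1\<close> the
    integral is the main term 1/6.\<close>
  define B where "B = 1 + 8 * p"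
  have tail: "measure_pmf.prob M {x. real j / real N < w \<bar>x\<bar>} \<le> max 0 (B - 2 * (real j / real N))" for j :: nat
    using prob_min_tail[OF L_atom, of "real j / real N"] by (simp add: w_def L_def vimage_def B_def)
  have "measure_pmf.prob (pair_pmf (pair_pmf M M) (pair_pmf M M)) ?E
      = measure_pmf.expectation (pair_pmf M M)
          (\<lambda>(b, c). measure_pmf.prob (pair_pmf M M) {(a, d). ((a, d), (b, c)) \<in> ?E})"
    by (subst prob_pair_swap) (simp add: prob_pair_pmf case_prod_unfold)
  also have "\<dots> \<le> measure_pmf.expectation (pair_pmf M M)
      (\<lambda>(b, c). p / real N * (\<Sum>j<N. of_bool (real j / real N < w \<bar>b\<bar> \<and> real j / real N < w \<bar>c\<bar>)))"
  proof (rule integral_mono_AE)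
    have "measure_pmf.prob (pair_pmf M M) {(a, d). ((a, d), (b, c)) \<in> ?E}
        \<le> p / real N * (\<Sum>j<N. of_bool (real j / real N < w \<bar>b\<bar> \<and> real j / real N < w \<bar>c\<bar>))" for b c
    proof -
      have "w \<bar>b\<bar> \<le> 1" by (simp add: w_def min_le_iff_disj)
      from min_le_count[OF N(1) this, of "w \<bar>c\<bar>"]
      have "p * min (w \<bar>b\<bar>) (w \<bar>c\<bar>) \<le> p * ((\<Sum>j<N. of_bool (real j / real N < w \<bar>b\<bar> \<and> real j / real N < w \<bar>c\<bar>)) / N)"
        using \<open>0 < p\<close> by (intro mult_left_mono) auto
      with inner[of b c] show ?thesis by simp
    qed
    then show "AE z in pair_pmf M M. (case z of (b, c) \<Rightarrow> measure_pmf.prob (pair_pmf M M) {(a, d). ((a, d), (b, c)) \<in> ?E})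
        \<le> (case z of (b, c) \<Rightarrow> p / real N * (\<Sum>j<N. of_bool (real j / real N < w \<bar>b\<bar> \<and> real j / real N < w \<bar>c\<bar>)))"
      by (simp add: case_prod_unfold)
    show "integrable (pair_pmf M M) (\<lambda>(b, c). measure_pmf.prob (pair_pmf M M) {(a, d). ((a, d), (b, c)) \<in> ?E})"
      by (rule measure_pmf.integrable_const_bound[where B = 1]) (auto simp: case_prod_unfold)
    show "integrable (pair_pmf M M) (\<lambda>(b, c). p / real N * (\<Sum>j<N. of_bool (real j / real N < w \<bar>b\<bar> \<and> real j / real N < w \<bar>c\<bar>)))"
      unfolding case_prod_unfold
      by (intro integrable_mult_right Bochner_Integration.integrable_sum measure_pmf.integrable_const_bound[where B = 1]) auto
  qed
  also have "\<dots> = p / real N * (\<Sum>j<N. measure_pmf.expectation (pair_pmf M M)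
      (\<lambda>z. of_bool (real j / real N < w \<bar>fst z\<bar> \<and> real j / real N < w \<bar>snd z\<bar>)))"
    unfolding case_prod_unfold
    by (subst integral_mult_right_zero, subst Bochner_Integration.integral_sum)
       (auto intro!: measure_pmf.integrable_const_bound[where B = 1])
  also have "(\<Sum>j<N. measure_pmf.expectation (pair_pmf M M)
        (\<lambda>z. of_bool (real j / real N < w \<bar>fst z\<bar> \<and> real j / real N < w \<bar>snd z\<bar>)))
      = (\<Sum>j<N. (measure_pmf.prob M {x. real j / real N < w \<bar>x\<bar>})\<^sup>2)"
  proof (rule sum.cong[OF refl])
    fix j :: nat
    let ?S = "{x. real j / real N < w \<bar>x\<bar>}"
    have "measure_pmf.expectation (pair_pmf M M) (\<lambda>z. of_bool (real j / real N < w \<bar>fst z\<bar> \<and> real j / real N < w \<bar>snd z\<bar>))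
        = measure_pmf.expectation (pair_pmf M M) (indicat_real (?S \<times> ?S))"
      by (intro Bochner_Integration.integral_cong) (auto simp: indicator_def)
    also have "\<dots> = (measure_pmf.prob M ?S)\<^sup>2" by (simp add: prob_pair_Times power2_eq_square)
    finally show "measure_pmf.expectation (pair_pmf M M) (\<lambda>z. of_bool (real j / real N < w \<bar>fst z\<bar> \<and> real j / real N < w \<bar>snd z\<bar>))
        = (measure_pmf.prob M ?S)\<^sup>2" .
  qed
  also have "p / real N * (\<Sum>j<N. (measure_pmf.prob M {x. real j / real N < w \<bar>x\<bar>})\<^sup>2)
      \<le> p / real N * (\<Sum>j<N. (max 0 (B - 2 * (real j / real N)))\<^sup>2)"
    using \<open>0 < p\<close> tail by (intro mult_left_mono sum_mono power_mono) auto
  also have "\<dots> \<le> p * (B ^ 3 / 6 + B\<^sup>2 / real N)"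
  proof -
    have "0 \<le> B" using \<open>0 < p\<close> by (simp add: B_def)
    have "p * ((\<Sum>j<N. (max 0 (B - 2 * (real j / real N)))\<^sup>2) / real N) \<le> p * (B ^ 3 / 6 + B\<^sup>2 / real N)"
      using \<open>0 < p\<close> by (intro mult_left_mono sum_pos_part_squares[OF N(1) \<open>0 \<le> B\<close>]) auto
    then show ?thesis by simp
  qed
  also have "\<dots> \<le> p * (1 / 6 + 14 * p)"
  proof (rule mult_left_mono)
    have "B\<^sup>2 \<le> 2\<^sup>2" using assms by (intro power_mono) (auto simp: B_def)
    then have "B\<^sup>2 * (1 / real N) \<le> 4 * p" using N by (intro mult_mono) auto
    moreover have "B ^ 3 \<le> 1 + 56 * p"
    proof -
      have "p * p \<le> p / 8" "p * p * p \<le> p / 64"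
        using assms mult_left_mono[of p "1/8" p] mult_mono[of "p * p" "1/8 * (1/8)" p p] mult_mono[of p "1/8" p "1/8"]
        by (auto simp: algebra_simps)
      then show ?thesis by (simp add: B_def power3_eq_cube algebra_simps)
    qed
    ultimately show "B ^ 3 / 6 + B\<^sup>2 / real N \<le> 1 / 6 + 14 * p" using assms by simp
  qed (use assms in simp)
  finally show ?thesis .
qed

text \<open>The products are equal and non-zero, so the partner of the smallest factor is the
  largest one.\<close>

lemma nested_cases:
  fixes a b c d :: real
  assumes "a * d = b * c" "b * c \<noteq> 0"
  shows "\<bar>a\<bar> \<le> min \<bar>b\<bar> \<bar>c\<bar> \<and> max \<bar>b\<bar> \<bar>c\<bar> \<le> \<bar>d\<bar> \<or> \<bar>d\<bar> \<le> min \<bar>b\<bar> \<bar>c\<bar> \<and> max \<bar>b\<bar> \<bar>c\<bar> \<le> \<bar>a\<bar>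
    \<or> \<bar>b\<bar> \<le> min \<bar>a\<bar> \<bar>d\<bar> \<and> max \<bar>a\<bar> \<bar>d\<bar> \<le> \<bar>c\<bar> \<or> \<bar>c\<bar> \<le> min \<bar>a\<bar> \<bar>d\<bar> \<and> max \<bar>a\<bar> \<bar>d\<bar> \<le> \<bar>b\<bar>"
proof -
  have *: "\<bar>y\<bar> \<le> \<bar>w\<bar>" if "\<bar>x\<bar> \<le> \<bar>z\<bar>" "x * w = y * z" "y * z \<noteq> 0" for x y z w :: real
  proof (rule ccontr)
    assume "\<not> ?thesis"
    then have "\<bar>x\<bar> * \<bar>w\<bar> < \<bar>z\<bar> * \<bar>y\<bar>" using that by (intro mult_le_less_imp_less) auto
    moreover have "\<bar>x\<bar> * \<bar>w\<bar> = \<bar>z\<bar> * \<bar>y\<bar>" using that(2) by (metis abs_mult mult.commute)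
    ultimately show False by simp
  qed
  have 1: "\<bar>b\<bar> \<le> \<bar>d\<bar>" if "\<bar>a\<bar> \<le> \<bar>c\<bar>" using *[OF that, of d b] assms by simp
  have 2: "\<bar>c\<bar> \<le> \<bar>d\<bar>" if "\<bar>a\<bar> \<le> \<bar>b\<bar>" using *[OF that, of d c] assms by (simp add: mult.commute)
  have 3: "\<bar>b\<bar> \<le> \<bar>a\<bar>" if "\<bar>d\<bar> \<le> \<bar>c\<bar>" using *[OF that, of a b] assms by (simp add: mult.commute)
  have 4: "\<bar>c\<bar> \<le> \<bar>a\<bar>" if "\<bar>d\<bar> \<le> \<bar>b\<bar>" using *[OF that, of a c] assms by (simp add: mult.commute)
  have 5: "\<bar>d\<bar> \<le> \<bar>c\<bar>" if "\<bar>b\<bar> \<le> \<bar>a\<bar>" using *[OF that, of c d] assms by (simp add: mult.commute)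
  have 6: "\<bar>a\<bar> \<le> \<bar>c\<bar>" if "\<bar>b\<bar> \<le> \<bar>d\<bar>" using *[OF that, of c a] assms by (simp add: mult.commute)
  have 7: "\<bar>d\<bar> \<le> \<bar>b\<bar>" if "\<bar>c\<bar> \<le> \<bar>a\<bar>" using *[OF that, of b d] assms by (simp add: mult.commute)
  have 8: "\<bar>a\<bar> \<le> \<bar>b\<bar>" if "\<bar>c\<bar> \<le> \<bar>d\<bar>" using *[OF that, of b a] assms by (simp add: mult.commute)
  from 1 2 3 4 5 6 7 8 show ?thesis unfolding min.bounded_iff max.bounded_iff by (smt (verit))
qed

text \<open>For equal laws the four nestings of \<open>a * d = b * c\<close> have the same
  probability, by exchanging factors and sides. This gives \<open>4 * (1 / 6)\<close>, and
  \<open>60 = 4 * 14 + 4\<close>, where the last \<open>4\<close> pays for zeros.\<close>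

lemma quotient_energy:
  fixes M :: "real pmf"
  assumes atom: "\<And>x. pmf M x \<le> p" and "0 < p" "p \<le> 1 / 8"
  shows "coll (map_pmf (\<lambda>(x, y). x / y) (pair_pmf M M)) (map_pmf (\<lambda>(x, y). x / y) (pair_pmf M M))
    \<le> 2 / 3 * p + 60 * p\<^sup>2"
proof -
  let ?M2 = "pair_pmf M M"
  let ?Q = "pair_pmf ?M2 ?M2"
  define N where "N = {((a, d), (b, c)) | a b c d :: real.
    a * d = b * c \<and> b * c \<noteq> 0 \<and> \<bar>a\<bar> \<le> min \<bar>b\<bar> \<bar>c\<bar> \<and> max \<bar>b\<bar> \<bar>c\<bar> \<le> \<bar>d\<bar>}"
  \<comment> \<open>As \<open>x / 0 = 0\<close>, a quotient vanishes when either of its entries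
    does, and all such quotients collide.\<close>
  define Zr where "Zr = {z :: (real \<times> real) \<times> (real \<times> real).
    (fst (fst z) = 0 \<or> fst (snd z) = 0) \<and> (snd (snd z) = 0 \<or> snd (fst z) = 0)}"
  define s where "s z = (snd z, fst z)" for z :: "real \<times> real"
  have N: "measure_pmf.prob ?Q N \<le> p * (1 / 6 + 14 * p)"
  proof -
    have "N = {((a, d), (b, c)). a * d = b * c \<and> b * c \<noteq> 0 \<and> \<bar>a\<bar> \<le> min \<bar>b\<bar> \<bar>c\<bar> \<and> max \<bar>b\<bar> \<bar>c\<bar> \<le> \<bar>d\<bar>}"
      by (auto simp: N_def)
    then show ?thesis using nested_energy[OF assms] by simp
  qed
  have sM: "map_pmf s ?M2 = ?M2"
    by (subst (2) pair_commute_pmf) (simp add: s_def[abs_def] case_prod_unfold)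
  have swap1: "measure_pmf.prob ?Q {z. (s (fst z), snd z) \<in> A} = measure_pmf.prob ?Q A" for A
  proof -
    have "measure_pmf.prob (pair_pmf (map_pmf s ?M2) ?M2) A = measure_pmf.prob ?Q {z. (s (fst z), snd z) \<in> A}"
      by (simp add: pair_map_pmf1 vimage_def apfst_def map_prod_def case_prod_unfold)
    then show ?thesis by (simp add: sM)
  qed
  have swap2: "measure_pmf.prob ?Q {z. (snd z, fst z) \<in> A} = measure_pmf.prob ?Q A" for A
    by (rule prob_pair_swap[symmetric])
  let ?N2 = "{z. (s (fst z), snd z) \<in> N}"
  let ?N3 = "{z. (snd z, fst z) \<in> N}"
  let ?N4 = "{z. (snd z, fst z) \<in> ?N2}"
  have Zr: "measure_pmf.prob ?Q Zr \<le> 4 * p\<^sup>2"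
  proof -
    have zero: "measure_pmf.prob ?M2 {z. fst z = 0 \<or> snd z = 0} \<le> 2 * p"
    proof -
      have zeros: "{z. fst z = 0 \<or> snd z = 0} = {0} \<times> UNIV \<union> UNIV \<times> {0 :: real}" by auto
      have "measure_pmf.prob ?M2 {z. fst z = 0 \<or> snd z = 0}
          \<le> measure_pmf.prob ?M2 ({0} \<times> UNIV) + measure_pmf.prob ?M2 (UNIV \<times> {0})"
        unfolding zeros by (rule measure_Un_le) auto
      then show ?thesis using atom[of 0] by (simp add: prob_pair_Times measure_pmf_single)
    qed
    have "measure_pmf.prob ?Q ({z. fst z = 0 \<or> snd z = 0} \<times> {z. fst z = 0 \<or> snd z = 0}) = measure_pmf.prob ?Q Zr"
      unfolding Zr_def by (subst fourfold_regroup) (auto simp: vimage_def case_prod_unfold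
          intro!: arg_cong[where f = "measure_pmf.prob _"])
    then have "measure_pmf.prob ?Q Zr = measure_pmf.prob ?Q ({z. fst z = 0 \<or> snd z = 0} \<times> {z. fst z = 0 \<or> snd z = 0})" ..
    also have "\<dots> \<le> (2 * p) * (2 * p)"
      unfolding prob_pair_Times using zero \<open>0 < p\<close> by (intro mult_mono) auto
    finally show ?thesis by (simp add: power2_eq_square)
  qed
  have "coll (map_pmf (\<lambda>(x, y). x / y) ?M2) (map_pmf (\<lambda>(x, y). x / y) ?M2)
      = measure_pmf.prob ?Q {z. fst (fst z) / snd (fst z) = fst (snd z) / snd (snd z)}"
    by (simp add: coll_def pair_map_pmf1 pair_map_pmf2 vimage_def case_prod_unfold)
  also have "\<dots> = measure_pmf.prob ?Q {z. fst (fst z) / fst (snd z) = snd (snd z) / snd (fst z)}"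
    by (subst fourfold_regroup) (simp add: vimage_def case_prod_unfold)
  also have "\<dots> \<le> measure_pmf.prob ?Q (Zr \<union> ((N \<union> ?N2) \<union> (?N3 \<union> ?N4)))"
  proof (rule measure_pmf.finite_measure_mono)
    show "{z. fst (fst z) / fst (snd z) = snd (snd z) / snd (fst z)} \<subseteq> Zr \<union> ((N \<union> ?N2) \<union> (?N3 \<union> ?N4))"
    proof
      fix z :: "(real \<times> real) \<times> (real \<times> real)"
      obtain a d b c where z: "z = ((a, d), (b, c))" by (metis surj_pair)
      assume "z \<in> {z. fst (fst z) / fst (snd z) = snd (snd z) / snd (fst z)}"
      then have eq: "a / b = c / d" by (simp add: z)
      show "z \<in> Zr \<union> ((N \<union> ?N2) \<union> (?N3 \<union> ?N4))"
      proof (cases "a = 0 \<or> b = 0 \<or> c = 0 \<or> d = 0")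
        case True
        then have "(a = 0 \<or> b = 0) \<and> (c = 0 \<or> d = 0)" using eq by auto
        then show ?thesis by (simp add: Zr_def z)
      next
        case False
        then have "a * d = b * c" using eq by (simp add: field_simps)
        moreover have "b * c \<noteq> 0" "a * d \<noteq> 0" using False by auto
        ultimately show ?thesis
          using nested_cases[of a d b c] by (simp add: N_def z s_def mult.commute) argo
      qed
    qed
  qed simp
  also have "\<dots> \<le> measure_pmf.prob ?Q Zr + (measure_pmf.prob ?Q N + measure_pmf.prob ?Q ?N2
      + (measure_pmf.prob ?Q ?N3 + measure_pmf.prob ?Q ?N4))"
    by (intro order_trans[OF measure_Un_le] add_mono order_refl measure_Un_le) auto
  also have "\<dots> \<le> 4 * p\<^sup>2 + 4 * (p * (1 / 6 + 14 * p))"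
    using Zr N swap1[of N] swap2[of N] swap2[of ?N2] by simp
  also have "\<dots> = 2 / 3 * p + 60 * p\<^sup>2" by (simp add: power2_eq_square algebra_simps)
  finally show ?thesis .
qed

text \<open>Rewriting \<open>a * b = c * d\<close> as \<open>a / c = d / b\<close> puts both copies
  of \<open>A\<close> on one side and both copies of \<open>D\<close> on the other, so
  Cauchy-Schwarz leaves one law at a time. Zero products are counted apart and raise 60 to
  64.\<close>

lemma product_energy:
  fixes A D :: "real pmf"
  assumes A: "\<And>x. pmf A x \<le> p" and D: "\<And>x. pmf D x \<le> p" and "0 < p" "p \<le> 1 / 8"
  shows "coll (map_pmf (\<lambda>(x, y). x * y) (pair_pmf A D)) (map_pmf (\<lambda>(x, y). x * y) (pair_pmf A D))
    \<le> 2 / 3 * p + 64 * p\<^sup>2"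
proof -
  let ?q = "\<lambda>M. map_pmf (\<lambda>(x, y). x / y) (pair_pmf M M) :: real pmf"
  let ?W = "pair_pmf A D"
  let ?O = "{z. fst z = 0 \<or> snd z = (0 :: real)} \<times> {z. fst z = 0 \<or> snd z = (0 :: real)}"
  define e where "e = 2 / 3 * p + 60 * p\<^sup>2"
  have "0 \<le> e" using \<open>0 < p\<close> by (simp add: e_def)
  have zero: "measure_pmf.prob ?W {z. fst z = 0 \<or> snd z = 0} \<le> 2 * p"
  proof -
    have zeros: "{z. fst z = 0 \<or> snd z = 0} = {0} \<times> UNIV \<union> UNIV \<times> {0 :: real}" by auto
    have "measure_pmf.prob ?W {z. fst z = 0 \<or> snd z = 0}
        \<le> measure_pmf.prob ?W ({0} \<times> UNIV) + measure_pmf.prob ?W (UNIV \<times> {0})"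
      unfolding zeros by (rule measure_Un_le) auto
    then show ?thesis using A[of 0] D[of 0] by (simp add: prob_pair_Times measure_pmf_single)
  qed
  have q_comm: "map_pmf (\<lambda>(x, y). y / x) (pair_pmf D D) = ?q D"
    by (subst pair_commute_pmf) (simp add: pmf.map_comp o_def case_prod_unfold)
  have "coll (map_pmf (\<lambda>(x, y). x * y) ?W) (map_pmf (\<lambda>(x, y). x * y) ?W)
      = measure_pmf.prob (pair_pmf ?W ?W) {z. fst (fst z) * snd (fst z) = fst (snd z) * snd (snd z)}"
    by (simp add: coll_def pair_map_pmf1 pair_map_pmf2 vimage_def case_prod_unfold)
  also have "\<dots> \<le> measure_pmf.prob (pair_pmf ?W ?W)
      (?O \<union> {z. fst (fst z) / fst (snd z) = snd (snd z) / snd (fst z)})"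
  proof (rule measure_pmf.finite_measure_mono)
    show "{z. fst (fst z) * snd (fst z) = fst (snd z) * snd (snd z)}
      \<subseteq> ?O \<union> {z. fst (fst z) / fst (snd z) = snd (snd z) / snd (fst z)}"
    proof
      fix z :: "(real \<times> real) \<times> (real \<times> real)"
      obtain a b c d where z: "z = ((a, b), (c, d))" by (metis surj_pair)
      assume "z \<in> {z. fst (fst z) * snd (fst z) = fst (snd z) * snd (snd z)}"
      then have eq: "a * b = c * d" by (simp add: z)
      show "z \<in> ?O \<union> {z. fst (fst z) / fst (snd z) = snd (snd z) / snd (fst z)}"
      proof (cases "a = 0 \<or> b = 0 \<or> c = 0 \<or> d = 0")
        case True
        then have "(a = 0 \<or> b = 0) \<and> (c = 0 \<or> d = 0)"
          using eq by (metis mult_eq_0_iff)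
        then show ?thesis by (simp add: z)
      next
        case False
        then have "a / c = d / b" using eq by (simp add: field_simps)
        then show ?thesis by (simp add: z)
      qed
    qed
  qed simp
  also have "\<dots> \<le> measure_pmf.prob (pair_pmf ?W ?W) ?O
      + measure_pmf.prob (pair_pmf ?W ?W) {z. fst (fst z) / fst (snd z) = snd (snd z) / snd (fst z)}"
    by (rule measure_Un_le) auto
  also have "measure_pmf.prob (pair_pmf ?W ?W) ?O \<le> (2 * p) * (2 * p)"
    unfolding prob_pair_Times using zero \<open>0 < p\<close> by (intro mult_mono) auto
  also have "measure_pmf.prob (pair_pmf ?W ?W) {z. fst (fst z) / fst (snd z) = snd (snd z) / snd (fst z)}
      = coll (?q A) (?q D)"
    unfolding q_comm[symmetric] coll_def pair_map_pmf1 pair_map_pmf2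
    by (subst pair_pair_regroup) (simp add: vimage_def case_prod_unfold)
  also have "\<dots> \<le> sqrt (coll (?q A) (?q A) * coll (?q D) (?q D))"
    by (rule coll_Cauchy_Schwarz)
  also have "\<dots> \<le> sqrt (e * e)"
    using quotient_energy[of A p] quotient_energy[of D p] assms \<open>0 \<le> e\<close>
    by (intro real_sqrt_le_mono mult_mono) (auto simp: e_def)
  also have "\<dots> = e" using \<open>0 \<le> e\<close> by simp
  finally show ?thesis by (simp add: e_def power2_eq_square)
qed

lemma two_by_two_singular:
  fixes A B C D :: "real pmf"
  assumes "\<And>x. pmf A x \<le> p" "\<And>x. pmf B x \<le> p" "\<And>x. pmf C x \<le> p" "\<And>x. pmf D x \<le> p"
    and "0 < p" "p \<le> 1 / 8"
  shows "measure_pmf.prob (pair_pmf (pair_pmf A D) (pair_pmf B C)) {z. fst (fst z) * snd (fst z) = fst (snd z) * snd (snd z)}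
    \<le> 2 / 3 * p + 64 * p\<^sup>2"
proof -
  define e where "e = 2 / 3 * p + 64 * p\<^sup>2"
  have "0 \<le> e" using \<open>0 < p\<close> by (simp add: e_def)
  let ?m = "\<lambda>M N. map_pmf (\<lambda>(x, y). x * y) (pair_pmf M N) :: real pmf"
  have "measure_pmf.prob (pair_pmf (pair_pmf A D) (pair_pmf B C)) {z. fst (fst z) * snd (fst z) = fst (snd z) * snd (snd z)}
      = coll (?m A D) (?m B C)"
    by (simp add: coll_def pair_map_pmf1 pair_map_pmf2 vimage_def case_prod_unfold)
  also have "\<dots> \<le> sqrt (coll (?m A D) (?m A D) * coll (?m B C) (?m B C))"
    by (rule coll_Cauchy_Schwarz)
  also have "\<dots> \<le> sqrt (e * e)"
    using product_energy[of A p D] product_energy[of B p C] assms \<open>0 \<le> e\<close>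
    by (intro real_sqrt_le_mono mult_mono) (auto simp: e_def)
  also have "\<dots> = e" using \<open>0 \<le> e\<close> by simp
  finally show ?thesis by (simp add: e_def)
qed

section \<open>Concentration of linear forms\<close>

lemma pmf_le_max_atom: "pmf M x \<le> max_atom M"
  unfolding max_atom_def by (intro cSUP_upper) (auto intro!: bdd_aboveI2[where M = 1] simp: pmf_le_1)

lemma max_atom_le: "(\<And>x. pmf M x \<le> b) \<Longrightarrow> max_atom M \<le> b"
  unfolding max_atom_def by (intro cSUP_least) auto

lemma max_atom_nonneg: "0 \<le> max_atom M"
  by (rule order_trans[OF _ pmf_le_max_atom[of M 0]]) simp

lemma max_atom_sq_le_coll: "(max_atom M)\<^sup>2 \<le> coll M M"
proof -
  have "max_atom M \<le> sqrt (coll M M)"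
    by (rule max_atom_le) (rule real_le_rsqrt[OF coll_ge_pmf_sq])
  then have "(max_atom M)\<^sup>2 \<le> (sqrt (coll M M))\<^sup>2"
    using max_atom_nonneg by (rule power_mono)
  then show ?thesis by simp
qed

definition lsum :: "(nat \<Rightarrow> real pmf) \<Rightarrow> nat set \<Rightarrow> (nat \<Rightarrow> real) \<Rightarrow> real pmf" where
  "lsum \<eta> J v = map_pmf (\<lambda>x. \<Sum>j\<in>J. x j * v j) (Pi_pmf J 0 \<eta>)"

definition energy :: "(nat \<Rightarrow> real pmf) \<Rightarrow> nat set \<Rightarrow> (nat \<Rightarrow> real) \<Rightarrow> real" where
  "energy \<eta> J v = coll (lsum \<eta> J v) (lsum \<eta> J v)"

lemma energy_nonneg: "0 \<le> energy \<eta> J v" and energy_pos: "0 < energy \<eta> J v"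
  and energy_le_1: "energy \<eta> J v \<le> 1"
  by (simp_all add: energy_def coll_le_1 coll_pos)

lemma lsum_union:
  assumes "finite J" "finite K" "J \<inter> K = {}"
  shows "lsum \<eta> (J \<union> K) v = conv (lsum \<eta> J v) (lsum \<eta> K v)"
proof -
  have "(\<Sum>j\<in>J \<union> K. (if j \<in> J then f j else g j) * v j) = (\<Sum>j\<in>J. f j * v j) + (\<Sum>j\<in>K. g j * v j)" for f g
  proof -
    have "(\<Sum>j\<in>K. (if j \<in> J then f j else g j) * v j) = (\<Sum>j\<in>K. g j * v j)"
      using assms(3) by (intro sum.cong) auto
    then show ?thesis using assms by (simp add: sum.union_disjoint)
  qed
  then show ?thesis
    unfolding lsum_def conv_def Pi_pmf_union[OF assms]
    by (simp add: map_pair[symmetric] pmf.map_comp o_def case_prod_unfold)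
qed

lemma lsum_singleton: "lsum \<eta> {j} v = map_pmf (\<lambda>x. x * v j) (\<eta> j)"
  by (simp add: lsum_def Pi_pmf_singleton pmf.map_comp o_def)

lemma energy_antimono:
  assumes "J \<subseteq> K" "finite K"
  shows "energy \<eta> K v \<le> energy \<eta> J v"
proof -
  have "lsum \<eta> (J \<union> (K - J)) v = conv (lsum \<eta> J v) (lsum \<eta> (K - J) v)"
    using assms by (intro lsum_union) (auto intro: finite_subset)
  then have "lsum \<eta> K v = conv (lsum \<eta> J v) (lsum \<eta> (K - J) v)"
    using assms by (simp add: Un_absorb1)
  then show ?thesis by (simp add: energy_def coll_conv_le)
qed

lemma energy_le_atom:
  assumes "finite J" "j \<in> J" "v j \<noteq> 0" "\<And>x. pmf (\<eta> j) x \<le> p"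
  shows "energy \<eta> J v \<le> p"
proof -
  have "energy \<eta> J v \<le> energy \<eta> {j} v" using assms by (intro energy_antimono) auto
  also have "\<dots> = coll (\<eta> j) (\<eta> j)"
    unfolding energy_def lsum_singleton using assms by (intro coll_map_inj) (auto simp: inj_def)
  also have "\<dots> \<le> p" using assms by (intro coll_le)
  finally show ?thesis .
qed

lemma pmf_lsum_le_energy:
  assumes "J \<subseteq> K" "finite K"
  shows "pmf (lsum \<eta> K v) z \<le> sqrt (energy \<eta> J v * energy \<eta> (K - J) v)"
proof -
  have "lsum \<eta> (J \<union> (K - J)) v = conv (lsum \<eta> J v) (lsum \<eta> (K - J) v)"
    using assms by (intro lsum_union) (auto intro: finite_subset)
  then have "lsum \<eta> K v = conv (lsum \<eta> J v) (lsum \<eta> (K - J) v)"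
    using assms by (simp add: Un_absorb1)
  then show ?thesis by (simp add: energy_def pmf_conv_le)
qed

lemma pmf_lsum_le_atom:
  assumes "finite K" "j \<in> K" "v j \<noteq> 0" "\<And>x. pmf (\<eta> j) x \<le> p"
  shows "pmf (lsum \<eta> K v) z \<le> p"
proof -
  have "lsum \<eta> K v = conv (lsum \<eta> (K - {j}) v) (lsum \<eta> {j} v)"
    using lsum_union[of "K - {j}" "{j}" \<eta> v] assms by (simp add: insert_absorb)
  then have "pmf (lsum \<eta> K v) z
      = measure_pmf.prob (pair_pmf (lsum \<eta> (K - {j}) v) (lsum \<eta> {j} v)) {w. fst w + snd w = z}"
    by (simp add: conv_def pmf_map vimage_def case_prod_unfold)
  also have "\<dots> \<le> p"
  proof (rule prob_pair_le)
    fix x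
    have "{y. (x, y) \<in> {w. fst w + snd w = z}} = {z - x}" by auto
    moreover have "pmf (lsum \<eta> {j} v) (z - x) = pmf (\<eta> j) ((z - x) / v j)"
      using pmf_map_inj'[of "\<lambda>x. x * v j" "\<eta> j" "(z - x) / v j"] assms(3)
      by (simp add: lsum_singleton inj_def)
    ultimately show "measure_pmf.prob (lsum \<eta> {j} v) {y. (x, y) \<in> {w. fst w + snd w = z}} \<le> p"
      using assms(4) by (simp add: measure_pmf_single)
  qed
  finally show ?thesis .
qed

text \<open>Coordinates are added as long as one of them lowers the energy by the factor
  \<open>1 - \<epsilon>\<close>. The energy never falls below that of \<open>K\<close>, so this ends
  within \<open>D\<close> additions, and then no coordinate of \<open>K - J\<close> lowers it that
  much.\<close>

lemma greedy_stuck: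
  assumes "finite K" "0 < \<epsilon>" "\<epsilon> < 1" and low: "(1 - \<epsilon>) ^ Suc D < energy \<eta> K v"
  obtains J where "J \<subseteq> K" "card J \<le> D"
    "\<And>j. j \<in> K - J \<Longrightarrow> (1 - \<epsilon>) * energy \<eta> J v \<le> energy \<eta> (insert j J) v"
proof (rule ccontr)
  note obt = that
  assume neg: "\<not> thesis"
  have ex: "\<exists>j\<in>K - J. energy \<eta> (insert j J) v < (1 - \<epsilon>) * energy \<eta> J v"
    if "J \<subseteq> K" "card J \<le> D" for J
  proof (rule ccontr)
    assume "\<not> ?thesis"
    then have "\<And>j. j \<in> K - J \<Longrightarrow> (1 - \<epsilon>) * energy \<eta> J v \<le> energy \<eta> (insert j J) v"
      by (meson not_le)
    from obt[OF \<open>J \<subseteq> K\<close> \<open>card J \<le> D\<close> this] neg show False by blast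
  qed
  have "\<exists>J\<subseteq>K. card J = m \<and> energy \<eta> J v \<le> (1 - \<epsilon>) ^ m" if "m \<le> Suc D" for m
    using that
  proof (induction m)
    case 0
    then show ?case by (intro exI[of _ "{}"]) (simp add: energy_le_1)
  next
    case (Suc m)
    then obtain J where J: "J \<subseteq> K" "card J = m" "energy \<eta> J v \<le> (1 - \<epsilon>) ^ m" by auto
    then obtain j where j: "j \<in> K - J" "energy \<eta> (insert j J) v < (1 - \<epsilon>) * energy \<eta> J v"
      using ex[of J] Suc.prems by auto
    have "(1 - \<epsilon>) * energy \<eta> J v \<le> (1 - \<epsilon>) * (1 - \<epsilon>) ^ m"
      using J assms by (intro mult_left_mono) auto
    then show ?case
      using J j finite_subset[OF J(1) assms(1)] by (intro exI[of _ "insert j J"]) auto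
  qed
  from this[of "Suc D"] obtain J where "J \<subseteq> K" "energy \<eta> J v \<le> (1 - \<epsilon>) ^ Suc D" by auto
  then show False using energy_antimono[of J K \<eta> v] assms by linarith
qed

text \<open>Four disjoint greedy sets: the one of largest energy predicts every remaining coordinate, while
  the other coordinates make the concentration of the whole sum smaller by a constant factor.\<close>

lemma concentrated_structure:
  fixes \<eta> :: "nat \<Rightarrow> real pmf" and v :: "nat \<Rightarrow> real"
  assumes atom: "\<And>j x. j < n \<Longrightarrow> pmf (\<eta> j) x \<le> p" and p: "p \<le> 1/4" "p < 1 - \<epsilon>"
    and \<epsilon>: "0 < \<epsilon>" "\<epsilon> < 1" and low: "(1 - \<epsilon>) ^ Suc D < (max_atom (lsum \<eta> {..<n} v))\<^sup>2"
    and supp: "4 * D < card {j. j < n \<and> v j \<noteq> 0}"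
  obtains J F where "J \<subseteq> F" "F \<subseteq> {..<n}" "card F \<le> 4 * D"
    "\<And>j. j \<in> {..<n} - F \<Longrightarrow> (1 - \<epsilon>) * energy \<eta> J v \<le> energy \<eta> (insert j J) v"
    "max_atom (lsum \<eta> {..<n} v) \<le> (1 - 1/200) * energy \<eta> J v"
proof -
  let ?e = "\<lambda>J. energy \<eta> J v"
  define good where "good K J \<longleftrightarrow> J \<subseteq> K \<and> card J \<le> D \<and> ?e J \<le> p
      \<and> (\<forall>j\<in>K - J. (1 - \<epsilon>) * ?e J \<le> ?e (insert j J))" for K J
  have step: "\<exists>J. good K J" if K: "K \<subseteq> {..<n}" "card ({..<n} - K) \<le> 3 * D" for K
  proof -
    have fin: "finite K" using K(1) by (rule finite_subset) simp
    have "\<exists>j\<in>K. v j \<noteq> 0"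
    proof (rule ccontr)
      assume "\<not> ?thesis"
      then have "{j. j < n \<and> v j \<noteq> 0} \<subseteq> {..<n} - K" by auto
      then have "card {j. j < n \<and> v j \<noteq> 0} \<le> card ({..<n} - K)"
        by (intro card_mono) auto
      also note K(2)
      finally have "card {j. j < n \<and> v j \<noteq> 0} \<le> 3 * D" .
      then show False using supp by simp
    qed
    then obtain j where j: "j \<in> K" "v j \<noteq> 0" by blast
    have "(1 - \<epsilon>) ^ Suc D < ?e K"
      using low max_atom_sq_le_coll[of "lsum \<eta> {..<n} v"] energy_antimono[OF K(1), of \<eta> v]
      by (simp add: energy_def)
    from greedy_stuck[OF fin \<epsilon> this]
    obtain J where J: "J \<subseteq> K" "card J \<le> D"
      "\<And>j. j \<in> K - J \<Longrightarrow> (1 - \<epsilon>) * ?e J \<le> ?e (insert j J)"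
      by blast
    have finJ: "finite J" using J(1) fin by (rule finite_subset)
    have "?e J \<le> p"
    proof (cases "\<exists>i\<in>J. v i \<noteq> 0")
      case True
      then obtain i where "i \<in> J" "v i \<noteq> 0" by blast
      then show ?thesis using energy_le_atom[OF finJ, of i v \<eta> p] atom J K by (auto simp: subset_iff)
    next
      \<comment> \<open>A sum over zeros of \<open>v\<close> is constant and has energy 1. A
        coordinate with \<open>v j \<noteq> 0\<close> would lower this to
        \<open>p < 1 - \<epsilon>\<close>, so the greedy choice cannot have stopped there.\<close>
      case False
      have "(\<lambda>x. \<Sum>j\<in>J. x j * v j) = (\<lambda>_. 0)" using False by auto
      then have "lsum \<eta> J v = return_pmf 0" by (simp add: lsum_def)
      then have "?e J = 1" by (simp add: energy_def coll_expectation)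
      moreover have "j \<notin> J" using False j by blast
      then have "(1 - \<epsilon>) * ?e J \<le> ?e (insert j J)" using J j by blast
      moreover have "?e (insert j J) \<le> p"
        using finJ j K by (intro energy_le_atom[of _ j] atom) auto
      ultimately show ?thesis using p by simp
    qed
    then show ?thesis using J by (auto simp: good_def)
  qed
  have goodD: "J \<subseteq> {..<n}" "finite J" "card J \<le> D" if "good K J" "K \<subseteq> {..<n}" for K J
    using that finite_subset[of J "{..<n}"] by (auto simp: good_def)
  obtain A where A: "good {..<n} A" using step[of "{..<n}"] by auto
  note A' = goodD[OF A subset_refl]
  have "{..<n} - ({..<n} - A) = A" using A' by auto
  then obtain B where B: "good ({..<n} - A) B" using step[of "{..<n} - A"] A' by auto
  note B' = goodD[OF B Diff_subset]
  have "{..<n} - ({..<n} - (A \<union> B)) = A \<union> B" "card (A \<union> B) \<le> 3 * D"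
    using A' B' card_Un_le[of A B] by auto
  then obtain C where C: "good ({..<n} - (A \<union> B)) C" using step[of "{..<n} - (A \<union> B)"] by auto
  note C' = goodD[OF C Diff_subset]
  have "{..<n} - ({..<n} - (A \<union> B \<union> C)) = A \<union> B \<union> C" "card (A \<union> B \<union> C) \<le> 3 * D"
    using A' B' C' card_Un_le[of A B] card_Un_le[of "A \<union> B" C] by auto
  then obtain E where E: "good ({..<n} - (A \<union> B \<union> C)) E" using step[of "{..<n} - (A \<union> B \<union> C)"] by auto
  note E' = goodD[OF E Diff_subset]
  define F where "F = A \<union> B \<union> C \<union> E"
  \<comment> \<open>The gains on \<open>A \<union> B\<close> and on \<open>C \<union> E\<close> are
    measured against the largest energy \<open>b\<close>, so the predicting set \<open>J\<close>
    must attain it.\<close>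
  define b where "b = Max {?e A, ?e B, ?e C, ?e E}"
  have le_b: "?e A \<le> b" "?e B \<le> b" "?e C \<le> b" "?e E \<le> b" by (auto simp: b_def)
  have "b \<in> {?e A, ?e B, ?e C, ?e E}" unfolding b_def by (rule Max_in) auto
  then obtain J where J: "?e J = b" "J = A \<or> J = B \<or> J = C \<or> J = E" by blast
  have "?e A \<le> p" "?e B \<le> p" "?e C \<le> p" "?e E \<le> p"
    using A B C E by (simp_all only: good_def)
  then have "b \<le> 1/4" using p J(2) unfolding J(1)[symmetric] by auto
  have disj: "A \<inter> B = {}" "C \<inter> E = {}" and sub: "C \<union> E \<subseteq> {..<n} - (A \<union> B)"
    using B C E unfolding good_def by blast+
  have AB: "?e (A \<union> B) \<le> (1 - 1/200) * b"
    unfolding energy_def lsum_union[OF A'(2) B'(2) disj(1)]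
    using le_b \<open>b \<le> 1/4\<close> by (intro coll_conv_gain) (simp_all add: energy_def)
  have CE: "?e (C \<union> E) \<le> (1 - 1/200) * b"
    unfolding energy_def lsum_union[OF C'(2) E'(2) disj(2)]
    using le_b \<open>b \<le> 1/4\<close> by (intro coll_conv_gain) (simp_all add: energy_def)
  have rest: "?e ({..<n} - (A \<union> B)) \<le> (1 - 1/200) * b"
    using CE energy_antimono[OF sub, of \<eta> v] by simp
  show ?thesis
  proof
    show "J \<subseteq> F" "F \<subseteq> {..<n}" using J A' B' C' E' by (auto simp: F_def)
    show "card F \<le> 4 * D"
      unfolding F_def using A' B' C' E' card_Un_le[of A B] card_Un_le[of "A \<union> B" C] card_Un_le[of "A \<union> B \<union> C" E]
      by linarith
    show "(1 - \<epsilon>) * ?e J \<le> ?e (insert j J)" if "j \<in> {..<n} - F" for j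
      using that J A B C E unfolding good_def F_def by blast
    show "max_atom (lsum \<eta> {..<n} v) \<le> (1 - 1/200) * ?e J"
    proof (rule max_atom_le)
      fix z
      have "pmf (lsum \<eta> {..<n} v) z \<le> sqrt (?e (A \<union> B) * ?e ({..<n} - (A \<union> B)))"
        using A' B' by (intro pmf_lsum_le_energy) auto
      also have "\<dots> \<le> sqrt (((1 - 1/200) * b) * ((1 - 1/200) * b))"
        using AB rest order_trans[OF energy_nonneg AB]
        by (intro real_sqrt_le_mono mult_mono energy_nonneg) auto
      also have "\<dots> = (1 - 1/200) * ?e J"
        using order_trans[OF energy_nonneg AB] by (simp only: real_sqrt_abs2 abs_of_nonneg J)
      finally show "pmf (lsum \<eta> {..<n} v) z \<le> (1 - 1/200) * ?e J" .
    qed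
  qed
qed

section \<open>Kernels of random matrices with concentrated vectors\<close>

text \<open>Row rank is at most the number of columns. Each induction step eliminates one column,
  and its pivot row joins \<open>R\<close>.\<close>

lemma common_kernel_of_few_rows:
  fixes a :: "'i \<Rightarrow> 'f \<Rightarrow> real"
  assumes "finite F"
  shows "\<exists>R\<subseteq>I. finite R \<and> card R \<le> card F \<and>
    (\<forall>w. (\<forall>i\<in>R. (\<Sum>f\<in>F. a i f * w f) = 0) \<longrightarrow> (\<forall>i\<in>I. (\<Sum>f\<in>F. a i f * w f) = 0))"
  using assms
proof (induction F arbitrary: a rule: finite_induct)
  case empty
  show ?case by (intro exI[of _ "{}"]) auto
next
  case (insert f F)
  show ?case
  proof (cases "\<forall>i\<in>I. a i f = 0")
    case True
    from insert.IH[of a] obtain R where R: "R \<subseteq> I" "finite R" "card R \<le> card F"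
      "\<And>w i. \<forall>i\<in>R. (\<Sum>f\<in>F. a i f * w f) = 0 \<Longrightarrow> i \<in> I \<Longrightarrow> (\<Sum>f\<in>F. a i f * w f) = 0" by blast
    have "(\<Sum>f\<in>insert f F. a i f * w f) = (\<Sum>f\<in>F. a i f * w f)" if "i \<in> I" for i w
      using True insert that by simp
    note eq = this
    show ?thesis
    proof (intro exI[of _ R] conjI allI impI ballI)
      show "card R \<le> card (insert f F)" using R insert by simp
      fix w i assume "\<forall>i\<in>R. (\<Sum>f\<in>insert f F. a i f * w f) = 0" "i \<in> I"
      then show "(\<Sum>f\<in>insert f F. a i f * w f) = 0" using R(4)[of w i] R(1) eq by (metis subsetD)
    qed (use R in auto)
  next
    case False
    then obtain k where k: "k \<in> I" "a k f \<noteq> 0" by blast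
    define a' where "a' i g = a i g - a i f / a k f * a k g" for i g
    from insert.IH[of a'] obtain R where R: "R \<subseteq> I" "finite R" "card R \<le> card F"
      "\<And>w i. \<forall>i\<in>R. (\<Sum>f\<in>F. a' i f * w f) = 0 \<Longrightarrow> i \<in> I \<Longrightarrow> (\<Sum>f\<in>F. a' i f * w f) = 0" by blast
    have eq: "(\<Sum>g\<in>F. a' i g * w g) = (\<Sum>g\<in>insert f F. a i g * w g)"
      if "(\<Sum>g\<in>insert f F. a k g * w g) = 0" for i w
    proof -
      have "(\<Sum>g\<in>F. a' i g * w g) = (\<Sum>g\<in>insert f F. a' i g * w g)"
        using insert k by (simp add: a'_def)
      also have "\<dots> = (\<Sum>g\<in>insert f F. a i g * w g) - a i f / a k f * (\<Sum>g\<in>insert f F. a k g * w g)"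
        unfolding a'_def sum_distrib_left sum_subtractf[symmetric] by (intro sum.cong) (auto simp: algebra_simps)
      finally show ?thesis using that by simp
    qed
    show ?thesis
    proof (intro exI[of _ "insert k R"] conjI allI impI ballI)
      show "card (insert k R) \<le> card (insert f F)"
        using R insert card_insert_le_m1[of "card (insert f F)" R k] by (simp add: card_insert_if)
      fix w i
      assume z: "\<forall>i\<in>insert k R. (\<Sum>f\<in>insert f F. a i f * w f) = 0" and i: "i \<in> I"
      then have "(\<Sum>f\<in>F. a' i f * w f) = 0" using R(4)[of w i] eq[of w] by simp
      then show "(\<Sum>f\<in>insert f F. a i f * w f) = 0" using eq[of w i] z by simp
    qed (use R k in auto)
  qed
qed

text \<open>A small subset is the set of letters of a word of length \<open>d\<close>; the extra
  letter \<open>None\<close> pads the word.\<close>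

lemma card_small_subsets:
  assumes "finite A"
  shows "finite {R. R \<subseteq> A \<and> card R \<le> d}" "card {R. R \<subseteq> A \<and> card R \<le> d} \<le> (card A + 1) ^ d"
proof -
  let ?B = "insert None (Some ` A)"
  let ?L = "{xs. set xs \<subseteq> ?B \<and> length xs = d}"
  have sub: "{R. R \<subseteq> A \<and> card R \<le> d} \<subseteq> (\<lambda>xs. {a. Some a \<in> set xs}) ` ?L"
  proof
    fix R assume R: "R \<in> {R. R \<subseteq> A \<and> card R \<le> d}"
    then have "finite R" using assms by (auto intro: finite_subset)
    then obtain ys where ys: "set ys = R" "distinct ys"
      using finite_distinct_list by blast
    let ?xs = "map Some ys @ replicate (d - card R) None"
    have "length ys = card R" using distinct_card[OF ys(2)] ys(1) by simp
    then have "?xs \<in> ?L" "R = {a. Some a \<in> set ?xs}" using R ys by auto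
    then show "R \<in> (\<lambda>xs. {a. Some a \<in> set xs}) ` ?L" by blast
  qed
  have fin: "finite ?L" using assms by (intro finite_lists_length_eq) auto
  then show "finite {R. R \<subseteq> A \<and> card R \<le> d}" by (intro finite_subset[OF sub] finite_imageI)
  have "card {R. R \<subseteq> A \<and> card R \<le> d} \<le> card ((\<lambda>xs. {a. Some a \<in> set xs}) ` ?L)"
    using fin by (intro card_mono[OF _ sub]) simp
  also have "\<dots> \<le> card ?L" by (rule card_image_le[OF fin])
  also have "\<dots> = card ?B ^ d" using assms by (intro card_lists_length_eq) auto
  also have "card ?B = card A + 1" using assms by (simp add: card_image card_insert_if)
  finally show "card {R. R \<subseteq> A \<and> card R \<le> d} \<le> (card A + 1) ^ d" .
qed

text \<open>Curried by rows, so that any set of rows can be split off as an independent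
  factor.\<close>

definition row_matrix :: "nat \<Rightarrow> (nat \<Rightarrow> nat \<Rightarrow> real pmf) \<Rightarrow> (nat \<Rightarrow> nat \<Rightarrow> real) pmf" where
  "row_matrix n \<xi> = Pi_pmf {..<n} (\<lambda>_. 0) (\<lambda>i. Pi_pmf {..<n} 0 (\<xi> i))"

definition dot :: "nat \<Rightarrow> (nat \<Rightarrow> real) \<Rightarrow> (nat \<Rightarrow> real) \<Rightarrow> real" where
  "dot n r v = (\<Sum>j<n. r j * v j)"

lemma prob_dot_zero: "measure_pmf.prob (Pi_pmf {..<n} 0 \<eta>) {r. dot n r v = 0} = pmf (lsum \<eta> {..<n} v) 0"
  by (simp add: lsum_def pmf_map dot_def vimage_def)

text \<open>The vectors of \<open>V\<close> that are parametrised linearly by their coordinates in \<open>F\<close>: at most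
  \<open>card F\<close> rows cut out the same kernel as all rows, and the remaining rows must annihilate a vector that is
  determined by those.\<close>

lemma prob_kernel_meets_subspace:
  assumes F: "F \<subseteq> {..<n}" and \<beta>: "0 \<le> \<beta>" "\<beta> \<le> 1"
    and conc: "\<And>v i. v \<in> V \<Longrightarrow> i < n \<Longrightarrow> pmf (lsum (\<xi> i) {..<n} v) 0 \<le> \<beta>"
  shows "measure_pmf.prob (row_matrix n \<xi>)
      {r. \<exists>v\<in>V. (\<forall>j\<in>{..<n} - F. v j = (\<Sum>l\<in>F. c j l * v l)) \<and> (\<forall>i<n. dot n (r i) v = 0)}
    \<le> (n + 1) ^ card F * \<beta> ^ (n - card F)"
proof -
  have finF: "finite F" using F finite_subset by blast
  define W where "W = {v. \<forall>j\<in>{..<n} - F. v j = (\<Sum>l\<in>F. c j l * v l)}"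
  define \<R> where "\<R> = {R. R \<subseteq> {..<n} \<and> card R \<le> card F}"
  define E where "E R = {r. (\<exists>v\<in>V \<inter> W. \<forall>i\<in>R. dot n (r i) v = 0) \<and>
    (\<forall>v\<in>W. (\<forall>i\<in>R. dot n (r i) v = 0) \<longrightarrow> (\<forall>i<n. dot n (r i) v = 0))}" for R
  have finR: "finite \<R>" and cardR: "card \<R> \<le> (n + 1) ^ card F"
    unfolding \<R>_def using card_small_subsets[of "{..<n}" "card F"] by auto
  have sub: "{r. \<exists>v\<in>V. (\<forall>j\<in>{..<n} - F. v j = (\<Sum>l\<in>F. c j l * v l)) \<and> (\<forall>i<n. dot n (r i) v = 0)}
      \<subseteq> (\<Union>R\<in>\<R>. E R)"
  proof
    fix r assume "r \<in> {r. \<exists>v\<in>V. (\<forall>j\<in>{..<n} - F. v j = (\<Sum>l\<in>F. c j l * v l)) \<and> (\<forall>i<n. dot n (r i) v = 0)}"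
    then obtain v where v: "v \<in> V" "v \<in> W" "\<forall>i<n. dot n (r i) v = 0" by (auto simp: W_def)
    \<comment> \<open>On \<open>W\<close> every row becomes a linear form in the coordinates from
      \<open>F\<close> alone, with coefficients \<open>a\<close>, so only \<open>card F\<close>
      columns remain for the elimination.\<close>
    define a where "a i l = r i l + (\<Sum>j\<in>{..<n} - F. r i j * c j l)" for i l
    have dot: "dot n (r i) v = (\<Sum>l\<in>F. a i l * v l)" if "v \<in> W" for v i
    proof -
      have "dot n (r i) v = (\<Sum>l\<in>F. r i l * v l) + (\<Sum>j\<in>{..<n} - F. r i j * v j)"
        unfolding dot_def using F by (subst sum.subset_diff[of F]) auto
      also have "(\<Sum>j\<in>{..<n} - F. r i j * v j) = (\<Sum>j\<in>{..<n} - F. \<Sum>l\<in>F. r i j * c j l * v l)"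
        using that by (intro sum.cong) (auto simp: W_def sum_distrib_left mult.assoc)
      also have "\<dots> = (\<Sum>l\<in>F. (\<Sum>j\<in>{..<n} - F. r i j * c j l) * v l)"
        by (subst sum.swap) (simp add: sum_distrib_right)
      finally show ?thesis by (simp add: a_def ring_distribs sum.distrib)
    qed
    obtain R where R: "R \<subseteq> {..<n}" "card R \<le> card F"
      "\<And>w i. \<forall>i\<in>R. (\<Sum>f\<in>F. a i f * w f) = 0 \<Longrightarrow> i \<in> {..<n} \<Longrightarrow> (\<Sum>f\<in>F. a i f * w f) = 0"
      using common_kernel_of_few_rows[OF finF, of "{..<n}" a] by blast
    have "r \<in> E R" unfolding E_def using v R dot by (auto simp: subset_iff)
    then show "r \<in> (\<Union>R\<in>\<R>. E R)" using R by (auto simp: \<R>_def)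
  qed
  have E: "measure_pmf.prob (row_matrix n \<xi>) (E R) \<le> \<beta> ^ (n - card F)" if "R \<in> \<R>" for R
  proof -
    let ?q = "\<lambda>i. Pi_pmf {..<n} 0 (\<xi> i)"
    let ?h = "\<lambda>(f, g) x. if x \<in> R then f x else g x"
    have R: "R \<subseteq> {..<n}" "card R \<le> card F" using that by (auto simp: \<R>_def)
    have split: "row_matrix n \<xi> = map_pmf ?h (pair_pmf (Pi_pmf R (\<lambda>_. 0) ?q) (Pi_pmf ({..<n} - R) (\<lambda>_. 0) ?q))"
      unfolding row_matrix_def using R finite_subset[OF R(1)]
      by (subst Pi_pmf_union[symmetric]) (auto simp: Un_absorb1)
    have "measure_pmf.prob (row_matrix n \<xi>) (E R)
        = measure_pmf.prob (pair_pmf (Pi_pmf R (\<lambda>_. 0) ?q) (Pi_pmf ({..<n} - R) (\<lambda>_. 0) ?q)) (?h -` E R)"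
      unfolding split by simp
    also have "\<dots> \<le> \<beta> ^ (n - card R)"
    proof (rule prob_pair_le)
      fix f
      show "measure_pmf.prob (Pi_pmf ({..<n} - R) (\<lambda>_. 0) ?q) {g. (f, g) \<in> ?h -` E R} \<le> \<beta> ^ (n - card R)"
      proof (cases "\<exists>v\<in>V \<inter> W. \<forall>i\<in>R. dot n (f i) v = 0")
        case True
        then obtain v where v: "v \<in> V" "v \<in> W" "\<forall>i\<in>R. dot n (f i) v = 0" by blast
        have "measure_pmf.prob (Pi_pmf ({..<n} - R) (\<lambda>_. 0) ?q) {g. (f, g) \<in> ?h -` E R}
            \<le> measure_pmf.prob (Pi_pmf ({..<n} - R) (\<lambda>_. 0) ?q) (Pi ({..<n} - R) (\<lambda>i. {r. dot n r v = 0}))"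
        proof (rule measure_pmf.finite_measure_mono)
          show "{g. (f, g) \<in> ?h -` E R} \<subseteq> Pi ({..<n} - R) (\<lambda>i. {r. dot n r v = 0})"
          proof (intro subsetI Pi_I CollectI)
            fix g i assume g: "g \<in> {g. (f, g) \<in> ?h -` E R}" and i: "i \<in> {..<n} - R"
            have "\<forall>k\<in>R. dot n (?h (f, g) k) v = 0" using v by simp
            then have "dot n (?h (f, g) i) v = 0" using g i v(2) unfolding E_def by blast
            then show "dot n (g i) v = 0" using i by simp
          qed
        qed simp
        also have "\<dots> = (\<Prod>i\<in>{..<n} - R. pmf (lsum (\<xi> i) {..<n} v) 0)"
          by (subst measure_Pi_pmf_Pi) (simp_all add: prob_dot_zero)
        also have "\<dots> \<le> (\<Prod>i\<in>{..<n} - R. \<beta>)"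
          using conc[OF v(1)] by (intro prod_mono) auto
        also have "\<dots> = \<beta> ^ (n - card R)"
          using R by (simp add: card_Diff_subset finite_subset)
        finally show ?thesis .
      next
        case False
        have "{g. (f, g) \<in> ?h -` E R} = {}"
        proof (rule ccontr)
          assume "\<not> ?thesis"
          then obtain g where "?h (f, g) \<in> E R" by blast
          then obtain v where "v \<in> V \<inter> W" "\<forall>i\<in>R. dot n (?h (f, g) i) v = 0" unfolding E_def by blast
          then show False using False by auto
        qed
        then show ?thesis using \<beta> by simp
      qed
    qed
    also have "\<dots> \<le> \<beta> ^ (n - card F)" using R \<beta> by (intro power_decreasing) auto
    finally show ?thesis .
  qed
  have "measure_pmf.prob (row_matrix n \<xi>)
      {r. \<exists>v\<in>V. (\<forall>j\<in>{..<n} - F. v j = (\<Sum>l\<in>F. c j l * v l)) \<and> (\<forall>i<n. dot n (r i) v = 0)}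
    \<le> measure_pmf.prob (row_matrix n \<xi>) (\<Union>R\<in>\<R>. E R)"
    by (rule measure_pmf.finite_measure_mono[OF sub]) simp
  also have "\<dots> \<le> (\<Sum>R\<in>\<R>. measure_pmf.prob (row_matrix n \<xi>) (E R))"
    by (rule measure_UNION_le[OF finR]) simp
  also have "\<dots> \<le> (\<Sum>R\<in>\<R>. \<beta> ^ (n - card F))" by (intro sum_mono E)
  also have "\<dots> = card \<R> * \<beta> ^ (n - card F)" by simp
  also have "\<dots> \<le> (n + 1) ^ card F * \<beta> ^ (n - card F)"
    using cardR \<beta> by (intro mult_right_mono) (auto simp flip: of_nat_power of_nat_Suc simp del: of_nat_add)
  finally show ?thesis by (simp add: add.commute)
qed

text \<open>A collision of the sums over \<open>insert j J\<close> with different values at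
  \<open>j\<close> expresses \<open>v j\<close> through \<open>v\<close> on \<open>J\<close>. With
  equal values at \<open>j\<close> the sums over \<open>J\<close> must collide as well, which is
  independent of the values at \<open>j\<close>; this is the subtracted term.\<close>

lemma prob_predicted_coordinate:
  fixes \<eta> :: "nat \<Rightarrow> real pmf"
  assumes J: "finite J" "j \<notin> J" and atom: "\<And>x. pmf (\<eta> j) x \<le> p"
  defines "P \<equiv> Pi_pmf J 0 \<eta>"
  shows "energy \<eta> (insert j J) v - p * energy \<eta> J v
    \<le> measure_pmf.prob (pair_pmf (pair_pmf P P) (pair_pmf (\<eta> j) (\<eta> j)))
        {z. fst (snd z) \<noteq> snd (snd z) \<and> (\<Sum>l\<in>J. fst (fst z) l * v l) + fst (snd z) * v j
          = (\<Sum>l\<in>J. snd (fst z) l * v l) + snd (snd z) * v j}" (is "_ \<le> measure_pmf.prob ?Q ?H")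
proof -
  let ?S = "\<lambda>x. \<Sum>l\<in>J. x l * v l"
  let ?D = "{z. ?S (fst z) = ?S (snd z)} \<times> {z. fst z = snd z}"
  let ?C = "pair_pmf P (\<eta> j)"
  have "lsum \<eta> (insert j J) v = conv (lsum \<eta> J v) (lsum \<eta> {j} v)"
    using lsum_union[of J "{j}" \<eta> v] J by simp
  also have "\<dots> = map_pmf (\<lambda>w. ?S (fst w) + snd w * v j) ?C"
    unfolding lsum_singleton unfolding lsum_def conv_def P_def
    by (simp add: map_pair[symmetric] pmf.map_comp o_def case_prod_unfold)
  finally have "energy \<eta> (insert j J) v = measure_pmf.prob (pair_pmf ?C ?C)
      {z. ?S (fst (fst z)) + snd (fst z) * v j = ?S (fst (snd z)) + snd (snd z) * v j}"
    by (simp add: energy_def coll_def pair_map_pmf1 pair_map_pmf2 vimage_def case_prod_unfold)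
  also have "\<dots> = measure_pmf.prob ?Q
      {z. ?S (fst (fst z)) + fst (snd z) * v j = ?S (snd (fst z)) + snd (snd z) * v j}"
    by (subst pair_pair_regroup) (simp add: vimage_def case_prod_unfold)
  also have "\<dots> \<le> measure_pmf.prob ?Q (?H \<union> ?D)"
    by (rule measure_pmf.finite_measure_mono) auto
  also have "\<dots> \<le> measure_pmf.prob ?Q ?H + measure_pmf.prob ?Q ?D"
    by (rule measure_Un_le) auto
  also have "measure_pmf.prob ?Q ?D = energy \<eta> J v * coll (\<eta> j) (\<eta> j)"
    unfolding prob_pair_Times
    by (simp add: energy_def coll_def lsum_def P_def pair_map_pmf1 pair_map_pmf2 vimage_def case_prod_unfold)
  also have "\<dots> \<le> energy \<eta> J v * p"
    using coll_le[of "\<eta> j" p "\<eta> j"] atom by (intro mult_left_mono) (auto simp: energy_nonneg)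
  finally show ?thesis by (simp add: mult.commute)
qed

text \<open>Guess each coordinate outside \<open>F\<close> by sampling: the guess is correct with probability about
  \<open>energy \<eta> J v\<close>, whatever \<open>v\<close> is, and correct guesses make \<open>v\<close> a linear function of its
  coordinates in \<open>F\<close>. This replaces a union bound over the infinitely many candidates for \<open>v\<close>.\<close>

lemma prob_structured_kernel:
  fixes \<xi> :: "nat \<Rightarrow> nat \<Rightarrow> real pmf" and \<eta> :: "nat \<Rightarrow> real pmf"
  assumes JF: "J \<subseteq> F" "F \<subseteq> {..<n}" and atom: "\<And>j x. j < n \<Longrightarrow> pmf (\<eta> j) x \<le> p"
    and h: "0 \<le> h" "0 \<le> 1 - \<epsilon> - p" and \<beta>: "0 \<le> \<beta>" "\<beta> \<le> 1"
    and conc: "\<And>v i. v \<in> V \<Longrightarrow> i < n \<Longrightarrow> pmf (lsum (\<xi> i) {..<n} v) 0 \<le> \<beta>"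
    and stuck: "\<And>v j. v \<in> V \<Longrightarrow> j \<in> {..<n} - F \<Longrightarrow> (1 - \<epsilon>) * energy \<eta> J v \<le> energy \<eta> (insert j J) v"
    and low: "\<And>v. v \<in> V \<Longrightarrow> h \<le> energy \<eta> J v"
  shows "measure_pmf.prob (row_matrix n \<xi>) {r. \<exists>v\<in>V. \<forall>i<n. dot n (r i) v = 0} * ((1 - \<epsilon> - p) * h) ^ (n - card F)
    \<le> (real n + 1) ^ card F * \<beta> ^ (n - card F)"
proof -
  define P where "P = Pi_pmf J 0 \<eta>"
  define hit :: "(nat \<Rightarrow> real) \<Rightarrow> nat \<Rightarrow> (((nat \<Rightarrow> real) \<times> (nat \<Rightarrow> real)) \<times> (real \<times> real)) set"
    where "hit v j = {z. fst (snd z) \<noteq> snd (snd z) \<and> (\<Sum>l\<in>J. fst (fst z) l * v l) + fst (snd z) * v j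
          = (\<Sum>l\<in>J. snd (fst z) l * v l) + snd (snd z) * v j}"
    for v j
  define Q where "Q = Pi_pmf ({..<n} - F) undefined (\<lambda>j. pair_pmf (pair_pmf P P) (pair_pmf (\<eta> j) (\<eta> j)))"
  define A where "A = {(r, \<alpha>). \<exists>v\<in>V. (\<forall>i<n. dot n (r i) v = 0) \<and> (\<forall>j\<in>{..<n} - F. \<alpha> j \<in> hit v j)}"
  have "finite F" by (rule finite_subset[OF JF(2)]) simp
  then have finF: "finite F" "finite J" using finite_subset[OF JF(1)] by auto
  have card: "card ({..<n} - F) = n - card F" using JF finF by (simp add: card_Diff_subset)
  have "measure_pmf.prob (row_matrix n \<xi>) {r. \<exists>v\<in>V. \<forall>i<n. dot n (r i) v = 0} * ((1 - \<epsilon> - p) * h) ^ (n - card F)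
      \<le> measure_pmf.prob (pair_pmf (row_matrix n \<xi>) Q) A"
  proof (rule prob_pair_ge)
    fix r :: "nat \<Rightarrow> nat \<Rightarrow> real"
    assume "\<exists>v\<in>V. \<forall>i<n. dot n (r i) v = 0"
    then obtain v where v: "v \<in> V" "\<forall>i<n. dot n (r i) v = 0" by blast
    have "(1 - \<epsilon> - p) * h \<le> measure_pmf.prob (pair_pmf (pair_pmf P P) (pair_pmf (\<eta> j) (\<eta> j))) (hit v j)"
      if j: "j \<in> {..<n} - F" for j
    proof -
      have "j \<notin> J" "j < n" using j JF by auto
      have "(1 - \<epsilon> - p) * h \<le> (1 - \<epsilon> - p) * energy \<eta> J v"
        using h low[OF v(1)] by (intro mult_left_mono)
      also have "\<dots> \<le> energy \<eta> (insert j J) v - p * energy \<eta> J v"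
        using stuck[OF v(1) j] by (simp add: algebra_simps)
      also have "\<dots> \<le> measure_pmf.prob (pair_pmf (pair_pmf P P) (pair_pmf (\<eta> j) (\<eta> j))) (hit v j)"
        unfolding hit_def P_def using atom[OF \<open>j < n\<close>]
        by (rule prob_predicted_coordinate[OF finF(2) \<open>j \<notin> J\<close>])
      finally show ?thesis .
    qed
    then have "(\<Prod>j\<in>{..<n} - F. (1 - \<epsilon> - p) * h)
        \<le> (\<Prod>j\<in>{..<n} - F. measure_pmf.prob (pair_pmf (pair_pmf P P) (pair_pmf (\<eta> j) (\<eta> j))) (hit v j))"
      using h by (intro prod_mono) auto
    also have "\<dots> = measure_pmf.prob Q (Pi ({..<n} - F) (hit v))"
      unfolding Q_def by (subst measure_Pi_pmf_Pi) simp_all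
    also have "\<dots> \<le> measure_pmf.prob Q {\<alpha>. (r, \<alpha>) \<in> A}"
      by (rule measure_pmf.finite_measure_mono) (use v in \<open>auto simp: A_def Pi_def\<close>)
    finally show "((1 - \<epsilon> - p) * h) ^ (n - card F) \<le> measure_pmf.prob Q {\<alpha>. (r, \<alpha>) \<in> A}"
      by (simp add: card)
  qed
  \<comment> \<open>Double counting: for fixed rows the samples succeed with a probability bounded
    below; for fixed samples the rows must annihilate a vector from one subspace parametrised by
    \<open>F\<close>.\<close>
  also have "\<dots> = measure_pmf.prob (pair_pmf Q (row_matrix n \<xi>)) {z. (snd z, fst z) \<in> A}"
    by (rule prob_pair_swap)
  also have "\<dots> \<le> (real n + 1) ^ card F * \<beta> ^ (n - card F)"
  proof (rule prob_pair_le)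
    fix \<alpha> :: "nat \<Rightarrow> ((nat \<Rightarrow> real) \<times> (nat \<Rightarrow> real)) \<times> (real \<times> real)"
    \<comment> \<open>The collision equation solved for \<open>v j\<close>. The coefficients depend
      on the sample only, not on \<open>v\<close>.\<close>
    define c where "c j l = (if l \<in> J then (fst (fst (\<alpha> j)) l - snd (fst (\<alpha> j)) l) / (snd (snd (\<alpha> j)) - fst (snd (\<alpha> j))) else 0)"
      for j l
    have lin: "v j = (\<Sum>l\<in>F. c j l * v l)" if "\<alpha> j \<in> hit v j" for v and j :: nat
    proof -
      define d where "d = snd (snd (\<alpha> j)) - fst (snd (\<alpha> j))"
      have "d \<noteq> 0" using that by (simp add: hit_def d_def)
      have "d * v j = (\<Sum>l\<in>J. fst (fst (\<alpha> j)) l * v l) - (\<Sum>l\<in>J. snd (fst (\<alpha> j)) l * v l)"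
        using that by (simp add: hit_def d_def algebra_simps)
      also have "\<dots> = (\<Sum>l\<in>J. (fst (fst (\<alpha> j)) l - snd (fst (\<alpha> j)) l) * v l)"
        by (simp add: sum_subtractf left_diff_distrib)
      also have "\<dots> = (\<Sum>l\<in>J. d * (c j l * v l))"
        using \<open>d \<noteq> 0\<close> by (intro sum.cong) (auto simp: c_def d_def)
      also have "\<dots> = d * (\<Sum>l\<in>J. c j l * v l)" by (simp add: sum_distrib_left)
      also have "(\<Sum>l\<in>J. c j l * v l) = (\<Sum>l\<in>F. c j l * v l)"
        using finF JF by (intro sum.mono_neutral_left) (auto simp: c_def)
      finally show ?thesis using \<open>d \<noteq> 0\<close> by simp
    qed
    have "measure_pmf.prob (row_matrix n \<xi>) {r. (\<alpha>, r) \<in> {z. (snd z, fst z) \<in> A}}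
        \<le> measure_pmf.prob (row_matrix n \<xi>)
      {r. \<exists>v\<in>V. (\<forall>j\<in>{..<n} - F. v j = (\<Sum>l\<in>F. c j l * v l)) \<and> (\<forall>i<n. dot n (r i) v = 0)}"
    proof (rule measure_pmf.finite_measure_mono)
      show "{r. (\<alpha>, r) \<in> {z. (snd z, fst z) \<in> A}}
        \<subseteq> {r. \<exists>v\<in>V. (\<forall>j\<in>{..<n} - F. v j = (\<Sum>l\<in>F. c j l * v l)) \<and> (\<forall>i<n. dot n (r i) v = 0)}"
      proof
        fix r assume "r \<in> {r. (\<alpha>, r) \<in> {z. (snd z, fst z) \<in> A}}"
        then obtain v where v: "v \<in> V" "\<forall>i<n. dot n (r i) v = 0" "\<forall>j\<in>{..<n} - F. \<alpha> j \<in> hit v j"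
          unfolding A_def by auto
        then have "\<forall>j\<in>{..<n} - F. v j = (\<Sum>l\<in>F. c j l * v l)" using lin by blast
        with v show "r \<in> {r. \<exists>v\<in>V. (\<forall>j\<in>{..<n} - F. v j = (\<Sum>l\<in>F. c j l * v l)) \<and> (\<forall>i<n. dot n (r i) v = 0)}"
          by blast
      qed
    qed simp
    also have "\<dots> \<le> (real n + 1) ^ card F * \<beta> ^ (n - card F)"
      by (rule prob_kernel_meets_subspace[OF JF(2) \<beta> conc])
    finally show "measure_pmf.prob (row_matrix n \<xi>) {r. (\<alpha>, r) \<in> {z. (snd z, fst z) \<in> A}}
        \<le> (real n + 1) ^ card F * \<beta> ^ (n - card F)" .
  qed
  finally show ?thesis .
qed

text \<open>A concentrated vector is described by few data \<open>(i, F, J, l)\<close>, where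
  \<open>l\<close> rounds the energy of \<open>J\<close> to a power of 999/1000. The gain 1/200
  outweighs three losses of 1/1000, from \<epsilon>, from \<open>p\<close> and from the rounding,
  and leaves a ratio of 499/500 per coordinate outside \<open>F\<close>. The choices of
  \<open>F\<close>, of \<open>J\<close> and of the rows in \<open>prob_kernel_meets_subspace\<close>
  contribute \<open>4 * D\<close> each to the exponent \<open>12 * D\<close>.\<close>

lemma prob_concentrated_kernel:
  fixes \<xi> :: "nat \<Rightarrow> nat \<Rightarrow> real pmf"
  assumes atom: "\<And>i j x. i < n \<Longrightarrow> j < n \<Longrightarrow> pmf (\<xi> i j) x \<le> p" and p: "p \<le> 1/1000"
    and \<delta>: "0 < \<delta>" "(999/1000) ^ Suc D < \<delta>\<^sup>2"
  shows "measure_pmf.prob (row_matrix n \<xi>)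
      {r. \<exists>v. (\<exists>j<n. v j \<noteq> 0) \<and> (\<exists>i<n. \<delta> \<le> max_atom (lsum (\<xi> i) {..<n} v)) \<and> (\<forall>i<n. dot n (r i) v = 0)}
    \<le> (1 + n * (D + 1)) * (n + 1) ^ (12 * D) * (499/500) ^ (n - 4 * D)"
proof (cases "n = 0")
  case True
  then show ?thesis by simp
next
  case False
  define q \<kappa> :: real where "q = 999/1000" and "\<kappa> = 499/500"
  have p0: "0 \<le> p" using atom[of 0 0 0] False pmf_nonneg[of "\<xi> 0 0" 0] by linarith
  define S where "S = {F. F \<subseteq> {..<n} \<and> card F \<le> 4 * D}"
  have finS: "finite S" and cardS: "card S \<le> (n + 1) ^ (4 * D)"
    unfolding S_def using card_small_subsets[of "{..<n}" "4 * D"] by auto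
  define B where "B = (real n + 1) ^ (4 * D) * \<kappa> ^ (n - 4 * D)"
  have B0: "0 \<le> B" by (simp add: B_def \<kappa>_def)
  have to_B: "(real n + 1) ^ card F * \<kappa> ^ (n - card F) \<le> B" if "F \<in> S" for F
  proof -
    have "(real n + 1) ^ card F \<le> (real n + 1) ^ (4 * D)"
      using that by (intro power_increasing) (auto simp: S_def)
    moreover have "\<kappa> ^ (n - card F) \<le> \<kappa> ^ (n - 4 * D)"
      using that by (intro power_decreasing) (auto simp: S_def \<kappa>_def)
    ultimately show ?thesis unfolding B_def by (rule mult_mono) (simp_all add: \<kappa>_def)
  qed
  define V0 where "V0 = {v :: nat \<Rightarrow> real. \<exists>j<n. v j \<noteq> 0}"
  \<comment> \<open>Vectors supported in a small \<open>F\<close> are beyond the scope of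
    \<open>concentrated_structure\<close>; their other coordinates are predicted with coefficients
    \<open>0\<close>.\<close>
  define Sp where "Sp F = {r. \<exists>v\<in>V0. (\<forall>j\<in>{..<n} - F. v j = (\<Sum>l\<in>F. 0 * v l)) \<and> (\<forall>i<n. dot n (r i) v = 0)}" for F
  define V where "V = (\<lambda>(i, F, J, l). {v. J \<subseteq> F
    \<and> (\<forall>j\<in>{..<n} - F. (1 - 1/1000) * energy (\<xi> i) J v \<le> energy (\<xi> i) (insert j J) v)
    \<and> q ^ Suc l \<le> energy (\<xi> i) J v \<and> (\<forall>i<n. pmf (lsum (\<xi> i) {..<n} v) 0 \<le> (1 - 1/200) * q ^ l)})"
  define De where "De x = {r. \<exists>v\<in>V x. \<forall>i<n. dot n (r i) v = 0}" for x
  define I where "I = {..<n} \<times> S \<times> S \<times> {..D}"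
  have Sp: "measure_pmf.prob (row_matrix n \<xi>) (Sp F) \<le> B" if F: "F \<in> S" for F
  proof -
    have "measure_pmf.prob (row_matrix n \<xi>) (Sp F) \<le> (real n + 1) ^ card F * p ^ (n - card F)"
      unfolding Sp_def
    proof (rule prob_kernel_meets_subspace)
      fix v i assume "v \<in> V0" "i < n"
      then obtain j where j: "j < n" "v j \<noteq> 0" by (auto simp: V0_def)
      then show "pmf (lsum (\<xi> i) {..<n} v) 0 \<le> p"
        using \<open>i < n\<close> by (intro pmf_lsum_le_atom[of _ j] atom) auto
    qed (use F p p0 in \<open>auto simp: S_def\<close>)
    also have "\<dots> \<le> (real n + 1) ^ card F * \<kappa> ^ (n - card F)"
      using p p0 by (intro mult_left_mono power_mono) (auto simp: \<kappa>_def)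
    also have "\<dots> \<le> B" by (rule to_B[OF F])
    finally show ?thesis .
  qed
  have De: "measure_pmf.prob (row_matrix n \<xi>) (De x) \<le> B" if x: "x \<in> I" for x
  proof -
    obtain i F J l where x_eq: "x = (i, F, J, l)" by (metis surj_pair)
    have i: "i < n" and F: "F \<in> S" using x by (auto simp: x_eq I_def)
    show ?thesis
    proof (cases "J \<subseteq> F")
      case False
      then have "De x = {}" by (auto simp: De_def V_def x_eq)
      then show ?thesis using B0 by simp
    next
      case True
      let ?m = "n - card F"
      let ?h = "(1 - 1/1000 - p) * q ^ Suc l"
      have q: "0 < q ^ l" "q ^ l \<le> 1" by (auto simp: q_def power_le_one)
      have "998/1000 * (999/1000 * q ^ l) \<le> ?h"
        using p q unfolding power_Suc q_def by (intro mult_mono) auto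
      moreover have "0 < H \<and> (1 - 1/200) * x \<le> \<kappa> * H" if "998/1000 * (999/1000 * x) \<le> H" "0 < x" for H x :: real
        using that by (simp add: \<kappa>_def)
      ultimately have h0: "0 < ?h" and \<beta>: "(1 - 1/200) * q ^ l \<le> \<kappa> * ?h" using q by blast+
      have "measure_pmf.prob (row_matrix n \<xi>) (De x) * ?h ^ ?m \<le> (real n + 1) ^ card F * ((1 - 1/200) * q ^ l) ^ ?m"
        unfolding De_def
      proof (rule prob_structured_kernel[where \<eta> = "\<xi> i" and J = J])
        show "J \<subseteq> F" "F \<subseteq> {..<n}" using True F by (auto simp: S_def)
      qed (use i p q atom in \<open>auto simp: V_def x_eq q_def mult_le_one\<close>)
      also have "\<dots> \<le> (real n + 1) ^ card F * (\<kappa> * ?h) ^ ?m"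
        using \<beta> q by (intro mult_left_mono power_mono) auto
      also have "\<dots> = ((real n + 1) ^ card F * \<kappa> ^ ?m) * ?h ^ ?m"
        by (simp only: power_mult_distrib mult.assoc)
      finally have "measure_pmf.prob (row_matrix n \<xi>) (De x) \<le> (real n + 1) ^ card F * \<kappa> ^ ?m"
        using h0 by (simp only: mult_le_cancel_right_pos zero_less_power)
      also have "\<dots> \<le> B" by (rule to_B[OF F])
      finally show ?thesis .
    qed
  qed
  let ?E = "{r. \<exists>v. (\<exists>j<n. v j \<noteq> 0) \<and> (\<exists>i<n. \<delta> \<le> max_atom (lsum (\<xi> i) {..<n} v)) \<and> (\<forall>i<n. dot n (r i) v = 0)}"
  have sub: "?E \<subseteq> (\<Union>F\<in>S. Sp F) \<union> (\<Union>x\<in>I. De x)"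
  proof
    fix r assume "r \<in> ?E"
    then obtain v i1 where v: "\<exists>j<n. v j \<noteq> 0" "i1 < n" "\<delta> \<le> max_atom (lsum (\<xi> i1) {..<n} v)"
      "\<forall>i<n. dot n (r i) v = 0" by blast
    let ?supp = "{j. j < n \<and> v j \<noteq> 0}"
    show "r \<in> (\<Union>F\<in>S. Sp F) \<union> (\<Union>x\<in>I. De x)"
    proof (cases "card ?supp \<le> 4 * D")
      case True
      then have "?supp \<in> S" by (auto simp: S_def)
      moreover have "r \<in> Sp ?supp" unfolding Sp_def V0_def using v by (auto intro!: bexI[of _ v])
      ultimately show ?thesis by blast
    next
      case False
      let ?a = "\<lambda>i. max_atom (lsum (\<xi> i) {..<n} v)"
      \<comment> \<open>The structure is extracted from the row law with the largest atom, so that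
        the resulting bound holds for every row.\<close>
      have "Max (?a ` {..<n}) \<in> ?a ` {..<n}" using \<open>n \<noteq> 0\<close> by (intro Max_in) auto
      then obtain i where i: "i < n" "?a i = Max (?a ` {..<n})" by auto
      have i_max: "?a k \<le> ?a i" if "k < n" for k using that i by simp
      have \<delta>_le: "\<delta> \<le> ?a i" using v i_max by (meson order_trans)
      have low: "(1 - 1/1000) ^ Suc D < (?a i)\<^sup>2"
      proof -
        have "\<delta>\<^sup>2 \<le> (?a i)\<^sup>2" using \<delta>_le \<delta> by (intro power_mono) auto
        then show ?thesis using \<delta> by simp
      qed
      obtain J F where JF: "J \<subseteq> F" "F \<subseteq> {..<n}" "card F \<le> 4 * D"
        and stuck: "\<And>j. j \<in> {..<n} - F \<Longrightarrow> (1 - 1/1000) * energy (\<xi> i) J v \<le> energy (\<xi> i) (insert j J) v"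
        and conc: "?a i \<le> (1 - 1/200) * energy (\<xi> i) J v"
      proof (rule concentrated_structure[of n "\<xi> i" p "1/1000" D v])
        show "4 * D < card ?supp" using False by simp
      qed (use i atom p low in auto)
      let ?e = "energy (\<xi> i) J v"
      have e: "?a i \<le> ?e" 
      proof -
        have "(1 - 1/200) * ?e \<le> 1 * ?e" by (intro mult_right_mono energy_nonneg) simp
        with conc show ?thesis by simp
      qed
      have "(?a i)\<^sup>2 \<le> ?a i"
        using max_atom_nonneg max_atom_le[of _ 1] by (simp add: power2_eq_square mult_left_le pmf_le_1)
      then have ex: "q ^ Suc D \<le> ?e" using low e by (simp add: q_def)
      define l where "l = (LEAST l. q ^ Suc l \<le> ?e)"
      have l1: "q ^ Suc l \<le> ?e" unfolding l_def using ex by (rule LeastI)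
      have l2: "l \<le> D" unfolding l_def using ex by (rule Least_le)
      have l3: "?e \<le> q ^ l"
      proof (cases l)
        case 0
        then show ?thesis by (simp add: energy_le_1)
      next
        case (Suc l')
        then have "\<not> q ^ Suc l' \<le> ?e" using not_less_Least[of l' "\<lambda>l. q ^ Suc l \<le> ?e"] by (simp add: l_def)
        then show ?thesis using Suc by simp
      qed
      have "pmf (lsum (\<xi> k) {..<n} v) 0 \<le> (1 - 1/200) * q ^ l" if "k < n" for k
      proof -
        have "pmf (lsum (\<xi> k) {..<n} v) 0 \<le> (1 - 1/200) * ?e"
          using pmf_le_max_atom[of "lsum (\<xi> k) {..<n} v" 0] i_max[OF that] conc by (meson order_trans)
        also have "\<dots> \<le> (1 - 1/200) * q ^ l" using l3 by (intro mult_left_mono) auto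
        finally show ?thesis .
      qed
      then have "v \<in> V (i, F, J, l)"
        using JF stuck l1 by (simp add: V_def)
      then have "r \<in> De (i, F, J, l)" using v unfolding De_def by blast
      moreover have "(i, F, J, l) \<in> I"
      proof -
        have "finite F" by (rule finite_subset[OF JF(2)]) simp
        then have "card J \<le> 4 * D" using JF card_mono[of F J] by linarith
        then show ?thesis using JF i l2 by (auto simp: I_def S_def)
      qed
      ultimately show ?thesis by blast
    qed
  qed
  have finI: "finite I" by (simp add: I_def finS)
  have "measure_pmf.prob (row_matrix n \<xi>) ?E
      \<le> measure_pmf.prob (row_matrix n \<xi>) ((\<Union>F\<in>S. Sp F) \<union> (\<Union>x\<in>I. De x))"
    by (rule measure_pmf.finite_measure_mono[OF sub]) simp
  also have "\<dots> \<le> measure_pmf.prob (row_matrix n \<xi>) (\<Union>F\<in>S. Sp F) + measure_pmf.prob (row_matrix n \<xi>) (\<Union>x\<in>I. De x)"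
    by (rule measure_Un_le) auto
  also have "\<dots> \<le> (\<Sum>F\<in>S. measure_pmf.prob (row_matrix n \<xi>) (Sp F)) + (\<Sum>x\<in>I. measure_pmf.prob (row_matrix n \<xi>) (De x))"
    by (intro add_mono measure_UNION_le finS finI) auto
  also have "\<dots> \<le> (\<Sum>F\<in>S. B) + (\<Sum>x\<in>I. B)"
    by (intro add_mono sum_mono Sp De)
  also have "\<dots> = (card S + card I) * B" by (simp add: ring_distribs)
  also have "\<dots> \<le> real ((1 + n * (D + 1)) * (n + 1) ^ (8 * D)) * B"
  proof (intro mult_right_mono of_nat_mono)
    let ?N = "(n + 1) ^ (4 * D)"
    have "card I = n * (card S * (card S * (D + 1)))" by (simp add: I_def card_cartesian_product)
    also have "\<dots> \<le> n * (?N * (?N * (D + 1)))" using cardS by (intro mult_le_mono order_refl)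
    finally have 1: "card I \<le> n * (?N * (?N * (D + 1)))" .
    have 2: "card S \<le> ?N * ?N" using cardS by (rule order_trans) simp
    have "?N * ?N = (n + 1) ^ (8 * D)" by (simp flip: power_add)
    moreover have "card S + card I \<le> (1 + n * (D + 1)) * (?N * ?N)"
      using 1 2 by (simp add: algebra_simps)
    ultimately show "card S + card I \<le> (1 + n * (D + 1)) * (n + 1) ^ (8 * D)" by simp
  qed (rule B0)
  also have "real ((1 + n * (D + 1)) * (n + 1) ^ (8 * D)) = (1 + real n * (real D + 1)) * (real n + 1) ^ (8 * D)"
    by (simp only: of_nat_mult of_nat_add of_nat_1 of_nat_power)
  also have "\<dots> * B = (1 + real n * (real D + 1)) * ((real n + 1) ^ (8 * D) * (real n + 1) ^ (4 * D)) * \<kappa> ^ (n - 4 * D)"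
    by (simp only: B_def mult.assoc)
  also have "(real n + 1) ^ (8 * D) * (real n + 1) ^ (4 * D) = (real n + 1) ^ (12 * D)"
    by (simp flip: power_add)
  finally show ?thesis by (simp only: \<kappa>_def)
qed

section \<open>Normal vectors\<close>

lemma Pi_pmf_Times:
  assumes "finite A" "finite B"
  shows "Pi_pmf (A \<times> B) d (\<lambda>(i, j). p i j)
    = map_pmf (\<lambda>r (i, j). r i j) (Pi_pmf A (\<lambda>_. d) (\<lambda>i. Pi_pmf B d (p i)))"
proof (rule pmf_eqI)
  fix x :: "'a \<times> 'b \<Rightarrow> 'c"
  let ?u = "\<lambda>r :: 'a \<Rightarrow> 'b \<Rightarrow> 'c. \<lambda>(i, j). r i j"
  let ?r = "\<lambda>i j. x (i, j)"
  have "inj ?u" by (auto simp: inj_def fun_eq_iff)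
  have "?u ?r = x" by auto
  have "pmf (map_pmf ?u (Pi_pmf A (\<lambda>_. d) (\<lambda>i. Pi_pmf B d (p i)))) x
      = pmf (Pi_pmf A (\<lambda>_. d) (\<lambda>i. Pi_pmf B d (p i))) ?r"
    using pmf_map_inj'[OF \<open>inj ?u\<close>, of _ ?r] \<open>?u ?r = x\<close> by simp
  also have "\<dots> = pmf (Pi_pmf (A \<times> B) d (\<lambda>(i, j). p i j)) x"
  proof (cases "\<forall>z. z \<notin> A \<times> B \<longrightarrow> x z = d")
    case True
    have "pmf (Pi_pmf A (\<lambda>_. d) (\<lambda>i. Pi_pmf B d (p i))) ?r = (\<Prod>i\<in>A. pmf (Pi_pmf B d (p i)) (?r i))"
      using True assms by (intro pmf_Pi') (auto simp: fun_eq_iff)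
    also have "\<dots> = (\<Prod>i\<in>A. \<Prod>j\<in>B. pmf (p i j) (x (i, j)))"
      using True assms by (intro prod.cong refl pmf_Pi') auto
    also have "\<dots> = (\<Prod>z\<in>A \<times> B. pmf (case z of (i, j) \<Rightarrow> p i j) (x z))"
      by (subst prod.cartesian_product) (simp add: case_prod_unfold)
    also have "\<dots> = pmf (Pi_pmf (A \<times> B) d (\<lambda>(i, j). p i j)) x"
      using True assms by (intro pmf_Pi'[symmetric]) auto
    finally show ?thesis .
  next
    case False
    then obtain i j where ij: "(i, j) \<notin> A \<times> B" "x (i, j) \<noteq> d" by auto
    have "pmf (Pi_pmf (A \<times> B) d (\<lambda>(i, j). p i j)) x = 0"
      using ij assms by (intro pmf_Pi_outside) blast+
    moreover have "pmf (Pi_pmf A (\<lambda>_. d) (\<lambda>i. Pi_pmf B d (p i))) ?r = 0"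
    proof (cases "i \<in> A")
      case True
      then have "pmf (Pi_pmf B d (p i)) (?r i) = 0"
        using ij assms by (intro pmf_Pi_outside) auto
      then have "(\<Prod>i\<in>A. pmf (Pi_pmf B d (p i)) (?r i)) = 0"
        using True assms by (intro prod_zero) auto
      then show ?thesis by (subst pmf_Pi[OF assms(1)]) simp
    next
      case False
      then show ?thesis using ij assms by (intro pmf_Pi_outside) (auto simp: fun_eq_iff)
    qed
    ultimately show ?thesis by simp
  qed
  finally show "pmf (Pi_pmf (A \<times> B) d (\<lambda>(i, j). p i j)) x
      = pmf (map_pmf ?u (Pi_pmf A (\<lambda>_. d) (\<lambda>i. Pi_pmf B d (p i)))) x" ..
qed

lemma prob_single_coordinate:
  assumes S: "finite S" "s \<in> S" and atom: "\<And>t. pmf (q s) t \<le> b"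
    and single: "\<And>f. \<exists>c. \<forall>t. f(s := t) \<in> E \<longrightarrow> t = c"
  shows "measure_pmf.prob (Pi_pmf S d q) E \<le> b"
proof -
  have "Pi_pmf S d q = map_pmf (\<lambda>(y, f). f(s := y)) (pair_pmf (q s) (Pi_pmf (S - {s}) d q))"
    using Pi_pmf_insert[of "S - {s}" s d q] S by (simp add: insert_absorb)
  then have "measure_pmf.prob (Pi_pmf S d q) E
      = measure_pmf.prob (pair_pmf (q s) (Pi_pmf (S - {s}) d q)) {z. (snd z)(s := fst z) \<in> E}"
    by (simp add: vimage_def case_prod_unfold)
  also have "\<dots> = measure_pmf.prob (pair_pmf (Pi_pmf (S - {s}) d q) (q s)) {z. (fst z)(s := snd z) \<in> E}"
    by (subst prob_pair_swap) simp
  also have "\<dots> \<le> b"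
  proof (rule prob_pair_le)
    fix f
    obtain c where "\<forall>t. f(s := t) \<in> E \<longrightarrow> t = c" using single by blast
    then have "measure_pmf.prob (q s) {t. (f, t) \<in> {z. (fst z)(s := snd z) \<in> E}} \<le> measure_pmf.prob (q s) {c}"
      by (intro measure_pmf.finite_measure_mono) auto
    then show "measure_pmf.prob (q s) {t. (f, t) \<in> {z. (fst z)(s := snd z) \<in> E}} \<le> b"
      using atom[of c] by (simp add: measure_pmf_single)
  qed
  finally show ?thesis .
qed

section \<open>Leading minors and the normal to the previous rows\<close>

definition minor :: "nat \<Rightarrow> (nat \<times> nat \<Rightarrow> real) \<Rightarrow> real" where
  "minor k x = det (mat k k x)"

lemma minor_cong: "(\<And>i j. i < k \<Longrightarrow> j < k \<Longrightarrow> x (i, j) = y (i, j)) \<Longrightarrow> minor k x = minor k y"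
  unfolding minor_def by (rule arg_cong[where f = det]) (auto intro!: cong_mat)

lemma minor_0_iff:
  "minor k x = 0 \<longleftrightarrow> (\<exists>v. (\<exists>j<k. v j \<noteq> 0) \<and> (\<forall>i<k. (\<Sum>j<k. x (i, j) * v j) = 0))"
proof -
  have row: "(mat k k x *\<^sub>v vec k v) $ i = (\<Sum>j<k. x (i, j) * v j)" if "i < k" for i v
    using that by (auto simp: scalar_prod_def lessThan_atLeast0 intro!: sum.cong)
  show ?thesis
    unfolding minor_def det_0_iff_vec_prod_zero_field[OF mat_carrier]
  proof
    assume "\<exists>w. w \<in> carrier_vec k \<and> w \<noteq> 0\<^sub>v k \<and> mat k k x *\<^sub>v w = 0\<^sub>v k"
    then obtain w where w: "w \<in> carrier_vec k" "w \<noteq> 0\<^sub>v k" "mat k k x *\<^sub>v w = 0\<^sub>v k" by blast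
    have eq: "vec k (\<lambda>j. w $ j) = w" using w by auto
    have "\<exists>j<k. w $ j \<noteq> 0"
    proof (rule ccontr)
      assume "\<not> ?thesis"
      then have "w = 0\<^sub>v k" using w(1) by (intro eq_vecI) auto
      with w show False by simp
    qed
    moreover have "(\<Sum>j<k. x (i, j) * w $ j) = 0" if "i < k" for i
      using row[OF that, of "\<lambda>j. w $ j"] w(3) that by (simp add: eq)
    ultimately show "\<exists>v. (\<exists>j<k. v j \<noteq> 0) \<and> (\<forall>i<k. (\<Sum>j<k. x (i, j) * v j) = 0)"
      by (intro exI[of _ "\<lambda>j. w $ j"]) simp
  next
    assume "\<exists>v. (\<exists>j<k. v j \<noteq> 0) \<and> (\<forall>i<k. (\<Sum>j<k. x (i, j) * v j) = 0)"
    then obtain v j where v: "j < k" "v j \<noteq> 0" "\<forall>i<k. (\<Sum>j<k. x (i, j) * v j) = 0" by blast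
    have "vec k v \<noteq> 0\<^sub>v k" using v by (metis index_vec index_zero_vec(1))
    moreover have "mat k k x *\<^sub>v vec k v = 0\<^sub>v k"
    proof (rule eq_vecI)
      fix i assume "i < dim_vec (0\<^sub>v k :: real vec)"
      then show "(mat k k x *\<^sub>v vec k v) $ i = 0\<^sub>v k $ i" using row[of i v] v by simp
    qed simp
    ultimately show "\<exists>w. w \<in> carrier_vec k \<and> w \<noteq> 0\<^sub>v k \<and> mat k k x *\<^sub>v w = 0\<^sub>v k"
      by (intro exI[of _ "vec k v"]) simp
  qed
qed

lemma minor_inverse:
  assumes "minor k x \<noteq> 0"
  shows "\<exists>c. (\<forall>i<k. \<forall>j<k. (\<Sum>l<k. x (i, l) * c l j) = of_bool (i = j))
    \<and> (\<forall>i<k. \<forall>j<k. (\<Sum>l<k. c i l * x (l, j)) = of_bool (i = j))"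
proof (intro exI conjI allI impI)
  let ?A = "mat k k x" and ?d = "minor k x"
  define c where "c i j = adj_mat ?A $$ (i, j) / ?d" for i j
  have "?A \<in> carrier_mat k k" by simp
  note adj = adj_mat[OF this, folded minor_def]
  fix i j assume ij: "i < k" "j < k"
  have "(\<Sum>l<k. x (i, l) * c l j) = (\<Sum>l<k. x (i, l) * adj_mat ?A $$ (l, j)) / ?d"
    by (simp add: c_def sum_divide_distrib)
  also have "(\<Sum>l<k. x (i, l) * adj_mat ?A $$ (l, j)) = (?A * adj_mat ?A) $$ (i, j)"
    using ij adj(1) by (auto simp: scalar_prod_def lessThan_atLeast0 intro!: sum.cong)
  finally show "(\<Sum>l<k. x (i, l) * c l j) = of_bool (i = j)"
    using ij assms by (simp add: adj(2))
  have "(\<Sum>l<k. c i l * x (l, j)) = (\<Sum>l<k. adj_mat ?A $$ (i, l) * x (l, j)) / ?d"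
    by (simp add: c_def sum_divide_distrib)
  also have "(\<Sum>l<k. adj_mat ?A $$ (i, l) * x (l, j)) = (adj_mat ?A * ?A) $$ (i, j)"
    using ij adj(1) by (auto simp: scalar_prod_def lessThan_atLeast0 intro!: sum.cong)
  finally show "(\<Sum>l<k. c i l * x (l, j)) = of_bool (i = j)"
    using ij assms by (simp add: adj(3))
qed

text \<open>When the leading minor of size \<open>m\<close> is non-zero, the normalisation
  \<open>v m = 1\<close> is possible and determines the coordinates up to \<open>m\<close>. It also
  supplies a coordinate that is known to be non-zero.\<close>

definition normal_vectors :: "nat \<Rightarrow> (nat \<times> nat \<Rightarrow> real) \<Rightarrow> (nat \<Rightarrow> real) set" where
  "normal_vectors m x = {v. v m = 1 \<and> (\<forall>i<m. (\<Sum>j<Suc m. x (i, j) * v j) = 0)}"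

text \<open>As a choice it depends on \<open>x\<close> only through the set
  \<open>normal_vectors m x\<close>, hence only on the first \<open>m\<close> rows
  (\<open>normal_vectors_cong\<close>).\<close>

definition normal :: "nat \<Rightarrow> (nat \<times> nat \<Rightarrow> real) \<Rightarrow> nat \<Rightarrow> real" where
  "normal m x = (SOME v. v \<in> normal_vectors m x)"

lemma normal_vectors_cong:
  assumes "\<And>i j. i < m \<Longrightarrow> j \<le> m \<Longrightarrow> x (i, j) = y (i, j)"
  shows "normal_vectors m x = normal_vectors m y"
proof -
  have "(\<Sum>j<Suc m. x (i, j) * v j) = (\<Sum>j<Suc m. y (i, j) * v j)" if "i < m" for i v
    using assms that by (intro sum.cong) auto
  then show ?thesis by (auto simp: normal_vectors_def)
qed

lemma normal_in_normal_vectors: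
  assumes "minor m x \<noteq> 0"
  shows "normal m x \<in> normal_vectors m x"
proof -
  obtain c where c: "\<forall>i<m. \<forall>j<m. (\<Sum>l<m. x (i, l) * c l j) = of_bool (i = j)"
    using minor_inverse[OF assms] by blast
  define v where "v l = (if l < m then - (\<Sum>j<m. c l j * x (j, m)) else 1)" for l
  have "(\<Sum>l<Suc m. x (i, l) * v l) = 0" if "i < m" for i
  proof -
    have "(\<Sum>l<m. x (i, l) * v l) = (\<Sum>l<m. - (\<Sum>j<m. x (i, l) * c l j * x (j, m)))"
      by (intro sum.cong) (auto simp: v_def sum_distrib_left mult.assoc)
    also have "\<dots> = - (\<Sum>l<m. \<Sum>j<m. x (i, l) * c l j * x (j, m))"
      by (rule sum_negf)
    also have "(\<Sum>l<m. \<Sum>j<m. x (i, l) * c l j * x (j, m)) = (\<Sum>j<m. (\<Sum>l<m. x (i, l) * c l j) * x (j, m))"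
      by (subst sum.swap) (simp add: sum_distrib_right)
    also have "\<dots> = (\<Sum>j<m. of_bool (i = j) * x (j, m))"
      using c that by (intro sum.cong) auto
    also have "\<dots> = x (i, m)" 
    proof -
      have "(\<Sum>j<m. of_bool (i = j) * x (j, m)) = (\<Sum>j<m. if i = j then x (j, m) else 0)"
        by (intro sum.cong) auto
      then show ?thesis using that by simp
    qed
    finally show ?thesis by (simp add: v_def)
  qed
  then have "v \<in> normal_vectors m x" by (auto simp: normal_vectors_def v_def)
  then show ?thesis unfolding normal_def by (rule someI[of "\<lambda>v. v \<in> normal_vectors m x"])
qed

lemma normal_unique:
  assumes "minor m x \<noteq> 0" "v \<in> normal_vectors m x" "w \<in> normal_vectors m x" "j \<le> m"
  shows "v j = w j"
proof (rule ccontr)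
  assume "v j \<noteq> w j"
  then have "j < m" using assms by (cases "j = m") (auto simp: normal_vectors_def)
  have row: "(\<Sum>l<m. x (i, l) * z l) = - x (i, m)" if "z \<in> normal_vectors m x" "i < m" for z i
    using that by (auto simp: normal_vectors_def eq_neg_iff_add_eq_0)
  have "(\<Sum>l<m. x (i, l) * (v l - w l)) = 0" if "i < m" for i
    using row[OF assms(2) that] row[OF assms(3) that] by (simp add: right_diff_distrib sum_subtractf)
  then have "minor m x = 0"
    unfolding minor_0_iff using \<open>j < m\<close> \<open>v j \<noteq> w j\<close> by (intro exI[of _ "\<lambda>l. v l - w l"]) auto
  with assms show False by simp
qed

text \<open>A kernel vector of the larger block has \<open>v m \<noteq> 0\<close>, for otherwise the
  smaller block would be singular too. After scaling it is the normal, and its last equation is the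
  claim.\<close>

lemma singular_step:
  assumes "minor m x \<noteq> 0" "minor (Suc m) x = 0"
  shows "(\<Sum>j<Suc m. x (m, j) * normal m x j) = 0"
proof -
  obtain v j where v: "j < Suc m" "v j \<noteq> 0" "\<forall>i<Suc m. (\<Sum>j<Suc m. x (i, j) * v j) = 0"
    using assms(2) unfolding minor_0_iff by blast
  have "v m \<noteq> 0"
  proof
    assume "v m = 0"
    then have "j < m" using v by (cases "j = m") auto
    moreover have "\<forall>i<m. (\<Sum>j<m. x (i, j) * v j) = 0" using v \<open>v m = 0\<close> by auto
    ultimately have "minor m x = 0" unfolding minor_0_iff using v by blast
    with assms show False by simp
  qed
  define w where "w j = v j / v m" for j
  have w: "(\<Sum>j<Suc m. x (i, j) * w j) = 0" if "i < Suc m" for i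
  proof -
    have "(\<Sum>j<Suc m. x (i, j) * w j) = (\<Sum>j<Suc m. x (i, j) * v j) / v m"
      by (simp only: w_def times_divide_eq_right sum_divide_distrib)
    then show ?thesis using v that by simp
  qed
  then have "w \<in> normal_vectors m x" using \<open>v m \<noteq> 0\<close> by (simp add: normal_vectors_def w_def)
  then have "normal m x j = w j" if "j \<le> m" for j
    using normal_unique[OF assms(1) normal_in_normal_vectors[OF assms(1)]] that by blast
  then have "(\<Sum>j<Suc m. x (m, j) * normal m x j) = (\<Sum>j<Suc m. x (m, j) * w j)"
    by (intro sum.cong) auto
  then show ?thesis using w by simp
qed

text \<open>With \<open>q A = u\<close> for the invertible block \<open>A\<close> one has \<open>u \<cdot> normal = - q \<cdot> y\<close>, where \<open>y\<close> is the last
  column, which is independent of \<open>A\<close>.\<close>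

lemma prob_normal_on_hyperplane:
  fixes \<xi> :: "nat \<Rightarrow> nat \<Rightarrow> real pmf"
  assumes atom: "\<And>i x. i < m \<Longrightarrow> pmf (\<xi> i m) x \<le> p" and "0 \<le> p"
    and u: "j0 < m" "u j0 \<noteq> 0"
  shows "measure_pmf.prob (Pi_pmf ({..<m} \<times> {..<Suc m}) 0 (\<lambda>(i, j). \<xi> i j))
      {x. minor m x \<noteq> 0 \<and> (\<Sum>j<m. u j * normal m x j) = 0} \<le> p"
proof -
  let ?B = "{..<m} \<times> {..<m}" and ?C = "{..<m} \<times> {m}"
  let ?h = "\<lambda>(f, g) x. if x \<in> ?B then f x else g x"
  let ?E = "{x. minor m x \<noteq> 0 \<and> (\<Sum>j<m. u j * normal m x j) = 0}"
  have S: "{..<m} \<times> {..<Suc m} = ?B \<union> ?C" by auto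
  have "measure_pmf.prob (Pi_pmf ({..<m} \<times> {..<Suc m}) 0 (\<lambda>(i, j). \<xi> i j)) ?E
      = measure_pmf.prob (pair_pmf (Pi_pmf ?B 0 (\<lambda>(i, j). \<xi> i j)) (Pi_pmf ?C 0 (\<lambda>(i, j). \<xi> i j))) (?h -` ?E)"
    unfolding S by (subst Pi_pmf_union) auto
  also have "\<dots> \<le> p"
  proof (rule prob_pair_le)
    fix f :: "nat \<times> nat \<Rightarrow> real"
    show "measure_pmf.prob (Pi_pmf ?C 0 (\<lambda>(i, j). \<xi> i j)) {g. (f, g) \<in> ?h -` ?E} \<le> p"
    proof (cases "minor m f = 0")
      case True
      have "minor m (?h (f, g)) = minor m f" for g by (rule minor_cong) simp
      then have "{g. (f, g) \<in> ?h -` ?E} = {}" using True by auto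
      then show ?thesis using \<open>0 \<le> p\<close> by (simp only: measure_empty)
    next
      case False
      obtain c where c: "\<forall>i<m. \<forall>j<m. (\<Sum>l<m. c i l * f (l, j)) = of_bool (i = j)"
        using minor_inverse[OF False] by blast
      define q where "q i = (\<Sum>l<m. u l * c l i)" for i
      have q: "(\<Sum>i<m. q i * f (i, j)) = u j" if "j < m" for j
      proof -
        have "(\<Sum>i<m. q i * f (i, j)) = (\<Sum>i<m. \<Sum>l<m. u l * (c l i * f (i, j)))"
          by (simp add: q_def sum_distrib_right mult.assoc)
        also have "\<dots> = (\<Sum>l<m. u l * (\<Sum>i<m. c l i * f (i, j)))"
          by (subst sum.swap) (simp add: sum_distrib_left)
        also have "\<dots> = (\<Sum>l<m. u l * of_bool (l = j))" using c that by (intro sum.cong) auto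
        also have "\<dots> = u j" 
        proof -
          have "(\<Sum>l<m. u l * of_bool (l = j)) = (\<Sum>l<m. if l = j then u l else 0)"
            by (intro sum.cong) auto
          then show ?thesis using that by simp
        qed
        finally show ?thesis .
      qed
      have "\<exists>i<m. q i \<noteq> 0"
      proof (rule ccontr)
        assume "\<not> ?thesis"
        then have "(\<Sum>i<m. q i * f (i, j0)) = 0" by simp
        then show False using q[OF u(1)] u(2) by simp
      qed
      then obtain i0 where i0: "i0 < m" "q i0 \<noteq> 0" by blast
      have eq: "(\<Sum>i<m. q i * g (i, m)) = 0" if "?h (f, g) \<in> ?E" for g
      proof -
        let ?x = "?h (f, g)"
        have "minor m ?x \<noteq> 0" using that by simp
        then have N: "normal m ?x m = 1" "\<And>i. i < m \<Longrightarrow> (\<Sum>j<Suc m. ?x (i, j) * normal m ?x j) = 0"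
          using normal_in_normal_vectors[of m ?x] by (auto simp: normal_vectors_def)
        have row: "(\<Sum>j<m. f (i, j) * normal m ?x j) = - g (i, m)" if "i < m" for i
          using N(2)[OF that] N(1) that by simp
        have "- (\<Sum>i<m. q i * g (i, m)) = (\<Sum>i<m. q i * (\<Sum>j<m. f (i, j) * normal m ?x j))"
          unfolding sum_negf[symmetric] using row by (intro sum.cong) auto
        also have "\<dots> = (\<Sum>i<m. \<Sum>j<m. q i * f (i, j) * normal m ?x j)"
          by (simp add: sum_distrib_left mult.assoc)
        also have "\<dots> = (\<Sum>j<m. (\<Sum>i<m. q i * f (i, j)) * normal m ?x j)"
          by (subst sum.swap) (simp add: sum_distrib_right)
        also have "\<dots> = (\<Sum>j<m. u j * normal m ?x j)" using q by (intro sum.cong) auto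
        finally show ?thesis using that by simp
      qed
      show ?thesis
      proof (rule prob_single_coordinate[where s = "(i0, m)"])
        fix g
        let ?r = "\<Sum>i\<in>{..<m} - {i0}. q i * g (i, m)"
        have "t = - ?r / q i0" if "g((i0, m) := t) \<in> {g. (f, g) \<in> ?h -` ?E}" for t
        proof -
          have "?h (f, g((i0, m) := t)) \<in> ?E" using that unfolding mem_Collect_eq vimage_eq .
          then have "(\<Sum>i<m. q i * (g((i0, m) := t)) (i, m)) = 0" by (rule eq)
          also have "(\<Sum>i<m. q i * (g((i0, m) := t)) (i, m)) = q i0 * t + ?r"
            using i0 by (subst sum.remove[of _ i0]) (auto intro!: sum.cong)
          finally show ?thesis using i0 by (simp add: field_simps)
        qed
        then show "\<exists>c. \<forall>t. g((i0, m) := t) \<in> {g. (f, g) \<in> ?h -` ?E} \<longrightarrow> t = c" by blast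
      qed (use i0 atom in auto)
    qed
  qed
  finally show ?thesis .
qed

lemma prob_last_row:
  "measure_pmf.prob (Pi_pmf ({m} \<times> {..<n}) 0 (\<lambda>(i, j). \<xi> i j)) {x. (\<Sum>j<n. x (m, j) * v j) = 0}
    = pmf (lsum (\<xi> m) {..<n} v) 0"
  by (subst Pi_pmf_Times) (simp_all add: Pi_pmf_singleton pmf.map_comp o_def vimage_def lsum_def pmf_map)

section \<open>The first vanishing leading minor\<close>

definition entry_law :: "nat \<Rightarrow> (nat \<Rightarrow> nat \<Rightarrow> real pmf) \<Rightarrow> (nat \<times> nat \<Rightarrow> real) pmf" where
  "entry_law k \<xi> = Pi_pmf ({..<k} \<times> {..<k}) 0 (\<lambda>(i, j). \<xi> i j)"

definition first_singular :: "nat \<Rightarrow> (nat \<times> nat \<Rightarrow> real) set" where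
  "first_singular m = {x. minor m x \<noteq> 0 \<and> minor (Suc m) x = 0}"

text \<open>The normal is a function of the first \<open>m\<close> rows, which are independent of
  the last one. The condition \<open>Q\<close> on it can therefore be paid for before the last row
  is drawn.\<close>

lemma prob_first_singular_where:
  fixes \<xi> :: "nat \<Rightarrow> nat \<Rightarrow> real pmf"
  assumes "0 \<le> b" and conc: "\<And>v. v m = 1 \<Longrightarrow> Q v \<Longrightarrow> pmf (lsum (\<xi> m) {..<Suc m} v) 0 \<le> b"
  shows "measure_pmf.prob (entry_law (Suc m) \<xi>) {x \<in> first_singular m. Q (normal m x)}
    \<le> measure_pmf.prob (Pi_pmf ({..<m} \<times> {..<Suc m}) 0 (\<lambda>(i, j). \<xi> i j))
        {x. minor m x \<noteq> 0 \<and> Q (normal m x)} * b"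
proof -
  let ?A = "{..<m} \<times> {..<Suc m}" and ?L = "{m} \<times> {..<Suc m}"
  let ?h = "\<lambda>(f, g) x. if x \<in> ?A then f x else g x"
  let ?E = "{x \<in> first_singular m. Q (normal m x)}"
  have S: "{..<Suc m} \<times> {..<Suc m} = ?A \<union> ?L" by auto
  have min: "minor m (?h (f, g)) = minor m f" for f g :: "nat \<times> nat \<Rightarrow> real"
    by (rule minor_cong) simp
  have nor: "normal m (?h (f, g)) = normal m f" for f g :: "nat \<times> nat \<Rightarrow> real"
  proof -
    have "normal_vectors m (?h (f, g)) = normal_vectors m f" by (rule normal_vectors_cong) simp
    then show ?thesis by (simp add: normal_def)
  qed
  have "measure_pmf.prob (entry_law (Suc m) \<xi>) ?E
      = measure_pmf.prob (pair_pmf (Pi_pmf ?A 0 (\<lambda>(i, j). \<xi> i j)) (Pi_pmf ?L 0 (\<lambda>(i, j). \<xi> i j))) (?h -` ?E)"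
    unfolding entry_law_def S by (subst Pi_pmf_union) auto
  also have "\<dots> \<le> measure_pmf.prob (Pi_pmf ?A 0 (\<lambda>(i, j). \<xi> i j)) {f. minor m f \<noteq> 0 \<and> Q (normal m f)} * b"
  proof (rule prob_pair_mult_le)
    fix f g :: "nat \<times> nat \<Rightarrow> real"
    assume "(f, g) \<in> ?h -` ?E"
    then have "minor m (?h (f, g)) \<noteq> 0" "Q (normal m (?h (f, g)))" by (auto simp: first_singular_def)
    then show "minor m f \<noteq> 0 \<and> Q (normal m f)" unfolding min nor by simp
  next
    fix f :: "nat \<times> nat \<Rightarrow> real"
    assume f: "minor m f \<noteq> 0 \<and> Q (normal m f)"
    have sub: "{g. (f, g) \<in> ?h -` ?E} \<subseteq> {x. (\<Sum>j<Suc m. x (m, j) * normal m f j) = 0}"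
    proof
      fix g assume "g \<in> {g. (f, g) \<in> ?h -` ?E}"
      then have "?h (f, g) \<in> first_singular m" by blast
      then have "(\<Sum>j<Suc m. ?h (f, g) (m, j) * normal m (?h (f, g)) j) = 0"
        unfolding first_singular_def by (intro singular_step) blast+
      then show "g \<in> {x. (\<Sum>j<Suc m. x (m, j) * normal m f j) = 0}" unfolding nor by simp
    qed
    have "measure_pmf.prob (Pi_pmf ?L 0 (\<lambda>(i, j). \<xi> i j)) {g. (f, g) \<in> ?h -` ?E}
        \<le> measure_pmf.prob (Pi_pmf ?L 0 (\<lambda>(i, j). \<xi> i j)) {x. (\<Sum>j<Suc m. x (m, j) * normal m f j) = 0}"
      by (rule measure_pmf.finite_measure_mono[OF sub]) simp
    also have "\<dots> = pmf (lsum (\<xi> m) {..<Suc m} (normal m f)) 0" by (rule prob_last_row)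
    also have "\<dots> \<le> b"
      using f normal_in_normal_vectors[of m f] by (intro conc) (auto simp: normal_vectors_def)
    finally show "measure_pmf.prob (Pi_pmf ?L 0 (\<lambda>(i, j). \<xi> i j)) {g. (f, g) \<in> ?h -` ?E} \<le> b" .
  qed
  finally show ?thesis .
qed

text \<open>With atoms \<open>z ^ 6\<close> each axis is cut into about \<open>1 / z ^ 3\<close>
  intervals of mass about \<open>z ^ 3\<close>. A slope of energy above \<open>z ^ 8\<close> then
  has collinear pairs of probability of order \<open>z ^ 11\<close> inside cells, out of a total of
  at most \<open>4 * z ^ 6\<close>.\<close>

lemma few_rich_slopes:
  fixes X Y :: "real pmf"
  assumes X: "\<And>x. pmf X x \<le> z ^ 6" and Y: "\<And>x. pmf Y x \<le> z ^ 6" and z: "0 < z" "z \<le> 1/10"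
  defines "T \<equiv> {t. t \<noteq> 0 \<and> z ^ 8 < coll (map_pmf (\<lambda>(x, y). t * x + y) (pair_pmf X Y))
                                    (map_pmf (\<lambda>(x, y). t * x + y) (pair_pmf X Y))}"
  shows "finite T" "card T \<le> 40 / z ^ 5"
proof -
  define s where "s = nat \<lceil>1 / z ^ 3\<rceil>"
  have s: "1 / z ^ 3 \<le> s" "s \<le> 1 / z ^ 3 + 1" using z by (simp_all add: s_def real_nat_ceiling_ge)
  have z3: "0 < z ^ 3" "z ^ 3 \<le> 1" using z by (auto simp: power_le_one)
  then have "1 \<le> 1 / z ^ 3" by simp
  with s have s1: "1 \<le> s" by linarith
  have inv_s: "1 / s \<le> z ^ 3"
  proof -
    have "1 \<le> z ^ 3 * s" using s(1) z3 by (simp add: field_simps)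
    then show ?thesis using s1 by (simp add: field_simps)
  qed
  \<comment> \<open>Finite subsets come first, since the finiteness of \<open>T\<close> is itself a
    consequence of this bound.\<close>
  have bound: "card T' \<le> 40 / z ^ 5" if T': "finite T'" "T' \<subseteq> T" for T'
  proof -
    have "card T' * (z ^ 8 / (2 * s + 1) - (z ^ 6)\<^sup>2) \<le> (1 / s + z ^ 6)\<^sup>2"
      using T' by (intro rich_slopes[OF X Y s1]) (auto simp: T_def less_imp_le)
    also have "\<dots> \<le> (2 * z ^ 3)\<^sup>2"
    proof (rule power_mono)
      have "z ^ 6 \<le> z ^ 3" using z by (intro power_decreasing) auto
      with inv_s show "1 / s + z ^ 6 \<le> 2 * z ^ 3" by simp
    qed (use z in simp)
    finally have 1: "card T' * (z ^ 8 / (2 * s + 1) - z ^ 12) \<le> 4 * z ^ 6"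
      by (simp add: power_mult_distrib flip: power_mult)
    have "z ^ 11 / 10 \<le> z ^ 8 / (2 * s + 1) - z ^ 12"
    proof -
      have "(2 * s + 1) * z ^ 3 \<le> (2 * (1 / z ^ 3 + 1) + 1) * z ^ 3"
        using s z3 by (intro mult_right_mono) auto
      also have "\<dots> = 2 + 3 * z ^ 3" using z by (simp add: field_simps)
      also have "\<dots> \<le> 5" using z3 by simp
      finally have "z ^ 8 * ((2 * s + 1) * z ^ 3) \<le> z ^ 8 * 5" using z by (intro mult_left_mono) auto
      then have "z ^ 11 * (2 * s + 1) \<le> 5 * z ^ 8" by (simp add: power_add[symmetric] mult_ac flip: power_add)
      then have "z ^ 11 / 5 \<le> z ^ 8 / (2 * s + 1)" by (simp add: field_simps)
      moreover have "z ^ 12 \<le> z ^ 11 / 10"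
      proof -
        have "z ^ 11 * z \<le> z ^ 11 * (1/10)" using z by (intro mult_left_mono) auto
        then show ?thesis by (simp flip: power_Suc2)
      qed
      ultimately show ?thesis by linarith
    qed
    then have "card T' * (z ^ 11 / 10) \<le> card T' * (z ^ 8 / (2 * s + 1) - z ^ 12)"
      by (intro mult_left_mono) auto
    also note 1
    finally have "card T' * z ^ 11 \<le> 40 * z ^ 6" by simp
    moreover have "z ^ 11 = z ^ 5 * z ^ 6" by (simp flip: power_add)
    ultimately have "card T' * (z ^ 5 * z ^ 6) \<le> 40 * z ^ 6" by (simp only:)
    then have "(card T' * z ^ 5) * z ^ 6 \<le> 40 * z ^ 6" by (simp only: mult.assoc)
    then have "card T' * z ^ 5 \<le> 40" using z by (simp only: mult_le_cancel_right_pos zero_less_power)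
    then show ?thesis using z by (simp add: field_simps)
  qed
  show fin: "finite T"
  proof (rule ccontr)
    assume "infinite T"
    obtain n :: nat where n: "40 / z ^ 5 < n" using reals_Archimedean2 by blast
    obtain T' where "T' \<subseteq> T" "finite T'" "card T' = n"
      using infinite_arbitrarily_large[OF \<open>infinite T\<close>] by blast
    with bound[of T'] n show False by simp
  qed
  show "card T \<le> 40 / z ^ 5" by (rule bound[OF fin subset_refl])
qed

text \<open>As \<open>m \<ge> 2\<close>, the coordinates \<open>0\<close>, \<open>1\<close> and
  \<open>m\<close> are distinct. For a generic ratio the block energies give
  \<open>sqrt (z ^ 8 * z ^ 6) = z ^ 7\<close>. There are order \<open>1 / z ^ 5\<close> bad ratios;
  each confines the normal to a hyperplane, with probability \<open>z ^ 6\<close>, and the last row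
  costs another \<open>z ^ 6\<close>. The threshold \<open>z ^ 8\<close> balances the two
  cases.\<close>

lemma prob_first_singular_small:
  fixes \<xi> :: "nat \<Rightarrow> nat \<Rightarrow> real pmf"
  assumes m: "2 \<le> m" and atom: "\<And>i j x. i \<le> m \<Longrightarrow> j \<le> m \<Longrightarrow> pmf (\<xi> i j) x \<le> z ^ 6"
    and z: "0 < z" "z \<le> 1/10"
  shows "measure_pmf.prob (entry_law (Suc m) \<xi>) (first_singular m) \<le> 43 * z ^ 7"
proof -
  let ?F = "Pi_pmf ({..<m} \<times> {..<Suc m}) 0 (\<lambda>(i, j). \<xi> i j)"
  let ?c = "\<lambda>t. coll (map_pmf (\<lambda>(x, y). t * x + y) (pair_pmf (\<xi> m 0) (\<xi> m 1)))
                    (map_pmf (\<lambda>(x, y). t * x + y) (pair_pmf (\<xi> m 0) (\<xi> m 1)))"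
  define T where "T = {t. t \<noteq> 0 \<and> z ^ 8 < ?c t}"
  have T: "finite T" "card T \<le> 40 / z ^ 5"
    using few_rich_slopes[of "\<xi> m 0" z "\<xi> m 1"] atom m z unfolding T_def by auto
  define Q where "Q v \<longleftrightarrow> v 0 = 0 \<or> v 1 = 0 \<or> v 0 / v 1 \<in> T" for v :: "nat \<Rightarrow> real"
  have generic: "pmf (lsum (\<xi> m) {..<Suc m} v) 0 \<le> z ^ 7" if v: "v m = 1" "\<not> Q v" for v
  proof -
    define t where "t = v 0 / v 1"
    have v01: "v 0 \<noteq> 0" "v 1 \<noteq> 0" and t: "t \<noteq> 0" "t \<notin> T" using v(2) by (auto simp: Q_def t_def)
    have "lsum (\<xi> m) {0, 1} v = conv (lsum (\<xi> m) {0} v) (lsum (\<xi> m) {1} v)"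
      using lsum_union[of "{0}" "{1}" "\<xi> m" v] by (simp add: insert_commute)
    note lsum_eq = this
    have eq: "fst w * v 0 + snd w * v 1 = (t * fst w + snd w) * v 1" for w :: "real \<times> real"
      using v01 by (simp add: t_def field_simps)
    have "conv (lsum (\<xi> m) {0} v) (lsum (\<xi> m) {1} v) = map_pmf (\<lambda>w. w * v 1) (map_pmf (\<lambda>(x, y). t * x + y) (pair_pmf (\<xi> m 0) (\<xi> m 1)))"
      unfolding lsum_singleton conv_def using eq
      by (simp add: map_pair[symmetric] pmf.map_comp o_def case_prod_unfold)
    with lsum_eq have "energy (\<xi> m) {0, 1} v = ?c t"
      using v01 by (simp add: energy_def coll_map_inj inj_def)
    then have "energy (\<xi> m) {0, 1} v \<le> z ^ 8" using t by (simp add: T_def)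
    moreover have "energy (\<xi> m) ({..<Suc m} - {0, 1}) v \<le> z ^ 6"
      using m v atom by (intro energy_le_atom[of _ m]) auto
    ultimately have "sqrt (energy (\<xi> m) {0, 1} v * energy (\<xi> m) ({..<Suc m} - {0, 1}) v) \<le> sqrt (z ^ 8 * z ^ 6)"
      using z by (intro real_sqrt_le_mono mult_mono energy_nonneg) auto
    also have "z ^ 8 * z ^ 6 = (z ^ 7)\<^sup>2" by (simp flip: power_add power_mult)
    also have "sqrt \<dots> = z ^ 7" using z by (subst real_sqrt_abs) simp
    finally show ?thesis
      using pmf_lsum_le_energy[of "{0, 1}" "{..<Suc m}" "\<xi> m" v 0] m by simp
  qed
  have special: "pmf (lsum (\<xi> m) {..<Suc m} v) 0 \<le> z ^ 6" if "v m = 1" for v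
    using that atom by (intro pmf_lsum_le_atom[of _ m]) auto
  have plane: "measure_pmf.prob ?F {x. minor m x \<noteq> 0 \<and> a * normal m x 0 + b * normal m x 1 = 0} \<le> z ^ 6"
    if "a \<noteq> 0 \<or> b \<noteq> 0" for a b
  proof -
    define u where "u j = (if j = 0 then a else if j = 1 then b else 0)" for j :: nat
    have sum: "(\<Sum>j<m. u j * v j) = a * v 0 + b * v 1" for v
    proof -
      have "(\<Sum>j<m. u j * v j) = (\<Sum>j\<in>{0, 1}. u j * v j)"
        using m by (intro sum.mono_neutral_right) (auto simp: u_def)
      then show ?thesis by (simp add: u_def)
    qed
    have "\<exists>j0<m. u j0 \<noteq> 0"
    proof (cases "a = 0")
      case True
      then show ?thesis using that m by (intro exI[of _ 1]) (auto simp: u_def)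
    next
      case False
      then show ?thesis using m by (intro exI[of _ 0]) (auto simp: u_def)
    qed
    then obtain j0 where "j0 < m" "u j0 \<noteq> 0" by blast
    then have "measure_pmf.prob ?F {x. minor m x \<noteq> 0 \<and> (\<Sum>j<m. u j * normal m x j) = 0} \<le> z ^ 6"
      using atom z by (intro prob_normal_on_hyperplane) auto
    then show ?thesis by (simp add: sum)
  qed
  define H where "H a b = {x. minor m x \<noteq> 0 \<and> a * normal m x 0 + b * normal m x 1 = 0}" for a b
  have "measure_pmf.prob ?F {x. minor m x \<noteq> 0 \<and> Q (normal m x)} \<le> measure_pmf.prob ?F (H 1 0 \<union> (H 0 1 \<union> (\<Union>t\<in>T. H 1 (- t))))"
  proof (rule measure_pmf.finite_measure_mono)
    show "{x. minor m x \<noteq> 0 \<and> Q (normal m x)} \<subseteq> H 1 0 \<union> (H 0 1 \<union> (\<Union>t\<in>T. H 1 (- t)))"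
    proof
      fix x assume "x \<in> {x. minor m x \<noteq> 0 \<and> Q (normal m x)}"
      then have x: "minor m x \<noteq> 0" "Q (normal m x)" by auto
      show "x \<in> H 1 0 \<union> (H 0 1 \<union> (\<Union>t\<in>T. H 1 (- t)))"
      proof (cases "normal m x 0 = 0 \<or> normal m x 1 = 0")
        case True
        then show ?thesis using x by (auto simp: H_def)
      next
        case False
        then have "normal m x 0 / normal m x 1 \<in> T" using x by (simp add: Q_def)
        moreover have "x \<in> H 1 (- (normal m x 0 / normal m x 1))" using x False by (simp add: H_def)
        ultimately show ?thesis by blast
      qed
    qed
  qed simp
  also have "\<dots> \<le> measure_pmf.prob ?F (H 1 0) + (measure_pmf.prob ?F (H 0 1) + (\<Sum>t\<in>T. measure_pmf.prob ?F (H 1 (- t))))"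
    by (intro order_trans[OF measure_Un_le] add_mono order_refl measure_UNION_le T) auto
  also have "\<dots> \<le> z ^ 6 + (z ^ 6 + (\<Sum>t\<in>T. z ^ 6))"
    unfolding H_def by (intro add_mono sum_mono plane) auto
  also have "\<dots> = (2 + card T) * z ^ 6" by (simp add: algebra_simps)
  also have "\<dots> \<le> (2 + 40 / z ^ 5) * z ^ 6" using T z by (intro mult_right_mono) auto
  finally have bad: "measure_pmf.prob ?F {x. minor m x \<noteq> 0 \<and> Q (normal m x)} \<le> (2 + 40 / z ^ 5) * z ^ 6" .
  have "measure_pmf.prob (entry_law (Suc m) \<xi>) (first_singular m)
      = measure_pmf.prob (entry_law (Suc m) \<xi>)
          ({x \<in> first_singular m. Q (normal m x)} \<union> {x \<in> first_singular m. \<not> Q (normal m x)})"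
    by (rule arg_cong[where f = "measure_pmf.prob _"]) blast
  also have "\<dots> \<le> measure_pmf.prob (entry_law (Suc m) \<xi>) {x \<in> first_singular m. Q (normal m x)}
        + measure_pmf.prob (entry_law (Suc m) \<xi>) {x \<in> first_singular m. \<not> Q (normal m x)}"
    by (rule measure_Un_le) auto
  also have "\<dots> \<le> ((2 + 40 / z ^ 5) * z ^ 6) * z ^ 6 + 1 * z ^ 7"
  proof (rule add_mono)
    have "measure_pmf.prob (entry_law (Suc m) \<xi>) {x \<in> first_singular m. Q (normal m x)}
        \<le> measure_pmf.prob ?F {x. minor m x \<noteq> 0 \<and> Q (normal m x)} * z ^ 6"
      using special z by (intro prob_first_singular_where) auto
    also have "\<dots> \<le> ((2 + 40 / z ^ 5) * z ^ 6) * z ^ 6"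
      using bad z by (intro mult_right_mono) auto
    finally show "measure_pmf.prob (entry_law (Suc m) \<xi>) {x \<in> first_singular m. Q (normal m x)}
        \<le> ((2 + 40 / z ^ 5) * z ^ 6) * z ^ 6" .
    have "measure_pmf.prob (entry_law (Suc m) \<xi>) {x \<in> first_singular m. \<not> Q (normal m x)}
        \<le> measure_pmf.prob ?F {x. minor m x \<noteq> 0 \<and> \<not> Q (normal m x)} * z ^ 7"
      using generic z by (intro prob_first_singular_where) auto
    also have "\<dots> \<le> 1 * z ^ 7" using z by (intro mult_right_mono) auto
    finally show "measure_pmf.prob (entry_law (Suc m) \<xi>) {x \<in> first_singular m. \<not> Q (normal m x)} \<le> 1 * z ^ 7" .
  qed
  also have "\<dots> \<le> 43 * z ^ 7"
  proof -
    have "((2 + 40 / z ^ 5) * z ^ 6) * z ^ 6 = 2 * z ^ 12 + 40 * z ^ 7"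
      using z by (simp add: field_simps flip: power_add)
    moreover have "z ^ 12 \<le> z ^ 7" using z by (intro power_decreasing) auto
    ultimately show ?thesis by simp
  qed
  finally show ?thesis .
qed

text \<open>Either all atoms of the last row's product with the normal are below \<delta>, or the
  normal is a concentrated vector in the kernel of all \<open>n\<close> rows, the last one
  included.\<close>

lemma prob_first_singular_large:
  fixes \<xi> :: "nat \<Rightarrow> nat \<Rightarrow> real pmf" and m :: nat
  assumes atom: "\<And>i j x. i \<le> m \<Longrightarrow> j \<le> m \<Longrightarrow> pmf (\<xi> i j) x \<le> p" and p: "p \<le> 1/1000"
    and \<delta>: "0 < \<delta>" "(999/1000) ^ Suc D < \<delta>\<^sup>2" and n: "n = Suc m"
  shows "measure_pmf.prob (entry_law n \<xi>) (first_singular m)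
    \<le> \<delta> + (1 + real n * (real D + 1)) * (real n + 1) ^ (12 * D) * (499/500) ^ (n - 4 * D)"
proof -
  let ?Q = "\<lambda>v. max_atom (lsum (\<xi> m) {..<n} v) < \<delta>"
  let ?u = "\<lambda>r :: nat \<Rightarrow> nat \<Rightarrow> real. \<lambda>(i, j). r i j"
  let ?E = "{r. \<exists>v. (\<exists>j<n. v j \<noteq> 0) \<and> (\<exists>i<n. \<delta> \<le> max_atom (lsum (\<xi> i) {..<n} v)) \<and> (\<forall>i<n. dot n (r i) v = 0)}"
  have flat: "entry_law n \<xi> = map_pmf ?u (row_matrix n \<xi>)"
    unfolding entry_law_def row_matrix_def by (rule Pi_pmf_Times) auto
  have "measure_pmf.prob (entry_law n \<xi>) {x \<in> first_singular m. \<not> ?Q (normal m x)}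
      = measure_pmf.prob (row_matrix n \<xi>) (?u -` {x \<in> first_singular m. \<not> ?Q (normal m x)})"
    unfolding flat by simp
  also have "\<dots> \<le> measure_pmf.prob (row_matrix n \<xi>) ?E"
  proof (rule measure_pmf.finite_measure_mono)
    show "?u -` {x \<in> first_singular m. \<not> ?Q (normal m x)} \<subseteq> ?E"
    proof
      fix r assume "r \<in> ?u -` {x \<in> first_singular m. \<not> ?Q (normal m x)}"
      then have r: "minor m (?u r) \<noteq> 0" "minor (Suc m) (?u r) = 0"
        and c: "\<not> ?Q (normal m (?u r))" by (auto simp: first_singular_def)
      define v where "v = normal m (?u r)"
      have v: "v \<in> normal_vectors m (?u r)" unfolding v_def by (rule normal_in_normal_vectors[OF r(1)])
      have "dot n (r i) v = 0" if "i < n" for i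
      proof (cases "i = m")
        case True
        then show ?thesis using singular_step[OF r] by (simp add: dot_def n v_def)
      next
        case False
        then show ?thesis using v that by (auto simp: dot_def n normal_vectors_def)
      qed
      moreover have "v m \<noteq> 0" using v by (simp add: normal_vectors_def)
      moreover have "\<delta> \<le> max_atom (lsum (\<xi> m) {..<n} v)" using c by (simp add: v_def)
      ultimately show "r \<in> ?E" using n by blast
    qed
  qed simp
  also have "\<dots> \<le> (1 + real n * (real D + 1)) * (real n + 1) ^ (12 * D) * (499/500) ^ (n - 4 * D)"
    using atom by (intro prob_concentrated_kernel[OF _ p \<delta>]) (auto simp: n)
  finally have 1: "measure_pmf.prob (entry_law n \<xi>) {x \<in> first_singular m. \<not> ?Q (normal m x)}
      \<le> (1 + real n * (real D + 1)) * (real n + 1) ^ (12 * D) * (499/500) ^ (n - 4 * D)" .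
  have "measure_pmf.prob (entry_law (Suc m) \<xi>) {x \<in> first_singular m. ?Q (normal m x)}
      \<le> measure_pmf.prob (Pi_pmf ({..<m} \<times> {..<Suc m}) 0 (\<lambda>(i, j). \<xi> i j)) {x. minor m x \<noteq> 0 \<and> ?Q (normal m x)} * \<delta>"
  proof (rule prob_first_singular_where)
    fix v assume "?Q v"
    then show "pmf (lsum (\<xi> m) {..<Suc m} v) 0 \<le> \<delta>"
      using pmf_le_max_atom[of "lsum (\<xi> m) {..<Suc m} v" 0] by (simp only: n)
  qed (use \<delta> in simp)
  also have "\<dots> \<le> 1 * \<delta>" using \<delta> by (intro mult_right_mono) auto
  finally have 2: "measure_pmf.prob (entry_law n \<xi>) {x \<in> first_singular m. ?Q (normal m x)} \<le> \<delta>"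
    by (simp add: n)
  have "measure_pmf.prob (entry_law n \<xi>) (first_singular m)
      = measure_pmf.prob (entry_law n \<xi>) ({x \<in> first_singular m. ?Q (normal m x)} \<union> {x \<in> first_singular m. \<not> ?Q (normal m x)})"
    by (rule arg_cong[where f = "measure_pmf.prob _"]) blast
  also have "\<dots> \<le> measure_pmf.prob (entry_law n \<xi>) {x \<in> first_singular m. ?Q (normal m x)}
      + measure_pmf.prob (entry_law n \<xi>) {x \<in> first_singular m. \<not> ?Q (normal m x)}"
    by (rule measure_Un_le) auto
  finally show ?thesis using 1 2 by linarith
qed

text \<open>A factor of the form \<open>exp (O((ln n)^2))\<close> against exponential decay in
  \<open>n\<close>. The constant is \<open>56000 = 1000 * 2 * 28\<close>: it makes
  \<open>(999/1000) ^ Suc D\<close> smaller than the square of \<open>n powr (-28)\<close>.\<close>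

lemma large_bound_asymptotics:
  "\<exists>C. \<forall>n\<ge>1. let D = nat \<lceil>56000 * ln (real n)\<rceil> in
    (1 + real n * (real D + 1)) * (real n + 1) ^ (12 * D) * (499/500) ^ (n - 4 * D) \<le> C * real n powr (-28)"
proof -
  define g where "g x = (1 + x * (56000 * ln x + 2)) * exp (12 * (56000 * ln x + 1) * ln (x + 1))
    * exp (- ((x - 4 * (56000 * ln x + 1)) / 500)) * x powr 28" for x :: real
  \<comment> \<open>The decay \<open>exp (- x / 500)\<close> is split in halves: one beats the
    squared logarithm in the exponent, the other the polynomial factors.\<close>
  define g1 where "g1 x = exp (12 * (56000 * ln x + 1) * ln (x + 1) - x / 1000)" for x :: real
  define g2 where "g2 x = (1 + x * (56000 * ln x + 2)) * exp (- x / 1000 + 4 * (56000 * ln x + 1) / 500) * x powr 28"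
    for x :: real
  have "(g1 \<longlongrightarrow> 0) at_top" "(g2 \<longlongrightarrow> 0) at_top" unfolding g1_def g2_def by real_asymp+
  then have "((\<lambda>x. g1 x * g2 x) \<longlongrightarrow> 0 * 0) at_top" by (rule tendsto_mult)
  moreover have "g1 x * g2 x = g x" for x
  proof -
    define a b where "a = 12 * (56000 * ln x + 1) * ln (x + 1)" and "b = 4 * (56000 * ln x + 1)"
    have "- ((x - b) / 500) = (- x / 1000 + b / 500) - x / 1000" by (simp add: field_simps)
    then have "exp a * exp (- ((x - b) / 500)) = exp (a - x / 1000) * exp (- x / 1000 + b / 500)"
      by (simp flip: exp_add)
    then show ?thesis by (simp add: g_def g1_def g2_def a_def b_def mult_ac)
  qed
  ultimately have "(g \<longlongrightarrow> 0) at_top" by simp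
  then have "(\<lambda>n. g (real n)) \<longlonglongrightarrow> 0"
    by (rule filterlim_compose) (rule filterlim_real_sequentially)
  then have "Bseq (\<lambda>n. g (real n))" by (rule convergent_imp_Bseq[OF convergentI])
  then obtain C where C: "\<And>n. \<bar>g (real n)\<bar> \<le> C" by (auto simp: Bseq_def)
  have "let D = nat \<lceil>56000 * ln (real n)\<rceil> in
    (1 + real n * (real D + 1)) * (real n + 1) ^ (12 * D) * (499/500) ^ (n - 4 * D) \<le> C * real n powr (-28)"
    if n: "1 \<le> n" for n :: nat
  proof -
    define D where "D = nat \<lceil>56000 * ln (real n)\<rceil>"
    have D: "real D \<le> 56000 * ln n + 1" using n by (simp add: D_def)
    have "(real n + 1) ^ (12 * D) = exp (12 * real D * ln (real n + 1))"
      by (simp add: exp_of_nat_mult[symmetric] flip: powr_realpow) (simp add: powr_def)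
    also have "\<dots> \<le> exp (12 * (56000 * ln n + 1) * ln (n + 1))"
    proof -
      have "12 * real D * ln (real n + 1) \<le> 12 * (56000 * ln n + 1) * ln (real n + 1)"
        using D by (intro mult_right_mono mult_left_mono) auto
      then show ?thesis by (simp add: add.commute)
    qed
    finally have 1: "(real n + 1) ^ (12 * D) \<le> exp (12 * (56000 * ln n + 1) * ln (n + 1))" .
    have "(499/500 :: real) \<le> exp (- (1 / 500))" using exp_ge_add_one_self[of "- (1/500)"] by simp
    then have "(499/500 :: real) ^ (n - 4 * D) \<le> exp (- (1 / 500)) ^ (n - 4 * D)"
      by (rule power_mono) simp
    also have "\<dots> = exp (- (real (n - 4 * D) / 500))" by (simp flip: exp_of_nat_mult)
    also have "\<dots> \<le> exp (- ((n - 4 * (56000 * ln n + 1)) / 500))"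
      using D by simp
    finally have 2: "(499/500 :: real) ^ (n - 4 * D) \<le> exp (- ((n - 4 * (56000 * ln n + 1)) / 500))" .
    have "(1 + real n * (real D + 1)) * (real n + 1) ^ (12 * D) * (499/500) ^ (n - 4 * D)
        \<le> (1 + n * (56000 * ln n + 2)) * exp (12 * (56000 * ln n + 1) * ln (n + 1))
          * exp (- ((n - 4 * (56000 * ln n + 1)) / 500))"
    proof -
      have "1 + real n * (real D + 1) \<le> 1 + n * (56000 * ln n + 2)"
        using D by (intro add_left_mono mult_left_mono) auto
      then show ?thesis using 1 2 n by (intro mult_mono) auto
    qed
    also have "\<dots> = g (real n) * real n powr (-28)"
    proof -
      have "real n powr 28 * real n powr (-28) = 1"
        using n by (subst powr_add[symmetric]) simp
      then show ?thesis by (simp only: g_def mult.assoc mult_1_right of_nat_add of_nat_1)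
    qed
    also have "\<dots> \<le> C * real n powr (-28)"
      using C[of n] by (intro mult_right_mono) auto
    finally show ?thesis by (simp add: D_def Let_def)
  qed
  then show ?thesis by blast
qed

section \<open>Blocks of size one and two, and the union over all sizes\<close>

lemma minor_0: "minor 0 x = 1"
  by (simp add: minor_def)

lemma minor_1_eq_0_iff: "minor (Suc 0) x = 0 \<longleftrightarrow> x (0, 0) = 0"
proof -
  have "minor (Suc 0) x = 0 \<longleftrightarrow> (\<exists>v :: nat \<Rightarrow> real. v 0 \<noteq> 0 \<and> x (0, 0) * v 0 = 0)"
    by (simp add: minor_0_iff)
  also have "\<dots> \<longleftrightarrow> x (0, 0) = 0"
  proof
    assume "x (0, 0) = 0"
    then show "\<exists>v :: nat \<Rightarrow> real. v 0 \<noteq> 0 \<and> x (0, 0) * v 0 = 0" by (intro exI[of _ "\<lambda>_. 1"]) simp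
  qed auto
  finally show ?thesis .
qed

lemma minor_2_eq_0_iff: "minor (Suc (Suc 0)) x = 0 \<longleftrightarrow> x (0, 0) * x (1, 1) = x (0, 1) * x (1, 0)"
proof -
  define a b c d where "a = x (0, 0)" and "b = x (0, 1)" and "c = x (1, 0)" and "d = x (1, 1)"
  have iff: "minor (Suc (Suc 0)) x = 0
      \<longleftrightarrow> (\<exists>v :: nat \<Rightarrow> real. (v 0 \<noteq> 0 \<or> v 1 \<noteq> 0) \<and> a * v 0 + b * v 1 = 0 \<and> c * v 0 + d * v 1 = 0)"
  proof -
    have "(\<exists>j<Suc (Suc 0). v j \<noteq> 0) \<longleftrightarrow> v 0 \<noteq> 0 \<or> v 1 \<noteq> 0" for v :: "nat \<Rightarrow> real"
      by (auto simp: less_Suc_eq)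
    moreover have "(\<forall>i<Suc (Suc 0). P i) \<longleftrightarrow> P 0 \<and> P 1" for P by (auto simp: less_Suc_eq)
    ultimately show ?thesis unfolding minor_0_iff a_def b_def c_def d_def by simp
  qed
  have "a * d = b * c" if "v 0 \<noteq> 0 \<or> v 1 \<noteq> 0" "a * v 0 + b * v 1 = 0" "c * v 0 + d * v 1 = 0"
    for v :: "nat \<Rightarrow> real"
  proof -
    have "(a * d - b * c) * v 0 = d * (a * v 0 + b * v 1) - b * (c * v 0 + d * v 1)"
      "(a * d - b * c) * v 1 = a * (c * v 0 + d * v 1) - c * (a * v 0 + b * v 1)"
      by (simp_all add: algebra_simps)
    then show ?thesis using that by auto
  qed
  moreover have "\<exists>v :: nat \<Rightarrow> real. (v 0 \<noteq> 0 \<or> v 1 \<noteq> 0) \<and> a * v 0 + b * v 1 = 0 \<and> c * v 0 + d * v 1 = 0"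
    if eq: "a * d = b * c"
  proof -
    have mk: ?thesis if "y \<noteq> 0 \<or> z \<noteq> 0" "a * y + b * z = 0" "c * y + d * z = 0" for y z
      using that by (intro exI[of _ "\<lambda>j. if j = 0 then y else z"]) simp
    consider "a \<noteq> 0 \<or> b \<noteq> 0" | "a = 0" "b = 0" "c \<noteq> 0 \<or> d \<noteq> 0" | "a = 0" "b = 0" "c = 0" "d = 0" by blast
    then show ?thesis
    proof cases
      case 1
      then show ?thesis using eq by (intro mk[of "- b" a]) (auto simp: algebra_simps)
    next
      case 2
      then show ?thesis by (intro mk[of "- d" c]) (auto simp: algebra_simps)
    next
      case 3
      then show ?thesis by (intro mk[of 1 0]) auto
    qed
  qed
  ultimately show ?thesis unfolding iff a_def[symmetric] b_def[symmetric] c_def[symmetric] d_def[symmetric] by blast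
qed

lemma prob_first_singular_marginal:
  assumes "m < n"
  shows "measure_pmf.prob (entry_law n \<xi>) (first_singular m) = measure_pmf.prob (entry_law (Suc m) \<xi>) (first_singular m)"
proof -
  let ?S = "{..<Suc m} \<times> {..<Suc m}"
  let ?r = "\<lambda>f x. if x \<in> ?S then f x else (0 :: real)"
  have "?S \<subseteq> {..<n} \<times> {..<n}" using assms by auto
  then have "entry_law (Suc m) \<xi> = map_pmf ?r (entry_law n \<xi>)"
    unfolding entry_law_def by (intro Pi_pmf_subset) auto
  moreover have "?r -` first_singular m = first_singular m"
  proof -
    have "minor m (?r f) = minor m f" "minor (Suc m) (?r f) = minor (Suc m) f" for f
      by (rule minor_cong; simp)+
    then show ?thesis unfolding first_singular_def vimage_def by simp
  qed
  ultimately show ?thesis by simp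
qed

lemma prob_strongly_nonsingular_eq:
  "prob_strongly_nonsingular (indep_matrix n \<xi>) = measure_pmf.prob (entry_law n \<xi>) {x. \<forall>k\<in>{1..n}. minor k x \<noteq> 0}"
proof -
  have "leading_minor (mat n n x) k = minor k x" if "k \<le> n" for k x
    unfolding leading_minor_def minor_def using that by (intro arg_cong[where f = det] cong_mat) auto
  then have "strongly_nonsingular (mat n n x) \<longleftrightarrow> (\<forall>k\<in>{1..n}. minor k x \<noteq> 0)" for x
    by (simp add: strongly_nonsingular_def)
  then show ?thesis
    by (simp add: prob_strongly_nonsingular_def indep_matrix_def entry_law_def vimage_def lessThan_atLeast0)
qed

text \<open>As \<open>minor 0\<close> is 1, the least vanishing minor comes right after a non-zero
  one.\<close>

lemma prob_strongly_nonsingular_ge: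
  "1 - (\<Sum>m<n. measure_pmf.prob (entry_law (Suc m) \<xi>) (first_singular m)) \<le> prob_strongly_nonsingular (indep_matrix n \<xi>)"
proof -
  let ?G = "{x. \<forall>k\<in>{1..n}. minor k x \<noteq> 0}"
  have "1 - prob_strongly_nonsingular (indep_matrix n \<xi>) = measure_pmf.prob (entry_law n \<xi>) (- ?G)"
    using measure_pmf.prob_compl[of ?G "entry_law n \<xi>"] by (simp add: prob_strongly_nonsingular_eq Compl_eq_Diff_UNIV)
  also have "\<dots> \<le> measure_pmf.prob (entry_law n \<xi>) (\<Union>m\<in>{..<n}. first_singular m)"
  proof (rule measure_pmf.finite_measure_mono)
    show "- ?G \<subseteq> (\<Union>m\<in>{..<n}. first_singular m)"
    proof
      fix x assume "x \<in> - ?G"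
      then obtain k where k: "k \<le> n" "minor k x = 0" by auto
      define l where "l = (LEAST k. minor k x = 0)"
      have l: "minor l x = 0" unfolding l_def using k(2) by (rule LeastI)
      have "l \<le> k" unfolding l_def using k(2) by (rule Least_le)
      obtain m where m: "l = Suc m" using l minor_0[of x] by (cases l) auto
      have "minor m x \<noteq> 0" using not_less_Least[of m "\<lambda>k. minor k x = 0"] m by (simp add: l_def)
      then have "x \<in> first_singular m" using l m by (simp add: first_singular_def)
      then show "x \<in> (\<Union>m\<in>{..<n}. first_singular m)" using m \<open>l \<le> k\<close> k(1) by auto
    qed
  qed simp
  also have "\<dots> \<le> (\<Sum>m<n. measure_pmf.prob (entry_law n \<xi>) (first_singular m))"
    by (rule measure_UNION_le) auto
  also have "\<dots> = (\<Sum>m<n. measure_pmf.prob (entry_law (Suc m) \<xi>) (first_singular m))"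
    by (intro sum.cong refl prob_first_singular_marginal) simp
  finally show ?thesis by linarith
qed

text \<open>A first failure at size one and a first failure at size two are disjoint events;
  together they already have the full order \<open>5/3 * p\<close> for the extremal law.\<close>

lemma prob_strongly_nonsingular_le:
  assumes "2 \<le> n"
  shows "prob_strongly_nonsingular (indep_matrix n \<xi>)
    \<le> 1 - measure_pmf.prob (entry_law (Suc 0) \<xi>) (first_singular 0)
        - measure_pmf.prob (entry_law (Suc (Suc 0)) \<xi>) (first_singular (Suc 0))"
proof -
  let ?G = "{x. \<forall>k\<in>{1..n}. minor k x \<noteq> 0}" and ?P = "measure_pmf.prob (entry_law n \<xi>)"
  have "?P (first_singular 0) + ?P (first_singular (Suc 0)) = ?P (first_singular 0 \<union> first_singular (Suc 0))"
    by (rule measure_pmf.finite_measure_Union[symmetric]) (auto simp: first_singular_def)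
  also have "\<dots> \<le> ?P (- ?G)"
  proof (rule measure_pmf.finite_measure_mono)
    have "1 \<in> {1..n}" "2 \<in> {1..n}" using assms by auto
    then show "first_singular 0 \<union> first_singular (Suc 0) \<subseteq> - ?G"
      unfolding first_singular_def by (auto simp: numeral_2_eq_2)
  qed simp
  also have "\<dots> = 1 - ?P ?G"
    using measure_pmf.prob_compl[of ?G "entry_law n \<xi>"] by (simp add: Compl_eq_Diff_UNIV)
  finally show ?thesis
    using prob_first_singular_marginal[of 0 n \<xi>] prob_first_singular_marginal[of "Suc 0" n \<xi>] assms
    by (simp add: prob_strongly_nonsingular_eq)
qed

lemma prob_first_singular_0: "measure_pmf.prob (entry_law (Suc 0) \<xi>) (first_singular 0) = pmf (\<xi> 0 0) 0"
proof -
  have S: "{..<Suc 0} \<times> {..<Suc 0} = {(0, 0)}" by auto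
  have "first_singular 0 = {x. x (0, 0) = 0}" by (auto simp: first_singular_def minor_0 minor_1_eq_0_iff)
  then show ?thesis
    unfolding entry_law_def S Pi_pmf_singleton by (simp add: vimage_def measure_pmf_single)
qed

lemma entry_law_2:
  "map_pmf (\<lambda>x. ((x (0, 0), x (1, 1)), (x (0, 1), x (1, 0)))) (entry_law (Suc (Suc 0)) \<xi>)
    = pair_pmf (pair_pmf (\<xi> 0 0) (\<xi> 1 1)) (pair_pmf (\<xi> 0 1) (\<xi> 1 0))"
proof -
  have S: "{..<Suc (Suc 0)} \<times> {..<Suc (Suc 0)} = insert (0, 0) (insert (1, 1) (insert (0, 1) (insert (1, 0) {})))"
    by (auto simp: less_Suc_eq)
  show ?thesis
    unfolding entry_law_def S
    by (subst Pi_pmf_insert', simp, simp)+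
       (simp add: pair_pmf_def map_pmf_def bind_assoc_pmf bind_return_pmf)
qed

lemma prob_first_singular_1_le:
  assumes "\<And>i j x. i \<le> 1 \<Longrightarrow> j \<le> 1 \<Longrightarrow> pmf (\<xi> i j) x \<le> p" "0 < p" "p \<le> 1 / 8"
  shows "measure_pmf.prob (entry_law (Suc (Suc 0)) \<xi>) (first_singular (Suc 0)) \<le> 2 / 3 * p + 64 * p\<^sup>2"
proof -
  let ?g = "\<lambda>x :: nat \<times> nat \<Rightarrow> real. ((x (0, 0), x (1, 1)), (x (0, 1), x (1, 0)))"
  let ?E = "{z :: (real \<times> real) \<times> (real \<times> real). fst (fst z) * snd (fst z) = fst (snd z) * snd (snd z)}"
  have "measure_pmf.prob (entry_law (Suc (Suc 0)) \<xi>) (first_singular (Suc 0))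
      \<le> measure_pmf.prob (entry_law (Suc (Suc 0)) \<xi>) (?g -` ?E)"
    by (rule measure_pmf.finite_measure_mono) (auto simp: first_singular_def minor_2_eq_0_iff)
  also have "\<dots> = measure_pmf.prob (map_pmf ?g (entry_law (Suc (Suc 0)) \<xi>)) ?E"
    by (rule measure_map_pmf[symmetric])
  also have "\<dots> \<le> 2 / 3 * p + 64 * p\<^sup>2"
    unfolding entry_law_2 using assms by (intro two_by_two_singular) auto
  finally show ?thesis .
qed

lemma prob_first_singular_decay:
  "\<exists>K\<ge>0. \<forall>p m. \<forall>\<xi> :: nat \<Rightarrow> nat \<Rightarrow> real pmf. 0 < p \<longrightarrow> p \<le> 1 / 10 ^ 6 \<longrightarrow> 2 \<le> m
    \<longrightarrow> (\<forall>i\<le>m. \<forall>j\<le>m. \<forall>x. pmf (\<xi> i j) x \<le> p)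
    \<longrightarrow> measure_pmf.prob (entry_law (Suc m) \<xi>) (first_singular m) \<le> K * p powr (13/12) * (1 / (real (Suc m))\<^sup>2)"
proof -
  obtain C where C: "\<forall>n\<ge>1. let D = nat \<lceil>56000 * ln (real n)\<rceil> in
    (1 + real n * (real D + 1)) * (real n + 1) ^ (12 * D) * (499/500) ^ (n - 4 * D) \<le> C * real n powr (-28)"
    using large_bound_asymptotics by blast
  define K where "K = max 43 (1 + C)"
  have K: "43 \<le> K" "1 + C \<le> K" by (auto simp: K_def)
  have "measure_pmf.prob (entry_law (Suc m) \<xi>) (first_singular m) \<le> K * p powr (13/12) * (1 / (real (Suc m))\<^sup>2)"
    if p: "0 < p" "p \<le> 1 / 10 ^ 6" and m: "2 \<le> m" and atom: "\<forall>i\<le>m. \<forall>j\<le>m. \<forall>x. pmf (\<xi> i j) x \<le> p"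
    for p m and \<xi> :: "nat \<Rightarrow> nat \<Rightarrow> real pmf"
  proof -
    define a where "a = measure_pmf.prob (entry_law (Suc m) \<xi>) (first_singular m)"
    define n where "n = Suc m"
    have n: "0 < real n" "1 \<le> n" by (auto simp: n_def)
    \<comment> \<open>Integral powers of \<open>z\<close> stand for fractional powers of
      \<open>p\<close>; the assumption \<open>p \<le> 1 / 10 ^ 6\<close> becomes
      \<open>z \<le> 1/10\<close>.\<close>
    define z where "z = p powr (1/6)"
    have z6: "z ^ 6 = p" using p by (simp add: z_def powr_power)
    have z0: "0 < z" using p by (simp add: z_def)
    have z1: "z \<le> 1/10"
    proof (rule power_le_imp_le_base[of _ 5])
      show "z ^ Suc 5 \<le> (1/10) ^ Suc 5" using z6 p by (simp add: power_one_over)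
    qed simp
    have "a \<le> 43 * z ^ 7"
      unfolding a_def using atom by (intro prob_first_singular_small[OF m _ z0 z1]) (auto simp: z6)
    also have "z ^ 7 = p powr (7/6)" using p by (simp add: z_def powr_power)
    also have "43 * p powr (7/6) \<le> K * p powr (7/6)" using K by (intro mult_right_mono) auto
    finally have small: "a \<le> K * p powr (7/6)" .
    define D where "D = nat \<lceil>56000 * ln (real n)\<rceil>"
    have D: "56000 * ln (real n) \<le> real D" by (simp add: D_def real_nat_ceiling_ge)
    have "(999/1000 :: real) ^ Suc D < (real n powr (-28))\<^sup>2"
    proof -
      have "(999/1000 :: real) \<le> exp (- (1/1000))" using exp_ge_add_one_self[of "- (1/1000)"] by simp
      then have "(999/1000 :: real) ^ Suc D \<le> exp (- (1/1000)) ^ Suc D" by (rule power_mono) simp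
      also have "\<dots> = exp (- ((real D + 1) / 1000))"
        unfolding exp_of_nat_mult[symmetric] by (rule arg_cong[where f = exp]) simp
      also have "\<dots> < exp (- 56 * ln (real n))" using D by simp
      also have "\<dots> = (real n powr (-28))\<^sup>2" using n by (simp add: powr_def flip: exp_double)
      finally show ?thesis .
    qed
    note D_large = this
    have "measure_pmf.prob (entry_law n \<xi>) (first_singular m)
        \<le> real n powr (-28) + (1 + real n * (real D + 1)) * (real n + 1) ^ (12 * D) * (499/500) ^ (n - 4 * D)"
    proof (rule prob_first_singular_large[OF _ _ _ D_large n_def])
      show "pmf (\<xi> i j) x \<le> p" if "i \<le> m" "j \<le> m" for i j x using atom that by blast
      show "p \<le> 1/1000" using p(2) by simp
      show "0 < real n powr (-28)" using n(1) by simp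
    qed
    then have "a \<le> real n powr (-28) + (1 + real n * (real D + 1)) * (real n + 1) ^ (12 * D) * (499/500) ^ (n - 4 * D)"
      unfolding a_def n_def[symmetric] .
    also have "\<dots> \<le> (1 + C) * real n powr (-28)"
      using C[rule_format, OF n(2)] by (simp add: D_def Let_def distrib_right)
    also have "\<dots> \<le> K * real n powr (-28)" using K by (intro mult_right_mono) auto
    finally have large: "a \<le> K * real n powr (-28)" .
    have a0: "0 \<le> a" by (simp add: a_def)
    \<comment> \<open>Interpolation of \<open>small\<close> and \<open>large\<close>:
      \<open>7/6 * 13/14 = 13/12\<close> still exceeds 1, and \<open>28/14 = 2\<close> suffices for
      summation over \<open>m\<close>.\<close>
    have "a = a powr (13/14) * a powr (1/14)" using a0 by (cases "a = 0") (auto simp flip: powr_add)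
    also have "\<dots> \<le> (K * p powr (7/6)) powr (13/14) * (K * real n powr (-28)) powr (1/14)"
      using small large a0 by (intro mult_mono powr_mono2) auto
    also have "\<dots> = (K powr (13/14) * K powr (1/14)) * (p powr (7/6 * (13/14))) * (real n powr (-28 * (1/14)))"
      using K by (simp only: powr_mult powr_powr mult_ac)
    also have "K powr (13/14) * K powr (1/14) = K" using K by (simp flip: powr_add)
    also have "p powr (7/6 * (13/14)) = p powr (13/12)" by simp
    also have "real n powr (-28 * (1/14)) = 1 / (real n)\<^sup>2"
      using n by (simp add: powr_minus_divide powr_numeral)
    finally show ?thesis by (simp only: a_def n_def)
  qed
  then show ?thesis using K by (intro exI[of _ K]) auto
qed

lemma prob_strongly_nonsingular_lower_bound:
  "\<exists>K\<ge>0. \<forall>p n. \<forall>\<xi>. 0 < p \<longrightarrow> p \<le> 1 / 10 ^ 6 \<longrightarrow> entries_bounded n p \<xi>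
    \<longrightarrow> 1 - 5/3 * p - K * p powr (13/12) \<le> prob_strongly_nonsingular (indep_matrix n \<xi>)"
proof -
  obtain K where K: "0 \<le> K" and decay: "\<forall>p m. \<forall>\<xi> :: nat \<Rightarrow> nat \<Rightarrow> real pmf. 0 < p \<longrightarrow> p \<le> 1 / 10 ^ 6 \<longrightarrow> 2 \<le> m
    \<longrightarrow> (\<forall>i\<le>m. \<forall>j\<le>m. \<forall>x. pmf (\<xi> i j) x \<le> p)
    \<longrightarrow> measure_pmf.prob (entry_law (Suc m) \<xi>) (first_singular m) \<le> K * p powr (13/12) * (1 / (real (Suc m))\<^sup>2)"
    using prob_first_singular_decay by blast
  have summ: "summable (\<lambda>m. 1 / (real (Suc m))\<^sup>2)"
    using inverse_squares_sums by (auto simp: sums_iff add.commute)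
  define S where "S = (\<Sum>m. 1 / (real (Suc m))\<^sup>2)"
  have S: "(\<Sum>m<n. 1 / (real (Suc m))\<^sup>2) \<le> S" for n
    unfolding S_def using summ by (intro sum_le_suminf) auto
  have S0: "0 \<le> S" using S[of 0] by simp
  have "1 - 5/3 * p - (64 + K * S) * p powr (13/12) \<le> prob_strongly_nonsingular (indep_matrix n \<xi>)"
    if p: "0 < p" "p \<le> 1 / 10 ^ 6" and ent: "entries_bounded n p \<xi>" for p n \<xi>
  proof -
    let ?a = "\<lambda>m. measure_pmf.prob (entry_law (Suc m) \<xi>) (first_singular m)"
    let ?q = "p powr (13/12)"
    have atom: "pmf (\<xi> i j) x \<le> p" if "i < n" "j < n" for i j x
      using ent that pmf_le_max_atom[of "\<xi> i j" x] by (auto simp: entries_bounded_def intro: order_trans)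
    define c where "c m = (if m = 0 then p else if m = 1 then 2 / 3 * p + 64 * ?q else 0)" for m :: nat
    have step: "?a m \<le> c m + K * ?q * (1 / (real (Suc m))\<^sup>2)" if m: "m < n" for m
    proof -
      have e: "0 \<le> K * ?q * (1 / (real (Suc m))\<^sup>2)" using K by simp
      consider "m = 0" | "m = 1" | "2 \<le> m" by linarith
      then show ?thesis
      proof cases
        case 1
        then have "?a m \<le> p" using m atom[of 0 0 0] by (simp add: prob_first_singular_0)
        then show ?thesis using e 1 by (simp add: c_def)
      next
        case 2
        have "?a m \<le> 2 / 3 * p + 64 * p\<^sup>2"
          unfolding 2 One_nat_def using p m 2 by (intro prob_first_singular_1_le atom) auto
        also have "p\<^sup>2 \<le> ?q"
        proof -
          have "p\<^sup>2 = p powr 2" using p by simp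
          also have "\<dots> \<le> ?q" using p by (intro powr_mono') auto
          finally show ?thesis .
        qed
        finally show ?thesis using e 2 by (simp add: c_def)
      next
        case 3
        then show ?thesis using decay[rule_format, OF p 3, of \<xi>] atom m by (simp add: c_def)
      qed
    qed
    have c_sum: "(\<Sum>m<n. c m) \<le> 5/3 * p + 64 * ?q"
    proof -
      \<comment> \<open>The range is enlarged so that it contains \<open>0\<close> and
        \<open>1\<close> also when \<open>n < 2\<close>.\<close>
      have "(\<Sum>m<n. c m) \<le> (\<Sum>m<n + 2. c m)"
        using p by (intro sum_mono2) (auto simp: c_def)
      also have "\<dots> = (\<Sum>m\<in>{0, 1}. c m)" by (intro sum.mono_neutral_right) (auto simp: c_def)
      finally show ?thesis by (simp add: c_def)
    qed
    have "(\<Sum>m<n. ?a m) \<le> (\<Sum>m<n. c m + K * ?q * (1 / (real (Suc m))\<^sup>2))"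
      by (intro sum_mono step) simp
    also have "\<dots> = (\<Sum>m<n. c m) + K * ?q * (\<Sum>m<n. 1 / (real (Suc m))\<^sup>2)"
      by (simp only: sum.distrib sum_distrib_left)
    also have "\<dots> \<le> (5/3 * p + 64 * ?q) + K * ?q * S"
      using K by (intro add_mono c_sum mult_left_mono S) simp
    finally have "(\<Sum>m<n. ?a m) \<le> 5/3 * p + (64 + K * S) * ?q" by (simp add: algebra_simps)
    then show ?thesis using prob_strongly_nonsingular_ge[where n = n and \<xi> = \<xi>] by linarith
  qed
  then show ?thesis using K S0 by (intro exI[of _ "64 + K * S"]) auto
qed

section \<open>Powers of two\<close>

text \<open>With truncated subtraction \<open>(j - i) + (i - j)\<close> is the distance of
  \<open>i\<close> and \<open>j\<close>. A new index adds its distances to all earlier ones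
  twice.\<close>

lemma sum_distances: "(\<Sum>i<N. \<Sum>j<N. real ((j - i) + (i - j))) = (real N ^ 3 - real N) / 3"
proof (induction N)
  case (Suc N)
  let ?d = "\<lambda>i j. real ((j - i) + (i - j))"
  have gauss: "(\<Sum>i<N. real (N - i)) = real N * (real N + 1) / 2"
  proof -
    have "(\<Sum>i<N. real (N - i)) = (\<Sum>i<N. real N - real i)" by (intro sum.cong) auto
    also have "\<dots> = real N * real N - (\<Sum>i<N. real i)" by (simp add: sum_subtractf)
    also have "(\<Sum>i<N. real i) = real N * (real N - 1) / 2" by (induction N) (auto simp: field_simps)
    finally show ?thesis by (simp add: field_simps)
  qed
  have "(\<Sum>i<Suc N. \<Sum>j<Suc N. ?d i j) = (\<Sum>i<N. (\<Sum>j<N. ?d i j) + real (N - i)) + (\<Sum>j<N. real (N - j))"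
    by simp
  also have "\<dots> = (\<Sum>i<N. \<Sum>j<N. ?d i j) + 2 * (\<Sum>i<N. real (N - i))"
    by (simp add: sum.distrib)
  also have "\<dots> = (real (Suc N) ^ 3 - real (Suc N)) / 3"
    unfolding Suc.IH gauss by (simp add: power3_eq_cube field_simps)
  finally show ?case .
qed simp

text \<open>The exponents solve \<open>i + a = j + b\<close> with all four below \<open>N\<close>.
  For given \<open>i\<close> and \<open>j\<close> the number \<open>k = min a b\<close> has
  \<open>N\<close> minus their distance many choices, in total at least
  \<open>2 / 3 * N ^ 3\<close>.\<close>

lemma prob_powers_of_two_quadruples:
  fixes N :: nat and L :: "real pmf"
  assumes L: "L = pmf_of_set ((\<lambda>j. 2 ^ j) ` {..<N} \<union> {0})"
  shows "2 / 3 * real N ^ 3 / real (N + 1) ^ 4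
    \<le> measure_pmf.prob (pair_pmf (pair_pmf L L) (pair_pmf L L))
        {z. fst (fst z) \<noteq> 0 \<and> fst (fst z) * snd (fst z) = fst (snd z) * snd (snd z)}"
proof -
  let ?S = "(\<lambda>j. 2 ^ j) ` {..<N} \<union> {0 :: real}"
  have inj2: "inj_on (\<lambda>j :: nat. (2 :: real) ^ j) A" for A by (auto simp: inj_on_def)
  have card: "card ?S = N + 1"
  proof -
    have "(0 :: real) \<notin> (\<lambda>j. 2 ^ j) ` {..<N}" by auto
    then show ?thesis by (simp add: card_image[OF inj2])
  qed
  have pmf_L: "pmf L (2 ^ j) = 1 / real (N + 1)" if "j < N" for j
    unfolding L using that card by (subst pmf_of_set) auto
  define A where "A = (SIGMA i:{..<N}. SIGMA j:{..<N}. {..<N - ((j - i) + (i - j))})"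
  define F where "F = (\<lambda>(i :: nat, j :: nat, k :: nat).
    (((2 :: real) ^ i, (2 :: real) ^ (k + (j - i))), ((2 :: real) ^ j, (2 :: real) ^ (k + (i - j)))))"
  have injF: "inj_on F A"
  proof (rule inj_onI)
    fix x y assume eq: "F x = F y"
    obtain i j k i' j' k' where xy: "x = (i, j, k)" "y = (i', j', k')" by (metis surj_pair)
    then have "i = i' \<and> j = j' \<and> k + (j - i) = k' + (j' - i')" using eq by (auto simp: F_def)
    moreover from this have "k = k'" by (elim conjE) simp
    ultimately show "x = y" using xy by simp
  qed
  have finA: "finite A" by (simp add: A_def)
  have cardA: "real (card A) = real N ^ 3 - (real N ^ 3 - real N) / 3"
  proof -
    have "real (card A) = (\<Sum>i<N. \<Sum>j<N. real (N - ((j - i) + (i - j))))"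
      by (simp add: A_def)
    also have "\<dots> = (\<Sum>i<N. \<Sum>j<N. real N - real ((j - i) + (i - j)))"
      by (intro sum.cong refl) auto
    also have "\<dots> = real N * (real N * real N) - (\<Sum>i<N. \<Sum>j<N. real ((j - i) + (i - j)))"
      by (simp add: sum_subtractf)
    also have "\<dots> = real N ^ 3 - (real N ^ 3 - real N) / 3"
      unfolding sum_distances by (simp add: power3_eq_cube)
    finally show ?thesis .
  qed
  have pmfF: "pmf (pair_pmf (pair_pmf L L) (pair_pmf L L)) (F x) = (1 / real (N + 1)) ^ 4" if "x \<in> A" for x
  proof -
    obtain i j k where x: "x = (i, j, k)" by (metis surj_pair)
    then have "i < N" "j < N" "k + (j - i) < N" "k + (i - j) < N" using that by (auto simp: A_def)
    then show ?thesis by (simp add: x F_def pmf_pair pmf_L power4_eq_xxxx)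
  qed
  have "2 / 3 * real N ^ 3 / real (N + 1) ^ 4 \<le> real (card A) * (1 / real (N + 1)) ^ 4"
    unfolding cardA by (simp add: power_one_over divide_right_mono field_simps)
  also have "\<dots> = (\<Sum>x\<in>A. pmf (pair_pmf (pair_pmf L L) (pair_pmf L L)) (F x))"
    using pmfF by simp
  also have "\<dots> = measure_pmf.prob (pair_pmf (pair_pmf L L) (pair_pmf L L)) (F ` A)"
    using finA by (simp add: measure_measure_pmf_finite sum.reindex[OF injF])
  also have "\<dots> \<le> measure_pmf.prob (pair_pmf (pair_pmf L L) (pair_pmf L L))
      {z. fst (fst z) \<noteq> 0 \<and> fst (fst z) * snd (fst z) = fst (snd z) * snd (snd z)}"
  proof (rule measure_pmf.finite_measure_mono)
    show "F ` A \<subseteq> {z. fst (fst z) \<noteq> 0 \<and> fst (fst z) * snd (fst z) = fst (snd z) * snd (snd z)}"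
      by (auto simp: F_def simp flip: power_add)
  qed simp
  finally show ?thesis .
qed

lemma powers_of_two_law:
  assumes "0 < p" "p < 1"
  shows "max_atom (powers_of_two_law p) \<le> p"
    and "2 \<le> n \<Longrightarrow> prob_strongly_nonsingular (iid_matrix n (powers_of_two_law p)) \<le> 1 - 5/3 * p + 6 * p\<^sup>2"
proof -
  \<comment> \<open>There are \<open>N\<close> powers of two, and \<open>0\<close> is one more
    value, so each atom is \<open>q\<close>, which lies between \<open>p - 2 * p\<^sup>2\<close> and
    \<open>p\<close>.\<close>
  define N where "N = Suc (nat \<lfloor>1 / p\<rfloor>)"
  define L where "L = powers_of_two_law p"
  define q where "q = 1 / real (N + 1)"
  have "{0..nat \<lfloor>1 / p\<rfloor>} = {..<N}" by (auto simp: N_def)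
  then have L: "L = pmf_of_set ((\<lambda>j. 2 ^ j) ` {..<N} \<union> {0})" by (simp add: L_def powers_of_two_law_def)
  let ?S = "(\<lambda>j. 2 ^ j) ` {..<N} \<union> {0 :: real}"
  have card: "card ?S = N + 1"
  proof -
    have "(0 :: real) \<notin> (\<lambda>j. 2 ^ j) ` {..<N}" by auto
    moreover have "inj_on (\<lambda>j :: nat. (2 :: real) ^ j) {..<N}" by (auto simp: inj_on_def)
    ultimately show ?thesis by (simp add: card_image)
  qed
  have pmf_L: "pmf L x = indicator ?S x * q" for x
    unfolding L q_def using card by (subst pmf_of_set) auto
  have "0 \<le> \<lfloor>1 / p\<rfloor>" using assms by simp
  then have "real N = of_int \<lfloor>1 / p\<rfloor> + 1" by (simp add: N_def)
  then have N: "1 / p < real N" "real N \<le> 1 / p + 1"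
    using real_of_int_floor_add_one_gt[of "1 / p"] of_int_floor_le[of "1 / p"] by linarith+
  have q_le: "q \<le> p"
  proof -
    have "1 \<le> p * real (N + 1)" using N(1) assms by (simp add: field_simps)
    then show ?thesis by (simp add: q_def field_simps)
  qed
  have q0: "0 < q" by (simp add: q_def)
  have q_ge: "p - 2 * p\<^sup>2 \<le> q"
  proof -
    have "(p - 2 * p\<^sup>2) * real (N + 1) \<le> 1"
    proof (cases "p - 2 * p\<^sup>2 \<le> 0")
      case False
      then have "(p - 2 * p\<^sup>2) * real (N + 1) \<le> (p - 2 * p\<^sup>2) * (1 / p + 2)"
        using N by (intro mult_left_mono) auto
      also have "\<dots> = 1 - 4 * p\<^sup>2" using assms by (simp add: field_simps power2_eq_square)
      finally show ?thesis by (smt (verit) zero_le_power2)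
    next
      case True
      then have "(p - 2 * p\<^sup>2) * real (N + 1) \<le> 0" by (intro mult_nonpos_nonneg) auto
      then show ?thesis by linarith
    qed
    then show ?thesis by (simp add: q_def field_simps)
  qed
  show "max_atom (powers_of_two_law p) \<le> p"
    using q_le q0 by (intro max_atom_le) (simp add: pmf_L[unfolded L_def] indicator_def assms less_imp_le)
  assume n: "2 \<le> n"
  let ?\<xi> = "\<lambda>_ _. L"
  let ?g = "\<lambda>x :: nat \<times> nat \<Rightarrow> real. ((x (0, 0), x (1, 1)), (x (0, 1), x (1, 0)))"
  let ?E = "{z :: (real \<times> real) \<times> (real \<times> real). fst (fst z) \<noteq> 0 \<and> fst (fst z) * snd (fst z) = fst (snd z) * snd (snd z)}"
  have P0: "measure_pmf.prob (entry_law (Suc 0) ?\<xi>) (first_singular 0) = q"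
    by (simp add: prob_first_singular_0 pmf_L)
  \<comment> \<open>The right-hand side is \<open>2 / 3 * q * (1 - q) ^ 3\<close>, to which
    Bernoulli's inequality applies.\<close>
  have "2 / 3 * (q * (1 - 3 * q)) \<le> 2 / 3 * real N ^ 3 / real (N + 1) ^ 4"
  proof -
    have "real N = (1 - q) * real (N + 1)" by (simp add: q_def field_simps)
    then have "real N ^ 3 / real (N + 1) ^ 4 = (1 - q) ^ 3 * real (N + 1) ^ 3 / real (N + 1) ^ 4"
      by (metis power_mult_distrib)
    also have "\<dots> = (1 - q) ^ 3 * q" by (simp add: q_def power_def numeral_eq_Suc)
    finally have "real N ^ 3 / real (N + 1) ^ 4 = (1 - q) ^ 3 * q" .
    moreover have "(1 - 3 * q) * q \<le> (1 - q) ^ 3 * q"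
    proof (rule mult_right_mono)
      have "(1 - q) ^ 3 - (1 - 3 * q) = q\<^sup>2 * (3 - q)" by (simp add: power2_eq_square power3_eq_cube algebra_simps)
      moreover have "0 \<le> q\<^sup>2 * (3 - q)" using q_le assms by (intro mult_nonneg_nonneg) auto
      ultimately show "1 - 3 * q \<le> (1 - q) ^ 3" by linarith
    qed (use q0 in simp)
    ultimately show ?thesis by (simp add: mult.commute)
  qed
  also have "\<dots> \<le> measure_pmf.prob (pair_pmf (pair_pmf L L) (pair_pmf L L)) ?E"
    by (rule prob_powers_of_two_quadruples[OF L])
  also have "\<dots> = measure_pmf.prob (map_pmf ?g (entry_law (Suc (Suc 0)) ?\<xi>)) ?E"
    by (simp only: entry_law_2)
  also have "\<dots> = measure_pmf.prob (entry_law (Suc (Suc 0)) ?\<xi>) (?g -` ?E)"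
    by (rule measure_map_pmf)
  also have "?g -` ?E = first_singular (Suc 0)"
    by (auto simp: first_singular_def minor_1_eq_0_iff minor_2_eq_0_iff)
  finally have P1: "2 / 3 * (q * (1 - 3 * q)) \<le> measure_pmf.prob (entry_law (Suc (Suc 0)) ?\<xi>) (first_singular (Suc 0))" .
  have "q * q \<le> p\<^sup>2" using q_le q0 by (auto simp: power2_eq_square intro: mult_mono)
  moreover have "prob_strongly_nonsingular (iid_matrix n L) \<le> 1 - q - 2 / 3 * (q * (1 - 3 * q))"
    unfolding iid_matrix_def using prob_strongly_nonsingular_le[OF n, of ?\<xi>] P0 P1 by linarith
  moreover have "2 / 3 * (q * (1 - 3 * q)) = 2 / 3 * q - 2 * (q * q)" by (simp add: algebra_simps)
  \<comment> \<open>The errors from \<open>q \<ge> p - 2 * p\<^sup>2\<close> and from the term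
    \<open>2 * (q * q)\<close> add up to \<open>5/3 * 2 + 2 \<le> 6\<close>.\<close>
  ultimately show "prob_strongly_nonsingular (iid_matrix n (powers_of_two_law p)) \<le> 1 - 5/3 * p + 6 * p\<^sup>2"
    using q_ge zero_le_power2[of p] unfolding L_def[symmetric] by linarith
qed

section \<open>Strong non-singularity\<close>

theorem theorem1p3:
  shows "\<exists>\<alpha>>0. \<exists>C::real.
    (\<forall>n\<ge>1. \<forall>p\<in>{0<..<1}. \<forall>\<xi>. entries_bounded n p \<xi> \<longrightarrow>
       prob_strongly_nonsingular (indep_matrix n \<xi>) \<ge> 1 - 5 / 3 * p - C * p powr (1 + \<alpha>)) \<and>
    (\<forall>n\<ge>2. \<forall>p\<in>{0<..<1}. \<exists>\<xi>. entries_bounded n p \<xi> \<and>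
       prob_strongly_nonsingular (indep_matrix n \<xi>) \<le> 1 - 5 / 3 * p + C * p powr (1 + \<alpha>)) \<and>
    (\<forall>n\<ge>2. \<forall>p\<in>{0<..<1}.
       \<bar>prob_strongly_nonsingular (iid_matrix n (powers_of_two_law p)) - (1 - 5 / 3 * p)\<bar>
         \<le> C * p powr (1 + \<alpha>))"
proof -
  obtain K where K: "0 \<le> K" and small: "\<forall>p n. \<forall>\<xi>. 0 < p \<longrightarrow> p \<le> 1 / 10 ^ 6 \<longrightarrow> entries_bounded n p \<xi>
    \<longrightarrow> 1 - 5/3 * p - K * p powr (13/12) \<le> prob_strongly_nonsingular (indep_matrix n \<xi>)"
    using prob_strongly_nonsingular_lower_bound by blast
  \<comment> \<open>For \<open>p > 1 / 10 ^ 6\<close> the lower bound is trivial: there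
    \<open>p powr (13/12) \<ge> p\<^sup>2 \<ge> 1 / 10 ^ 12\<close>, so the factor
    \<open>10 ^ 12\<close> makes it at most \<open>0\<close>. The \<open>6\<close> serves the upper
    bound.\<close>
  define C where "C = max (max 6 K) (10 ^ 12)"
  have C: "6 \<le> C" "K \<le> C" "10 ^ 12 \<le> C" by (auto simp: C_def)
  have sq: "p\<^sup>2 \<le> p powr (13/12)" if "0 < p" "p < 1" for p :: real
  proof -
    have "p\<^sup>2 = p powr 2" using that by simp
    also have "\<dots> \<le> p powr (13/12)" using that by (intro powr_mono') auto
    finally show ?thesis .
  qed
  have lower: "1 - 5/3 * p - C * p powr (13/12) \<le> prob_strongly_nonsingular (indep_matrix n \<xi>)"
    if p: "0 < p" "p < 1" and ent: "entries_bounded n p \<xi>" for n p \<xi>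
  proof (cases "p \<le> 1 / 10 ^ 6")
    case True
    have "K * p powr (13/12) \<le> C * p powr (13/12)" using C by (intro mult_right_mono) auto
    then show ?thesis using small[rule_format, OF p(1) True ent] by linarith
  next
    case False
    have "(1 / 10 ^ 6)\<^sup>2 \<le> p\<^sup>2" using False by (intro power_mono) auto
    then have "1 / 10 ^ 12 \<le> p powr (13/12)" using sq[OF p] by (simp add: power_divide)
    then have "10 ^ 12 * (1 / 10 ^ 12) \<le> C * p powr (13/12)" using C by (intro mult_mono) auto
    then have "1 - 5/3 * p - C * p powr (13/12) \<le> 0" using p by simp
    also have "0 \<le> prob_strongly_nonsingular (indep_matrix n \<xi>)" by (simp add: prob_strongly_nonsingular_def)
    finally show ?thesis .
  qed
  have ent: "entries_bounded n p (\<lambda>_ _. powers_of_two_law p)" if "0 < p" "p < 1" for n p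
    using powers_of_two_law(1)[OF that] by (simp add: entries_bounded_def)
  have upper: "prob_strongly_nonsingular (iid_matrix n (powers_of_two_law p)) \<le> 1 - 5/3 * p + C * p powr (13/12)"
    if "2 \<le> n" "0 < p" "p < 1" for n p
  proof -
    have "6 * p\<^sup>2 \<le> C * p powr (13/12)" using C sq that by (intro mult_mono) auto
    then show ?thesis using powers_of_two_law(2)[OF that(2,3,1)] by linarith
  qed
  show ?thesis
  proof (rule exI[of _ "1/12 :: real"], intro conjI exI[of _ C] allI ballI impI)
    fix n p \<xi> assume "p \<in> {0<..<1 :: real}" "entries_bounded n p \<xi>"
    then show "1 - 5 / 3 * p - C * p powr (1 + 1/12) \<le> prob_strongly_nonsingular (indep_matrix n \<xi>)"
      using lower[of p n \<xi>] by simp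
  next
    fix n :: nat and p assume "2 \<le> n" "p \<in> {0<..<1 :: real}"
    then show "\<exists>\<xi>. entries_bounded n p \<xi> \<and>
       prob_strongly_nonsingular (indep_matrix n \<xi>) \<le> 1 - 5 / 3 * p + C * p powr (1 + 1/12)"
      using upper[of n p] ent[of p n] by (intro exI[of _ "\<lambda>_ _. powers_of_two_law p"]) (simp add: iid_matrix_def)
  next
    fix n :: nat and p assume n: "2 \<le> n" and p: "p \<in> {0<..<1 :: real}"
    then have "1 - 5 / 3 * p - C * p powr (13/12) \<le> prob_strongly_nonsingular (iid_matrix n (powers_of_two_law p))"
      unfolding iid_matrix_def using ent[of p n] by (intro lower) auto
    with upper[of n p] n p
    have "\<bar>prob_strongly_nonsingular (iid_matrix n (powers_of_two_law p)) - (1 - 5 / 3 * p)\<bar> \<le> C * p powr (13/12)"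
      by (simp add: abs_le_iff)
    then show "\<bar>prob_strongly_nonsingular (iid_matrix n (powers_of_two_law p)) - (1 - 5 / 3 * p)\<bar>
         \<le> C * p powr (1 + 1/12)"
      by simp
  qed simp
qed

end
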